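(* Let $G$ be a finite simple connected graph, let $K$ be a field, and let $w$ be an even closed walk of $G$ with $B_w\neq 0$. Then $B_w$ is an indispensable binomial of the toric ideal $I_G$ if and only if $w$ is a strongly primitive walk, all the chords of $w$ are odd, and no two chords of $w$ cross effectively in $w$.
   Context: Toric ideal. Let $V(G)=\{v_1,\ldots,v_n\}$ and $E(G)=\{e_1,\ldots,e_m\}$; the edges are also the variables of $K[e_1,\ldots,e_m]$. To $e=\{v_i,v_j\}$ associate $a_e=v_i+v_j$ in the free abelian group on $V(G)$. The toric ideal $I_G\subset K[e_1,\ldots,e_m]$ is generated by all binomials $\mathbf{e}^{\mathbf{u}}-\mathbf{e}^{\mathbf{v}}$ with $\sum_k u_k a_{e_k}=\sum_k v_k a_{e_k}$. A binomial $B\in I_G$ is indispensable if every minimal system of binomial generators of $I_G$ contains a nonzero constant multiple of $B$. Walks. A walk is a finite sequence of edges $w=(\{v_{i_1},v_{i_2}\},\{v_{i_2},v_{i_3}\},\ldots,\{v_{i_q},v_{i_{q+1}}\})$ of $G$, $q\ge1$; its length is $q$, it is even/odd according to $q$, and closed if $v_{i_{q+1}}=v_{i_1}$. Edges may be repeated. A walk $w'=(e_{j_1},\ldots,e_{j_t})$ is a subwalk of $w=(e_{i_1},\ldots,e_{i_q})$ if $e_{j_1}\cdots e_{j_t}$ divides $e_{i_1}\cdots e_{i_q}$. For an even closed walk $w=(e_{i_1},\ldots,e_{i_{2q}})$ put $E^+(w)=\prod_{k=1}^{q}e_{i_{2k-1}}$, $E^-(w)=\prod_{k=1}^{q}e_{i_{2k}}$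 and $B_w=E^+(w)-E^-(w)\in I_G$. The edges in odd (even) positions are the odd (even) edges of $w$. $w$ is primitive if there is no even closed subwalk $\xi$ of $w$ of smaller length with $E^+(\xi)\mid E^+(w)$ and $E^-(\xi)\mid E^-(w)$. Blocks and sinks. $\mathbf{w}$ denotes the subgraph of $G$ whose vertices and edges are those of $w$. A block of a graph is a maximal connected subgraph having no cut vertex of its own; a block that is a cycle is called cyclic. A sink of a block $B$ of $\mathbf{w}$ is a common vertex of two odd or of two even edges of $w$ (counted as occurrences in $w$) which belong to $B$. A strongly primitive walk is a primitive walk that does not have two sinks of the same cyclic block at distance one in that block. Chords. An edge $f\in E(G)$ is a chord of $w$ if both vertices of $f$ are vertices of $\mathbf{w}$ and $f\notin E(\mathbf{w})$. For $w=((v_1,v_2),(v_2,v_3),\ldots,(v_{2k},v_1))$ with $e_s=(v_s,v_{s+1})$ and $e_{2k}=(v_{2k},v_1)$, a chord $f=\{v_i,v_j\}$, $i<j$, breaks $w$ into the two walks $(e_1,\ldots,e_{i-1},f,e_j,\ldots,e_{2k})$ and $(e_i,\ldots,e_{j-1},f)$, which are both even or both odd. A chord $f=\{x,y\}$ of a primitive walk $w$ is a bridge of $w$ if there exist two different blocks $B_1,B_2$ of $\mathbf{w}$ with $x\in B_1$ and $y\in B_2$. A chord is even (respectively odd) if it is not a bridge and breaks $w$ into two even (respectively two odd) walks. Crossing. Let $w=((v_{i_1},v_{i_2}),(v_{i_2},v_{i_3}),\ldots,(v_{i_{2q}},v_{i_1}))$ be primitive and let $f=\{v_{i_s},v_{i_j}\}$,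 $f'=\{v_{i_{s'}},v_{i_{j'}}\}$ be odd chords with $1\le s<j\le 2q$, $1\le s'<j'\le 2q$ (so $j-s$ and $j'-s'$ are even). They cross effectively in $w$ if $s'-s$ is odd and either $s<s'<j<j'$ or $s'<s<j'<j$. *)

theory Defs
  imports "HOL-Library.Poly_Mapping" "HOL-Library.Multiset" "HOL-Algebra.Ideal"
begin

subsection \<open>Graphs\<close>

text \<open>A graph is a pair of a vertex set and a set of edges, the edges being two-element sets of
  vertices.\<close>

type_synonym 'a ugraph = "'a set \<times> 'a set set"

abbreviation verts :: "'a ugraph \<Rightarrow> 'a set" where
  "verts G \<equiv> fst G"

abbreviation edges :: "'a ugraph \<Rightarrow> 'a set set" where
  "edges G \<equiv> snd G"

definition simple_graph :: "'a ugraph \<Rightarrow> bool" where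
  "simple_graph G \<longleftrightarrow> finite (verts G) \<and> (\<forall>e\<in>edges G. e \<subseteq> verts G \<and> card e = 2)"

definition reach :: "'a ugraph \<Rightarrow> ('a \<times> 'a) set" where
  "reach G = {(x, y). {x, y} \<in> edges G}\<^sup>*"

definition connected_graph :: "'a ugraph \<Rightarrow> bool" where
  "connected_graph G \<longleftrightarrow> verts G \<noteq> {} \<and> (\<forall>x\<in>verts G. \<forall>y\<in>verts G. (x, y) \<in> reach G)"

definition delete_vertex :: "'a ugraph \<Rightarrow> 'a \<Rightarrow> 'a ugraph" where
  "delete_vertex G v = (verts G - {v}, {e \<in> edges G. v \<notin> e})"

definition cut_vertex :: "'a ugraph \<Rightarrow> 'a \<Rightarrow> bool" where
  "cut_vertex G v \<longleftrightarrow> v \<in> verts G \<and>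
     (\<exists>x\<in>verts G - {v}. \<exists>y\<in>verts G - {v}. (x, y) \<in> reach G \<and> (x, y) \<notin> reach (delete_vertex G v))"

definition subgraph :: "'a ugraph \<Rightarrow> 'a ugraph \<Rightarrow> bool" where
  "subgraph H G \<longleftrightarrow> verts H \<subseteq> verts G \<and> edges H \<subseteq> edges G \<and> (\<forall>e\<in>edges H. e \<subseteq> verts H)"

definition nonseparable :: "'a ugraph \<Rightarrow> bool" where
  "nonseparable G \<longleftrightarrow> connected_graph G \<and> (\<nexists>v. cut_vertex G v)"

definition block :: "'a ugraph \<Rightarrow> 'a ugraph \<Rightarrow> bool" where
  "block G B \<longleftrightarrow> subgraph B G \<and> nonseparable B \<and>
     (\<forall>H. subgraph H G \<and> nonseparable H \<and> subgraph B H \<longrightarrow> H = B)"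

definition cycle_graph :: "'a ugraph \<Rightarrow> bool" where
  "cycle_graph G \<longleftrightarrow> (\<exists>xs. 3 \<le> length xs \<and> distinct xs \<and> verts G = set xs \<and>
     edges G = {{xs ! i, xs ! (Suc i mod length xs)} | i. i < length xs})"

definition cyclic_block :: "'a ugraph \<Rightarrow> 'a ugraph \<Rightarrow> bool" where
  "cyclic_block G B \<longleftrightarrow> block G B \<and> cycle_graph B"


subsection \<open>Walks\<close>

text \<open>A walk is represented by its list of vertices
  \<open>[v\<^sub>1, \<dots>, v\<^sub>q, v\<^sub>q\<^sub>+\<^sub>1]\<close>, a closed one repeating its first vertex at the end.  For a simple graph
  the sequence of edges determines this list unless all its edges coincide; in that case the
  binomial of an even closed walk is zero.\<close>

fun walk_edges :: "'a list \<Rightarrow> 'a set list" where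
  "walk_edges (x # y # w) = {x, y} # walk_edges (y # w)"
| "walk_edges _ = []"

definition walk_length :: "'a list \<Rightarrow> nat" where
  "walk_length w = length (walk_edges w)"

definition walk :: "'a ugraph \<Rightarrow> 'a list \<Rightarrow> bool" where
  "walk G w \<longleftrightarrow> 1 \<le> walk_length w \<and> set (walk_edges w) \<subseteq> edges G"

definition even_closed_walk :: "'a ugraph \<Rightarrow> 'a list \<Rightarrow> bool" where
  "even_closed_walk G w \<longleftrightarrow> walk G w \<and> hd w = last w \<and> even (walk_length w)"

definition subwalk :: "'a list \<Rightarrow> 'a list \<Rightarrow> bool" where
  "subwalk w' w \<longleftrightarrow> mset (walk_edges w') \<subseteq># mset (walk_edges w)"

text \<open>The monomials \<open>E\<^sup>+(w)\<close> and \<open>E\<^sup>-(w)\<close> are represented by the multisets of their variables, so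
  that divisibility is multiset inclusion.  List positions start at 0, hence the odd edges
  \<open>e\<^sub>1, e\<^sub>3, \<dots>\<close> sit at even positions.\<close>

definition Eplus :: "'a list \<Rightarrow> 'a set multiset" where
  "Eplus w = mset (nths (walk_edges w) {i. even i})"

definition Eminus :: "'a list \<Rightarrow> 'a set multiset" where
  "Eminus w = mset (nths (walk_edges w) {i. odd i})"

definition primitive_walk :: "'a ugraph \<Rightarrow> 'a list \<Rightarrow> bool" where
  "primitive_walk G w \<longleftrightarrow> even_closed_walk G w \<and>
     (\<nexists>\<xi>. even_closed_walk G \<xi> \<and> subwalk \<xi> w \<and> walk_length \<xi> < walk_length w \<and>
        Eplus \<xi> \<subseteq># Eplus w \<and> Eminus \<xi> \<subseteq># Eminus w)"

definition walk_graph :: "'a list \<Rightarrow> 'a ugraph" where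
  "walk_graph w = (set w, set (walk_edges w))"

text \<open>Two edges of the walk are two positions, so an edge traversed twice with the same parity makes
  both its vertices sinks.\<close>

definition sink :: "'a list \<Rightarrow> 'a ugraph \<Rightarrow> 'a \<Rightarrow> bool" where
  "sink w B v \<longleftrightarrow> (\<exists>i j. i < walk_length w \<and> j < walk_length w \<and> i \<noteq> j \<and> (even i \<longleftrightarrow> even j) \<and>
     walk_edges w ! i \<in> edges B \<and> walk_edges w ! j \<in> edges B \<and>
     v \<in> walk_edges w ! i \<and> v \<in> walk_edges w ! j)"

definition strongly_primitive :: "'a ugraph \<Rightarrow> 'a list \<Rightarrow> bool" where
  "strongly_primitive G w \<longleftrightarrow> primitive_walk G w \<and>
     (\<nexists>B x y. cyclic_block (walk_graph w) B \<and> sink w B x \<and> sink w B y \<and> {x, y} \<in> edges B)"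


subsection \<open>Chords\<close>

definition chord :: "'a ugraph \<Rightarrow> 'a list \<Rightarrow> 'a set \<Rightarrow> bool" where
  "chord G w f \<longleftrightarrow> f \<in> edges G \<and> f \<subseteq> verts (walk_graph w) \<and> f \<notin> edges (walk_graph w)"

definition bridge :: "'a ugraph \<Rightarrow> 'a list \<Rightarrow> 'a set \<Rightarrow> bool" where
  "bridge G w f \<longleftrightarrow> chord G w f \<and>
     (\<exists>x y B1 B2. f = {x, y} \<and> block (walk_graph w) B1 \<and> block (walk_graph w) B2 \<and> B1 \<noteq> B2 \<and>
        x \<in> verts B1 \<and> y \<in> verts B2)"

text \<open>For \<open>w = [v\<^sub>0, \<dots>, v\<^sub>n\<^sub>-\<^sub>1, v\<^sub>0]\<close> and a chord \<open>{v\<^sub>i, v\<^sub>j}\<close> with \<open>i < j < n\<close>, these are the walks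
  \<open>[v\<^sub>0, \<dots>, v\<^sub>i, v\<^sub>j, \<dots>, v\<^sub>n\<^sub>-\<^sub>1, v\<^sub>0]\<close> and \<open>[v\<^sub>i, \<dots>, v\<^sub>j, v\<^sub>i]\<close>.\<close>

definition break_outer :: "'a list \<Rightarrow> nat \<Rightarrow> nat \<Rightarrow> 'a list" where
  "break_outer w i j = take (Suc i) w @ drop j w"

definition break_inner :: "'a list \<Rightarrow> nat \<Rightarrow> nat \<Rightarrow> 'a list" where
  "break_inner w i j = drop i (take (Suc j) w) @ [w ! i]"

definition odd_chord :: "'a ugraph \<Rightarrow> 'a list \<Rightarrow> 'a set \<Rightarrow> bool" where
  "odd_chord G w f \<longleftrightarrow> chord G w f \<and> \<not> bridge G w f \<and>
     (\<exists>i j. i < j \<and> j < walk_length w \<and> f = {w ! i, w ! j} \<and>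
        odd (walk_length (break_outer w i j)) \<and> odd (walk_length (break_inner w i j)))"

definition cross_effectively :: "'a ugraph \<Rightarrow> 'a list \<Rightarrow> 'a set \<Rightarrow> 'a set \<Rightarrow> bool" where
  "cross_effectively G w f f' \<longleftrightarrow> odd_chord G w f \<and> odd_chord G w f' \<and>
     (\<exists>s j s' j'. s < j \<and> j < walk_length w \<and> s' < j' \<and> j' < walk_length w \<and>
        f = {w ! s, w ! j} \<and> f' = {w ! s', w ! j'} \<and>
        odd (int s' - int s) \<and> (s < s' \<and> s' < j \<and> j < j' \<or> s' < s \<and> s < j' \<and> j' < j))"


subsection \<open>Toric ideals\<close>

text \<open>Polynomials over \<open>'k\<close> in edge variables are finitely supported functions from monomials to
  coefficients with the convolution product of \<open>Poly_Mapping\<close>.  A monomial is the finite multiset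
  of its variables, which is the same as its exponent vector.\<close>

type_synonym ('a, 'k) edge_poly = "'a set multiset \<Rightarrow>\<^sub>0 'k"

abbreviation monomial :: "'a set multiset \<Rightarrow> ('a, 'k::field) edge_poly" where
  "monomial u \<equiv> Poly_Mapping.single u 1"

abbreviation const :: "'k::field \<Rightarrow> ('a, 'k) edge_poly" where
  "const c \<equiv> Poly_Mapping.single {#} c"

text \<open>The ring \<open>K[E(G)]\<close>, with \<open>K\<close> the field \<open>'k\<close>: only edges of \<open>G\<close> occur as variables.\<close>

definition edge_ring :: "'a ugraph \<Rightarrow> ('a, 'k::field) edge_poly ring" where
  "edge_ring G = \<lparr>carrier = {p. \<forall>u\<in>Poly_Mapping.keys p. set_mset u \<subseteq> edges G},
     monoid.mult = (*), one = 1, zero = 0, add = (+)\<rparr>"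

definition edge_vector :: "'a set \<Rightarrow> 'a \<Rightarrow>\<^sub>0 int" where
  "edge_vector e = (\<Sum>v\<in>e. frag_of v)"

definition toric_ideal :: "'a ugraph \<Rightarrow> ('a, 'k::field) edge_poly set" where
  "toric_ideal G = Idl\<^bsub>edge_ring G\<^esub> {monomial u - monomial v | u v.
     set_mset u \<subseteq> edges G \<and> set_mset v \<subseteq> edges G \<and>
     (\<Sum>e\<in>#u. edge_vector e) = (\<Sum>e\<in>#v. edge_vector e)}"

definition walk_binomial :: "'a list \<Rightarrow> ('a, 'k::field) edge_poly" where
  "walk_binomial w = monomial (Eplus w) - monomial (Eminus w)"

text \<open>A binomial is a polynomial with exactly two terms; in a toric ideal these are precisely the
  nonzero constant multiples of nonzero differences of two monomials.\<close>

definition binomial :: "('a, 'k::field) edge_poly \<Rightarrow> bool" where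
  "binomial p \<longleftrightarrow> card (Poly_Mapping.keys p) = 2"

definition binomial_generators :: "'a ugraph \<Rightarrow> ('a, 'k::field) edge_poly set \<Rightarrow> bool" where
  "binomial_generators G S \<longleftrightarrow> S \<subseteq> carrier (edge_ring G) \<and> (\<forall>p\<in>S. binomial p) \<and>
     Idl\<^bsub>edge_ring G\<^esub> S = toric_ideal G"

definition minimal_binomial_generators :: "'a ugraph \<Rightarrow> ('a, 'k::field) edge_poly set \<Rightarrow> bool" where
  "minimal_binomial_generators G S \<longleftrightarrow>
     binomial_generators G S \<and> (\<forall>T. T \<subset> S \<longrightarrow> \<not> binomial_generators G T)"

definition indispensable :: "'a ugraph \<Rightarrow> ('a, 'k::field) edge_poly \<Rightarrow> bool" where
  "indispensable G p \<longleftrightarrow> p \<in> toric_ideal G \<and> binomial p \<and>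
     (\<forall>S. minimal_binomial_generators G S \<longrightarrow> (\<exists>c. c \<noteq> 0 \<and> const c * p \<in> S))"

end

theory Submission
  imports Defs
begin

text \<open>
  For balanced monomials \<open>x\<^sup>u\<close>, \<open>x\<^sup>v\<close> the binomial \<open>x\<^sup>u - x\<^sup>v\<close> is indispensable iff \<open>u\<close>, \<open>v\<close> are disjoint
  and are the only monomials with their vertex degrees: a third one \<open>t\<close> lets \<open>x\<^sup>u - x\<^sup>v\<close> be replaced by
  \<open>x\<^sup>u - x\<^sup>t\<close> and \<open>x\<^sup>t - x\<^sup>v\<close>, a common variable by a binomial of lower degree.

  On a segment of a walk, the alternating sum of the vertex vectors of the edges telescopes to the
  two endpoints.  Hence exchanging odd and even edges on segments, and adding edges joining their
  endpoints, produces elements of the fiber; even chords, bridges, adjacent sinks and effective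
  crossings all give a third element.  Conversely, in a primitive walk a vertex occurs at most twice,
  and a vertex occurring twice separates the walk into two odd closed walks.  Parity on the two sides
  shows that an element of the fiber, read along the walk, is a perfect matching of the cycle of
  positions by walk edges and odd chords.  A shortest chord in it would be crossed effectively, so
  there are no chords and the matching is one of the two alternating ones.
\<close>

subsection \<open>Degrees and the edge ring\<close>

text \<open>Two obstacles shape the development. An infinite generating set need not contain a
  minimal one, and without minimal systems every binomial would be vacuously indispensable. Refuting
  indispensability therefore needs a finite binomial generating set; the Graver pairs provide one,
  finite by Dickson's lemma.

  On the graph side the walk may repeat vertices and edges, so everything is phrased with positions
  modulo its length. Primitivity becomes: no proper nonempty set of positions has vanishing
  alternating sum. This form is invariant under rotation, so most facts are proved at position 0 and
  then shifted.

  Reading a fiber element along the walk is delicate at a vertex visited twice, where it has degree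
  2: both of its edges there might be one walk edge with multiplicity 2. Both ends of that edge are
  then visited twice, and here the condition on sinks enters: a proper cycle through the edge,
  obtained by loop erasure, would be a cyclic block with two adjacent sinks. So the walk itself
  traverses the edge twice.\<close>

definition deg :: "'a set multiset \<Rightarrow> 'a \<Rightarrow> nat" where
  "deg t x = size {#e \<in># t. x \<in> e#}"

lemma deg_empty [simp]: "deg {#} x = 0"
  and deg_add [simp]: "deg (s + t) x = deg s x + deg t x"
  and deg_add_mset [simp]: "deg (add_mset e t) x = of_bool (x \<in> e) + deg t x"
  by (simp_all add: deg_def)

lemma deg_diff: "s \<subseteq># t \<Longrightarrow> deg (t - s) x = deg t x - deg s x"
  by (metis deg_add subset_mset.add_diff_inverse add_diff_cancel_left')

lemma lookup_edge_vector:
  assumes "finite e"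
  shows "Poly_Mapping.lookup (edge_vector e) x = of_bool (x \<in> e)"
  unfolding edge_vector_def lookup_sum
  using assms by (simp add: lookup_single when_def of_bool_def sum.delta)

lemma lookup_sum_edge_vector:
  assumes "\<forall>e \<in> set_mset t. finite e"
  shows "Poly_Mapping.lookup (\<Sum>e\<in>#t. edge_vector e) x = int (deg t x)"
  using assms by (induction t) (simp_all add: lookup_add lookup_edge_vector)

lemma poly_mapping_sum_monomials:
  "(\<Sum>m\<in>Poly_Mapping.keys p. Poly_Mapping.single m (Poly_Mapping.lookup p m)) = p"
  by (rule poly_mapping_eqI)
     (simp add: lookup_sum lookup_single when_def sum.delta in_keys_iff flip: of_bool_def)

locale fin_graph =
  fixes G :: "'a ugraph"
  assumes simple: "simple_graph G"
begin

lemma edge_card: "e \<in> edges G \<Longrightarrow> card e = 2"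
  and edge_finite: "e \<in> edges G \<Longrightarrow> finite e"
  using simple by (auto simp: simple_graph_def intro: card_ge_0_finite)

lemma finite_edges: "finite (edges G)"
proof (rule finite_subset)
  show "edges G \<subseteq> Pow (verts G)" using simple by (auto simp: simple_graph_def)
  show "finite (Pow (verts G))" using simple by (simp add: simple_graph_def)
qed

lemma edge_vector_sum_eq_iff:
  assumes "set_mset u \<subseteq> edges G" "set_mset v \<subseteq> edges G"
  shows "(\<Sum>e\<in>#u. edge_vector e) = (\<Sum>e\<in>#v. edge_vector e) \<longleftrightarrow> deg u = deg v"
proof -
  have "\<forall>e\<in>set_mset u. finite e" "\<forall>e\<in>set_mset v. finite e"
    using assms edge_finite by blast+
  then show ?thesis
    by (simp add: poly_mapping_eq_iff fun_eq_iff lookup_sum_edge_vector)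
qed

text \<open>Handshake: the degrees sum to twice the number of edges, so the fibers are
  homogeneous.\<close>

lemma size_eq_if_deg_eq:
  assumes "set_mset u \<subseteq> edges G" "set_mset v \<subseteq> edges G" "deg u = deg v"
  shows "size u = size v"
proof -
  have "(\<Sum>x\<in>verts G. deg t x) = 2 * size t" if "set_mset t \<subseteq> edges G" for t
    using that
  proof (induction t)
    case (add e t)
    have "(\<Sum>x\<in>verts G. of_bool (x \<in> e)) = card (verts G \<inter> e)"
      using simple by (simp add: simple_graph_def sum.inter_filter[symmetric] of_bool_def
          flip: Int_def)
    also have "verts G \<inter> e = e" using add.prems simple by (auto simp: simple_graph_def)
    finally show ?case using add edge_card by (simp add: sum.distrib)
  qed simp
  from this[OF assms(1)] this[OF assms(2)] assms(3) show ?thesis by simp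
qed

lemma deg_0_imp_empty:
  assumes "set_mset u \<subseteq> edges G" "deg u = deg {#}"
  shows "u = {#}"
  using size_eq_if_deg_eq[of u "{#}"] assms by simp

section \<open>The polynomial ring in the edges and its ideals\<close>

abbreviation R :: "('a, 'k::field) edge_poly ring" where "R \<equiv> edge_ring G"

lemma R_simps [simp]:
  "mult R = (*)" "one R = (1 :: ('a, 'k::field) edge_poly)" "zero R = (0 :: ('a, 'k) edge_poly)"
  "add R = ((+) :: ('a, 'k) edge_poly \<Rightarrow> _)"
  by (simp_all add: edge_ring_def)

lemma carrier_R: "p \<in> carrier R \<longleftrightarrow> (\<forall>u\<in>Poly_Mapping.keys p. set_mset u \<subseteq> edges G)"
  by (simp add: edge_ring_def)

lemma mult_carrier: "p \<in> carrier R \<Longrightarrow> q \<in> carrier R \<Longrightarrow> p * q \<in> carrier R"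
  unfolding carrier_R using keys_mult[of p q] by fastforce

lemma add_carrier: "p \<in> carrier R \<Longrightarrow> q \<in> carrier R \<Longrightarrow> p + q \<in> carrier R"
  unfolding carrier_R using keys_add[of p q] by blast

lemma uminus_carrier: "p \<in> carrier R \<Longrightarrow> - p \<in> carrier R"
  unfolding carrier_R by (simp add: keys_minus)

lemma cring_R: "cring (R :: ('a, 'k::field) edge_poly ring)"
proof (rule cringI)
  show "abelian_group (R :: ('a, 'k) edge_poly ring)"
  proof (rule abelian_groupI)
    fix x :: "('a, 'k) edge_poly" assume "x \<in> carrier R"
    then show "\<exists>y\<in>carrier R. y \<oplus>\<^bsub>R\<^esub> x = \<zero>\<^bsub>R\<^esub>"
      by (intro bexI[of _ "- x"]) (simp_all add: uminus_carrier)
  qed (simp_all add: add_carrier add.assoc, simp_all add: carrier_R ac_simps)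
  show "comm_monoid (R :: ('a, 'k) edge_poly ring)"
    by (rule comm_monoidI) (simp_all add: mult_carrier mult.assoc, simp_all add: carrier_R ac_simps)
qed (simp add: distrib_right)

lemma ring_R: "ring (R :: ('a, 'k::field) edge_poly ring)"
  using cring_R by (rule cring.axioms)

lemma single_carrier: "set_mset u \<subseteq> edges G \<Longrightarrow> Poly_Mapping.single u c \<in> carrier R"
  by (auto simp: carrier_R)

lemma sum_singles_closed:
  fixes J :: "('a, 'k::field) edge_poly set"
  assumes "0 \<in> J" "\<And>p q. p \<in> J \<Longrightarrow> q \<in> J \<Longrightarrow> p + q \<in> J"
    and "\<And>m c. m \<in> Poly_Mapping.keys q \<Longrightarrow> Poly_Mapping.single m c * p \<in> J"
  shows "q * p \<in> J"
proof -
  have "(\<Sum>m\<in>M. Poly_Mapping.single m (Poly_Mapping.lookup q m) * p) \<in> J"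
    if "M \<subseteq> Poly_Mapping.keys q" for M
    using finite_subset[OF that finite_keys] that
    by (induction M rule: finite_induct) (simp_all add: assms)
  from this[OF order_refl] show ?thesis
    by (simp add: poly_mapping_sum_monomials flip: sum_distrib_right)
qed

text \<open>Every polynomial is a finite sum of terms, so closure under products with terms gives
  closure under all products; negatives come from the factor \<open>- 1\<close>.\<close>

lemma ideal_R_I:
  fixes J :: "('a, 'k::field) edge_poly set"
  assumes "J \<subseteq> carrier R" "0 \<in> J" "\<And>p q. p \<in> J \<Longrightarrow> q \<in> J \<Longrightarrow> p + q \<in> J"
    and "\<And>p m c. p \<in> J \<Longrightarrow> set_mset m \<subseteq> edges G \<Longrightarrow> Poly_Mapping.single m c * p \<in> J"
  shows "ideal J R"
proof (rule idealI[OF ring_R])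
  interpret cring "R :: ('a, 'k) edge_poly ring" by (rule cring_R)
  have mult: "q * p \<in> J" if "p \<in> J" "q \<in> carrier R" for p q
    
  proof (rule sum_singles_closed)
    show "Poly_Mapping.single m c * p \<in> J" if "m \<in> Poly_Mapping.keys q" for m c
      using that \<open>p \<in> J\<close> \<open>q \<in> carrier R\<close> by (intro assms(4)) (auto simp: carrier_R)
  qed (use assms(2,3) in auto)
  have minus: "\<ominus>\<^bsub>R\<^esub> a = - a" if "a \<in> carrier R" for a :: "('a, 'k) edge_poly"
    
    by (rule minus_equality) (use that uminus_carrier in auto)
  show "subgroup J (add_monoid (R :: ('a, 'k) edge_poly ring))"
  proof
    fix x assume x: "x \<in> J"
    have "- 1 * x \<in> J" using x by (rule mult) (simp add: carrier_R)
    then show "inv\<^bsub>add_monoid R\<^esub> x \<in> J"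
      using minus[of x] x assms(1) by (auto simp: a_inv_def)
  qed (use assms in auto)
  show "x \<otimes>\<^bsub>R\<^esub> a \<in> J" "a \<otimes>\<^bsub>R\<^esub> x \<in> J" if "a \<in> J" "x \<in> carrier R" for a x
    using mult[OF that] by (simp_all add: mult.commute)
qed

lemma idealD:
  assumes "ideal J (R :: ('a, 'k::field) edge_poly ring)"
  shows "J \<subseteq> carrier R" "0 \<in> J" "\<And>p q. p \<in> J \<Longrightarrow> q \<in> J \<Longrightarrow> p + q \<in> J"
    and "\<And>p q. p \<in> J \<Longrightarrow> q \<in> carrier R \<Longrightarrow> q * p \<in> J"
proof -
  interpret ideal J "R :: ('a, 'k) edge_poly ring" by fact
  show "J \<subseteq> carrier R" using Icarr by blast
  show "0 \<in> J" using additive_subgroup.zero_closed[OF is_additive_subgroup] by simp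
  show "p + q \<in> J" if "p \<in> J" "q \<in> J" for p q
    using additive_subgroup.a_closed[OF is_additive_subgroup that] by simp
  show "q * p \<in> J" if "p \<in> J" "q \<in> carrier R" for p q using I_l_closed that by simp
qed

end

section \<open>Dickson's lemma\<close>

text \<open>Repeatedly passing to an index that minimises \<open>h\<close> on the remaining tail
  makes the values nondecreasing, because later tails are smaller.\<close>

lemma nat_seq_mono_subseq:
  fixes h :: "nat \<Rightarrow> nat"
  shows "\<exists>r :: nat \<Rightarrow> nat. strict_mono r \<and> mono (\<lambda>i. h (r i))"
proof -
  have "\<exists>m\<ge>n. \<forall>k\<ge>n. h m \<le> h k" for n
    using ex_has_least_nat[of "\<lambda>k. k \<ge> n" n h] by auto
  then obtain m where m: "\<And>n. m n \<ge> n" "\<And>n k. k \<ge> n \<Longrightarrow> h (m n) \<le> h k" by metis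
  define r where "r = rec_nat (m 0) (\<lambda>_ i. m (Suc i))"
  have r: "r (Suc i) = m (Suc (r i))" for i by (simp add: r_def)
  have lt: "r i < r (Suc i)" for i using m(1)[of "Suc (r i)"] r by simp
  have "h (r i) \<le> h (r (Suc i))" for i
  proof (cases i)
    case 0
    then show ?thesis using m(2)[of 0 "r (Suc 0)"] by (simp add: r_def)
  next
    case (Suc j)
    then show ?thesis using m(2)[of "Suc (r j)" "r (Suc i)"] lt[of i] lt[of j] r by simp
  qed
  then show ?thesis using lt by (intro exI[of _ r] conjI) (simp_all add: mono_iff_le_Suc strict_mono_Suc_iff)
qed

text \<open>One coordinate at a time: a further subsequence stays monotone in the coordinates
  already treated.\<close>

lemma dickson:
  fixes f :: "nat \<Rightarrow> 'b \<Rightarrow> nat"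
  assumes "finite A"
  shows "\<exists>g::nat \<Rightarrow> nat. strict_mono g \<and> (\<forall>x\<in>A. mono (\<lambda>i. f (g i) x))"
  using assms
proof (induction A rule: finite_induct)
  case empty
  show ?case by (intro exI[of _ id]) (simp add: strict_mono_def)
next
  case (insert x A)
  then obtain g :: "nat \<Rightarrow> nat" where g: "strict_mono g" "\<forall>x\<in>A. mono (\<lambda>i. f (g i) x)" by auto
  obtain r :: "nat \<Rightarrow> nat" where r: "strict_mono r" "mono (\<lambda>i. f (g (r i)) x)"
    using nat_seq_mono_subseq[of "\<lambda>i. f (g i) x"] by auto
  have "mono (\<lambda>i. f (g (r i)) y)" if "y \<in> A" for y
    using g(2) that r(1) by (auto simp: mono_def strict_mono_less_eq)
  then show ?case using r g(1) by (intro exI[of _ "\<lambda>i. g (r i)"]) (simp add: strict_mono_def)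
qed

text \<open>The sum type \<open>E <+> E\<close> turns a pair of multisets into one exponent vector,
  so an infinite \<open>P\<close> would contain two comparable members.\<close>

lemma finite_multiset_pair_antichain:
  fixes P :: "('b multiset \<times> 'b multiset) set"
  assumes "finite E" "\<And>u v. (u, v) \<in> P \<Longrightarrow> set_mset u \<subseteq> E \<and> set_mset v \<subseteq> E"
    and anti: "\<And>u v u' v'. (u, v) \<in> P \<Longrightarrow> (u', v') \<in> P \<Longrightarrow> u' \<subseteq># u \<Longrightarrow> v' \<subseteq># v \<Longrightarrow> u' = u \<and> v' = v"
  shows "finite P"
proof (rule ccontr)
  assume "infinite P"
  then obtain q :: "nat \<Rightarrow> _" where q: "inj q" "range q \<subseteq> P"
    using infinite_countable_subset by blast
  define f where "f i = case_sum (count (fst (q i))) (count (snd (q i)))" for i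
  obtain g :: "nat \<Rightarrow> nat" where g: "strict_mono g" "\<forall>x\<in>E <+> E. mono (\<lambda>i. f (g i) x)"
    using dickson[of "E <+> E" f] assms(1) by auto
  have le: "f (g 0) x \<le> f (g 1) x" if "x \<in> E <+> E" for x
    using g(2) that by (auto simp: mono_def)
  have in_P: "q i \<in> P" for i using q(2) by blast
  have sub: "fst (q i) \<in> {u. set_mset u \<subseteq> E}" "snd (q i) \<in> {u. set_mset u \<subseteq> E}" for i
    using assms(2)[of "fst (q i)" "snd (q i)"] in_P by auto
  have "fst (q (g 0)) \<subseteq># fst (q (g 1))"
  proof (rule mset_subset_eqI)
    fix a show "count (fst (q (g 0))) a \<le> count (fst (q (g 1))) a"
      using le[of "Inl a"] sub(1)[of "g 0"] by (cases "a \<in># fst (q (g 0))") (auto simp: f_def not_in_iff)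
  qed
  moreover have "snd (q (g 0)) \<subseteq># snd (q (g 1))"
  proof (rule mset_subset_eqI)
    fix a show "count (snd (q (g 0))) a \<le> count (snd (q (g 1))) a"
      using le[of "Inr a"] sub(2)[of "g 0"] by (cases "a \<in># snd (q (g 0))") (auto simp: f_def not_in_iff)
  qed
  ultimately have "q (g 0) = q (g 1)"
    using anti[of "fst (q (g 1))" "snd (q (g 1))" "fst (q (g 0))" "snd (q (g 0))"] in_P
    by (simp add: prod_eq_iff)
  then have "g 0 = g 1" using q(1) by (simp add: inj_eq)
  then show False using g(1) by (simp add: strict_mono_eq)
qed

lemma lookup_single_times:
  fixes p :: "'b multiset \<Rightarrow>\<^sub>0 'k::field"
  shows "Poly_Mapping.lookup (Poly_Mapping.single m c * p) u =
    (if m \<subseteq># u then c * Poly_Mapping.lookup p (u - m) else 0)"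
proof -
  have single: "Poly_Mapping.lookup (Poly_Mapping.single m c * Poly_Mapping.single a d) u =
    (if m \<subseteq># u then c * Poly_Mapping.lookup (Poly_Mapping.single a d) (u - m) else 0)" for a d
    by (auto simp: mult_single lookup_single when_def) (metis mset_subset_eq_add_left)
  have "Poly_Mapping.lookup (Poly_Mapping.single m c * (\<Sum>a\<in>A. Poly_Mapping.single a (g a))) u =
    (if m \<subseteq># u then c * Poly_Mapping.lookup (\<Sum>a\<in>A. Poly_Mapping.single a (g a)) (u - m) else 0)"
    if "finite A" for A g
    using that
    by (induction A rule: finite_induct) (simp_all add: single distrib_left lookup_add split: if_splits)
  from this[of "Poly_Mapping.keys p" "Poly_Mapping.lookup p"]
  show ?thesis by (simp add: poly_mapping_sum_monomials)
qed

lemma binomialE: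
  assumes "binomial p"
  obtains a b c d where "a \<noteq> b" "c \<noteq> 0" "d \<noteq> 0"
    "p = Poly_Mapping.single a c + Poly_Mapping.single b d"
proof -
  obtain a b where ab: "Poly_Mapping.keys p = {a, b}" "a \<noteq> b"
    using assms by (auto simp: binomial_def card_2_iff)
  have "p = (\<Sum>m\<in>Poly_Mapping.keys p. Poly_Mapping.single m (Poly_Mapping.lookup p m))"
    by (simp add: poly_mapping_sum_monomials)
  also have "\<dots> = Poly_Mapping.single a (Poly_Mapping.lookup p a) + Poly_Mapping.single b (Poly_Mapping.lookup p b)"
    using ab by simp
  finally show ?thesis using that[of a b] ab by (metis insertI1 insertI2 in_keys_iff)
qed

lemma binomial_diff: "u \<noteq> v \<Longrightarrow> binomial (monomial u - monomial v :: ('a, 'k::field) edge_poly)"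
proof -
  assume "u \<noteq> v"
  then have "Poly_Mapping.keys (monomial u - monomial v :: ('a, 'k) edge_poly) = {u, v}"
    by (auto simp: in_keys_iff lookup_minus lookup_single when_def split: if_splits)
  then show ?thesis using \<open>u \<noteq> v\<close> by (simp add: binomial_def)
qed

lemma const_times_diff:
  "const c * (monomial u - monomial v) = Poly_Mapping.single u c - Poly_Mapping.single v (c::'k::field)"
  by (simp add: right_diff_distrib mult_single)

context fin_graph
begin

section \<open>The toric ideal, graded by vertex degrees\<close>

definition balanced :: "'a set multiset \<Rightarrow> 'a set multiset \<Rightarrow> bool" where
  "balanced u v \<longleftrightarrow> set_mset u \<subseteq> edges G \<and> set_mset v \<subseteq> edges G \<and> deg u = deg v"

lemma balanced_diff:
  assumes "balanced u v" "balanced u' v'" "u' \<subseteq># u" "v' \<subseteq># v"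
  shows "balanced (u - u') (v - v')"
  using assms by (auto simp: balanced_def fun_eq_iff deg_diff dest: in_diffD)

abbreviation balanced_binomials :: "('a, 'k::field) edge_poly set" where
  "balanced_binomials \<equiv> {monomial u - monomial v | u v. balanced u v}"

lemma toric_ideal_eq: "toric_ideal G = Idl\<^bsub>R\<^esub> (balanced_binomials :: ('a, 'k::field) edge_poly set)"
proof -
  have "(balanced_binomials :: ('a, 'k) edge_poly set) = {monomial u - monomial v | u v.
     set_mset u \<subseteq> edges G \<and> set_mset v \<subseteq> edges G \<and>
     (\<Sum>e\<in>#u. edge_vector e) = (\<Sum>e\<in>#v. edge_vector e)}"
    unfolding balanced_def using edge_vector_sum_eq_iff by blast
  then show ?thesis by (simp add: toric_ideal_def)
qed

lemma diff_carrier: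
  "set_mset u \<subseteq> edges G \<Longrightarrow> set_mset v \<subseteq> edges G \<Longrightarrow>
    Poly_Mapping.single u c - Poly_Mapping.single v d \<in> carrier (R :: ('a, 'k::field) edge_poly ring)"
  using add_carrier[OF single_carrier uminus_carrier[OF single_carrier], of u v c d] by simp

lemma balanced_binomials_carrier: "(balanced_binomials :: ('a, 'k::field) edge_poly set) \<subseteq> carrier R"
  using diff_carrier by (auto simp: balanced_def)

lemma Idl_props:
  assumes "S \<subseteq> carrier (R :: ('a, 'k::field) edge_poly ring)"
  shows "ideal (Idl\<^bsub>R\<^esub> S) R" "S \<subseteq> Idl\<^bsub>R\<^esub> S"
    and "\<And>J. ideal J R \<Longrightarrow> S \<subseteq> J \<Longrightarrow> Idl\<^bsub>R\<^esub> S \<subseteq> J"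
  using assms ring.genideal_ideal[OF ring_R] ring.genideal_self[OF ring_R]
    ring.genideal_minimal[OF ring_R] by blast+

lemma toric_ideal: "ideal (toric_ideal G) (R :: ('a, 'k::field) edge_poly ring)"
  unfolding toric_ideal_eq using Idl_props(1)[OF balanced_binomials_carrier] .

lemma balanced_in_toric: "balanced u v \<Longrightarrow> monomial u - monomial v \<in> (toric_ideal G :: ('a, 'k::field) edge_poly set)"
  unfolding toric_ideal_eq using Idl_props(2)[OF balanced_binomials_carrier] by blast

text \<open>Multiplication by a term sends balanced pairs to balanced pairs, so this span is already
  an ideal. Its induction rule makes invariants such as \<open>fiber_sum\<close> computable on the
  toric ideal.\<close>

inductive_set bspan :: "('a, 'k::field) edge_poly set" where
  zero: "0 \<in> bspan"
| step: "p \<in> bspan \<Longrightarrow> balanced u v \<Longrightarrow> p + (Poly_Mapping.single u c - Poly_Mapping.single v c) \<in> bspan"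

lemma bspan_add: "p \<in> bspan \<Longrightarrow> q \<in> bspan \<Longrightarrow> q + p \<in> bspan"
  by (induction p rule: bspan.induct) (simp_all add: add.assoc[symmetric] bspan.step)

lemma bspan_ideal: "ideal bspan (R :: ('a, 'k::field) edge_poly ring)"
proof (rule ideal_R_I)
  have "p \<in> carrier R" if "p \<in> bspan" for p :: "('a, 'k) edge_poly"
    using that
  proof induction
    case zero then show ?case by (simp add: carrier_R)
  next
    case step then show ?case by (intro add_carrier diff_carrier) (auto simp: balanced_def)
  qed
  then show "bspan \<subseteq> carrier (R :: ('a, 'k) edge_poly ring)" by blast
  fix p :: "('a, 'k) edge_poly" and m c assume "p \<in> bspan" "set_mset m \<subseteq> edges G"
  then show "Poly_Mapping.single m c * p \<in> bspan"
  proof (induction)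
    case (step p u v d)
    have "balanced (m + u) (m + v)" using step by (auto simp: balanced_def fun_eq_iff)
    then show ?case using bspan.step[OF step.IH, of "m + u" "m + v" "c * d"] step.prems
      by (simp add: distrib_left right_diff_distrib mult_single)
  qed (simp add: bspan.zero)
qed (simp_all add: bspan.zero bspan_add)

lemma toric_subset_bspan: "toric_ideal G \<subseteq> (bspan :: ('a, 'k::field) edge_poly set)"
  unfolding toric_ideal_eq
proof (rule Idl_props(3)[OF balanced_binomials_carrier bspan_ideal])
  show "(balanced_binomials :: ('a, 'k) edge_poly set) \<subseteq> bspan"
  proof
    fix p :: "('a, 'k) edge_poly" assume "p \<in> balanced_binomials"
    then obtain u v where "balanced u v" and p: "p = monomial u - monomial v" by blast
    then show "p \<in> bspan" using bspan.step[OF bspan.zero, of u v 1] by simp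
  qed
qed

text \<open>For \<open>p\<close> in the edge ring, this is the coefficient at exponent
  \<open>D\<close> of the image of \<open>p\<close> under the map that sends each edge variable to
  the product of its two vertices.\<close>

definition fiber_sum :: "('a \<Rightarrow> nat) \<Rightarrow> ('a, 'k::field) edge_poly \<Rightarrow> 'k" where
  "fiber_sum D p = (\<Sum>m | m \<in> Poly_Mapping.keys p \<and> deg m = D. Poly_Mapping.lookup p m)"

lemma fiber_sum_superset:
  assumes "finite K" "Poly_Mapping.keys p \<subseteq> K"
  shows "fiber_sum D p = (\<Sum>m | m \<in> K \<and> deg m = D. Poly_Mapping.lookup p m)"
  unfolding fiber_sum_def
  by (rule sum.mono_neutral_left) (use assms in \<open>auto simp: in_keys_iff\<close>)

lemma fiber_sum_add: "fiber_sum D (p + q) = fiber_sum D p + fiber_sum D q"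
proof -
  let ?K = "Poly_Mapping.keys p \<union> Poly_Mapping.keys q"
  have "finite ?K" by simp
  note sup = fiber_sum_superset[OF this, of _ D]
  show ?thesis
    unfolding sup[OF keys_add] sup[of p, OF Un_upper1] sup[of q, OF Un_upper2]
    by (simp add: lookup_add sum.distrib)
qed

lemma fiber_sum_single: "fiber_sum D (Poly_Mapping.single u c) = (if deg u = D then c else 0)"
proof -
  have "fiber_sum D (Poly_Mapping.single u c) =
      (\<Sum>m | m \<in> {u} \<and> deg m = D. Poly_Mapping.lookup (Poly_Mapping.single u c) m)"
    by (rule fiber_sum_superset) auto
  also have "{m. m \<in> {u} \<and> deg m = D} = (if deg u = D then {u} else {})" by auto
  finally show ?thesis by simp
qed

lemma fiber_sum_toric:
  assumes "p \<in> toric_ideal G"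
  shows "fiber_sum D p = 0"
proof -
  have "p \<in> bspan" using assms toric_subset_bspan by blast
  then show ?thesis
  proof induction
    case zero show ?case by (simp add: fiber_sum_def)
  next
    case (step p u v c)
    have "fiber_sum D (Poly_Mapping.single u c + Poly_Mapping.single v (- c)) = 0"
      unfolding fiber_sum_add fiber_sum_single using step(2) by (simp add: balanced_def)
    then have "fiber_sum D (Poly_Mapping.single u c - Poly_Mapping.single v c) = 0"
      by (simp add: single_uminus)
    then show ?case using step by (simp add: fiber_sum_add)
  qed
qed

subsection \<open>Indispensable binomials and fibers\<close>

text \<open>If the two terms lay in different fibers, the fiber sum at the first would be its
  nonzero coefficient. In a common fiber their coefficients must cancel.\<close>

lemma toric_binomialE:
  assumes "p \<in> (toric_ideal G :: ('a, 'k::field) edge_poly set)" "binomial p"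
  obtains u v c where "balanced u v" "u \<noteq> v" "c \<noteq> 0" "p = const c * (monomial u - monomial v)"
proof -
  from assms(2) obtain a b c d where ab: "a \<noteq> b" "c \<noteq> 0" "d \<noteq> 0"
    and p: "p = Poly_Mapping.single a c + Poly_Mapping.single b d" by (rule binomialE)
  have "fiber_sum (deg a) p = 0" using assms(1) by (rule fiber_sum_toric)
  then have deg: "deg b = deg a" and "c + d = 0"
    using ab by (auto simp: p fiber_sum_add fiber_sum_single split: if_splits)
  from \<open>c + d = 0\<close> have "d = - c" by (simp only: add_eq_0_iff)
  have "p \<in> carrier R" using assms(1) idealD(1)[OF toric_ideal] by blast
  moreover have "a \<in> Poly_Mapping.keys p" "b \<in> Poly_Mapping.keys p"
    using ab by (auto simp: p in_keys_iff lookup_add lookup_single when_def)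
  ultimately have "balanced a b" using deg by (auto simp: balanced_def carrier_R)
  moreover have "p = const c * (monomial a - monomial b)"
    by (simp add: const_times_diff p \<open>d = - c\<close> single_uminus)
  ultimately show ?thesis using that ab by blast
qed

lemma lookup_toric_0:
  assumes "p \<in> toric_ideal G" "\<And>b. balanced a b \<Longrightarrow> b = a" "set_mset a \<subseteq> edges G"
  shows "Poly_Mapping.lookup p a = 0"
proof (rule ccontr)
  assume a: "Poly_Mapping.lookup p a \<noteq> 0"
  have "p \<in> carrier R" using assms(1) idealD(1)[OF toric_ideal] by blast
  then have "{m. m \<in> Poly_Mapping.keys p \<and> deg m = deg a} = {a}"
    using a assms(2,3) by (auto simp: carrier_R balanced_def in_keys_iff)
  with fiber_sum_toric[OF assms(1), of "deg a"] a show False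
    by (simp add: fiber_sum_def)
qed

definition two_fiber :: "'a set multiset \<Rightarrow> 'a set multiset \<Rightarrow> bool" where
  "two_fiber u v \<longleftrightarrow> u \<inter># v = {#} \<and> (\<forall>t. balanced u t \<longrightarrow> t = u \<or> t = v)"

text \<open>Exchanging the factor \<open>a\<close> of \<open>u\<close> for \<open>b\<close> leaves
  the cofactor \<open>r\<close> untouched. The result stays in the fiber but shares \<open>r\<close>
  with \<open>u\<close>, so it cannot be \<open>v\<close>.\<close>

lemma two_fiber_divisor:
  assumes "balanced u v" "two_fiber u v" "a \<subset># u" "balanced a b"
  shows "b = a"
proof -
  obtain r where r: "u = a + r" "r \<noteq> {#}"
    using assms(3) by (metis subset_mset.le_iff_add subset_mset.less_le add.right_neutral)
  have "balanced u (r + b)"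
    using assms(1,4) r by (auto simp: balanced_def fun_eq_iff add.commute)
  then have "r + b = u \<or> r + b = v" using assms(2) by (simp add: two_fiber_def)
  moreover have "r + b \<noteq> v"
  proof
    assume v: "r + b = v"
    then have "r \<subseteq># u \<inter># v" using r by (simp add: subset_mset.le_inf_iff v[symmetric])
    moreover have "u \<inter># v = {#}" using assms(2) by (simp add: two_fiber_def)
    ultimately have "r \<subseteq># {#}" by (simp only:)
    then show False using r(2) by simp
  qed
  ultimately show ?thesis using r by (simp add: add.commute)
qed

text \<open>The elements of the toric ideal without the term \<open>u\<close> form an ideal, because
  proper divisors of \<open>u\<close> are alone in their fibers. A binomial generating set
  containing no nonzero multiple of the binomial would lie in that ideal, which misses the binomial
  itself.\<close>

lemma indispensable_if_two_fiber:
  assumes bal: "balanced u v" and "u \<noteq> v" and fib: "two_fiber u v"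
  shows "indispensable G (monomial u - monomial v :: ('a, 'k::field) edge_poly)"
proof -
  define J where "J = {p \<in> (toric_ideal G :: ('a, 'k) edge_poly set). Poly_Mapping.lookup p u = 0}"
  note I = idealD[OF toric_ideal[where 'k = 'k]]
  have J: "ideal J R"
  proof (rule ideal_R_I)
    show "J \<subseteq> carrier R" using I(1) by (auto simp: J_def)
    show "0 \<in> J" using I(2) by (simp add: J_def)
    show "p + q \<in> J" if "p \<in> J" "q \<in> J" for p q
      using that I(3) by (simp add: J_def lookup_add)
    fix p m c assume p: "p \<in> J" and m: "set_mset m \<subseteq> edges G"
    have "Poly_Mapping.single m c * p \<in> toric_ideal G"
      using p by (intro I(4) single_carrier m) (auto simp: J_def)
    \<comment> \<open>The coefficient of the product at \<open>u\<close> is \<open>c\<close> times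
      that of \<open>p\<close> at \<open>u - m\<close>, which is \<open>u\<close> itself or a proper
      divisor.\<close>
    moreover have "Poly_Mapping.lookup p (u - m) = 0" if "m \<subseteq># u"
    proof (cases "m = {#}")
      case True
      then show ?thesis using p by (simp add: J_def)
    next
      case False
      then have "u - m \<subset># u" using that
        by (metis diff_subset_eq_self subset_mset.less_le subset_mset.diff_add
            add_cancel_right_right)
      then have "\<And>b. balanced (u - m) b \<Longrightarrow> b = u - m"
        using two_fiber_divisor[OF bal fib] by blast
      moreover have "set_mset (u - m) \<subseteq> edges G"
        using bal by (auto simp: balanced_def dest: in_diffD)
      ultimately show ?thesis using p by (intro lookup_toric_0) (auto simp: J_def)
    qed
    ultimately show "Poly_Mapping.single m c * p \<in> J"
      by (simp add: J_def lookup_single_times)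
  qed
  let ?B = "monomial u - monomial v :: ('a, 'k) edge_poly"
  have "\<exists>c. c \<noteq> 0 \<and> const c * ?B \<in> S" if S: "binomial_generators G S" for S
  proof (rule ccontr)
    assume no: "\<nexists>c. c \<noteq> 0 \<and> const c * ?B \<in> S"
    have carr: "S \<subseteq> carrier R" and gen: "Idl\<^bsub>R\<^esub> S = toric_ideal G" and bin: "\<forall>p\<in>S. binomial p"
      using S by (auto simp: binomial_generators_def)
    have "S \<subseteq> J"
    proof
      fix p assume p: "p \<in> S"
      then have pI: "p \<in> toric_ideal G" using Idl_props(2)[OF carr] gen by blast
      then obtain a b c where ab: "balanced a b" "a \<noteq> b" "c \<noteq> 0"
        and peq: "p = const c * (monomial a - monomial b)"
        using bin p by (meson toric_binomialE)
      have "a \<noteq> u"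
      proof
        assume "a = u"
        then have "b = v" using ab fib by (auto simp: two_fiber_def)
        then show False using no p peq ab(3) \<open>a = u\<close> by blast
      qed
      moreover have "b \<noteq> u"
      proof
        assume "b = u"
        then have "a = v" using ab fib by (auto simp: two_fiber_def balanced_def)
        then have "p = const (- c) * ?B" using peq \<open>b = u\<close>
          by (simp add: const_times_diff single_uminus)
        then show False using no p ab(3) by (metis neg_equal_0_iff_equal)
      qed
      ultimately show "p \<in> J" using pI
        by (simp add: J_def peq const_times_diff lookup_minus lookup_single when_def)
    qed
    then have "toric_ideal G \<subseteq> J" using Idl_props(3)[OF carr J] gen by simp
    then have "?B \<in> J" using balanced_in_toric[OF bal] by blast
    then show False using \<open>u \<noteq> v\<close>
      by (simp add: J_def lookup_minus lookup_single when_def)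
  qed
  then show ?thesis
    using balanced_in_toric[OF bal] binomial_diff[OF \<open>u \<noteq> v\<close>]
    by (simp add: indispensable_def minimal_binomial_generators_def)
qed

section \<open>Graver pairs and finite generating sets\<close>

text \<open>The Graver basis as pairs of exponents; minimality makes it an antichain, hence
  finite.\<close>

definition graver :: "('a set multiset \<times> 'a set multiset) set" where
  "graver = {(u, v). balanced u v \<and> u \<noteq> v \<and>
     (\<forall>u' v'. balanced u' v' \<and> u' \<noteq> v' \<and> u' \<subseteq># u \<and> v' \<subseteq># v \<longrightarrow> u' = u \<and> v' = v)}"

lemma finite_graver: "finite graver"
  by (rule finite_multiset_pair_antichain[OF finite_edges]) (auto simp: graver_def balanced_def)

text \<open>A pair that is not minimal lies above another balanced pair; subtracting it leaves a
  third one. Both have smaller total size, and the binomial is a combination of theirs. Hence only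
  Graver pairs need checking.\<close>

lemma generators_if_graver:
  fixes T :: "('a, 'k::field) edge_poly set"
  assumes T: "T \<subseteq> toric_ideal G"
    and gr: "\<And>u v. (u, v) \<in> graver \<Longrightarrow> monomial u - monomial v \<in> Idl\<^bsub>R\<^esub> T"
  shows "Idl\<^bsub>R\<^esub> T = toric_ideal G"
proof
  have carr: "T \<subseteq> carrier R" using T idealD(1)[OF toric_ideal] by blast
  show "Idl\<^bsub>R\<^esub> T \<subseteq> toric_ideal G" by (rule Idl_props(3)[OF carr toric_ideal T])
  note I = idealD[OF Idl_props(1)[OF carr]]
  have "monomial u - monomial v \<in> Idl\<^bsub>R\<^esub> T" if "balanced u v" for u v
    using that
  proof (induction "size u + size v" arbitrary: u v rule: less_induct)
    case less
    show ?case
    proof (cases "u = v \<or> (u, v) \<in> graver")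
      case True
      then show ?thesis using gr I(2) by auto
    next
      case False
      then obtain u' v' where uv': "balanced u' v'" "u' \<noteq> v'" "u' \<subseteq># u" "v' \<subseteq># v" "\<not> (u' = u \<and> v' = v)"
        using less.prems by (auto simp: graver_def)
      have "size u' + size v' < size u + size v"
      proof -
        have "size u' \<le> size u" "size v' \<le> size v" using uv' by (simp_all add: size_mset_mono)
        moreover have "size u' < size u \<or> size v' < size v"
          using uv' by (metis mset_subset_size subset_mset.less_le)
        ultimately show ?thesis by linarith
      qed
      then have 1: "monomial u' - monomial v' \<in> Idl\<^bsub>R\<^esub> T" using less.hyps uv'(1) by blast
      have "u' \<noteq> {#} \<or> v' \<noteq> {#}" using uv'(2) by blast
      then have "size (u - u') + size (v - v') < size u + size v"
        using size_mset_mono[OF uv'(3)] size_mset_mono[OF uv'(4)]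
        by (auto simp: size_Diff_submset[OF uv'(3)] size_Diff_submset[OF uv'(4)] nonempty_has_size)
      then have 2: "monomial (u - u') - monomial (v - v') \<in> Idl\<^bsub>R\<^esub> T"
        using less.hyps balanced_diff[OF less.prems uv'(1,3,4)] by blast
      have "monomial u - monomial v =
         (monomial (u - u') * (monomial u' - monomial v') + monomial v' * (monomial (u - u') - monomial (v - v'))
          :: ('a, 'k) edge_poly)"
        using uv'(3,4) by (simp add: right_diff_distrib mult_single add.commute)
      also have "\<dots> \<in> Idl\<^bsub>R\<^esub> T"
      proof (intro I(3) I(4) 1 2 single_carrier)
        show "set_mset (u - u') \<subseteq> edges G" using less.prems by (auto simp: balanced_def dest: in_diffD)
        show "set_mset v' \<subseteq> edges G" using uv'(1) by (auto simp: balanced_def)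
      qed
      finally show ?thesis .
    qed
  qed
  then have "balanced_binomials \<subseteq> Idl\<^bsub>R\<^esub> T" by blast
  then show "toric_ideal G \<subseteq> Idl\<^bsub>R\<^esub> T"
    unfolding toric_ideal_eq
    by (rule Idl_props(3)[OF balanced_binomials_carrier Idl_props(1)[OF carr]])
qed

text \<open>A finite binomial generating set from which all multiples of the binomial are removed, and
  which still generates the binomial thanks to the added elements \<open>A\<close>, contains a generating set of
  minimal cardinality.\<close>

lemma not_indispensable_if_generated:
  fixes u v
  defines "B \<equiv> monomial u - monomial v :: ('a, 'k::field) edge_poly"
  assumes bal: "balanced u v" and A: "finite A" "A \<subseteq> toric_ideal G" "\<forall>p\<in>A. binomial p"
    "\<And>c. c \<noteq> 0 \<Longrightarrow> const c * B \<notin> A" and gen: "B \<in> Idl\<^bsub>R\<^esub> A"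
  shows "\<not> indispensable G B"
proof
  assume ind: "indispensable G B"
  define M where "M = {const c * B | c. c \<noteq> 0}"
  define T where "T = ((\<lambda>(u, v). monomial u - monomial v) ` graver - M) \<union> A"
  have fin: "finite T" using finite_graver A(1) by (simp add: T_def)
  have TI: "T \<subseteq> toric_ideal G"
    using A(2) balanced_in_toric by (auto simp: T_def graver_def)
  then have carr: "T \<subseteq> carrier R" using idealD(1)[OF toric_ideal] by blast
  have bin: "\<forall>p\<in>T. binomial p" using A(3) binomial_diff by (auto simp: T_def graver_def)
  note I = idealD[OF Idl_props(1)[OF carr]]
  have "A \<subseteq> Idl\<^bsub>R\<^esub> T" using Idl_props(2)[OF carr] by (auto simp: T_def)
  then have "Idl\<^bsub>R\<^esub> A \<subseteq> Idl\<^bsub>R\<^esub> T"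
    using A(2) idealD(1)[OF toric_ideal] by (intro Idl_props(3) Idl_props(1) carr) auto
  then have BT: "B \<in> Idl\<^bsub>R\<^esub> T" using gen by blast
  have "Idl\<^bsub>R\<^esub> T = toric_ideal G"
  proof (rule generators_if_graver[OF TI])
    fix a b assume ab: "(a, b) \<in> graver"
    let ?p = "monomial a - monomial b :: ('a, 'k) edge_poly"
    show "?p \<in> Idl\<^bsub>R\<^esub> T"
    proof (cases "?p \<in> M")
      case True
      then obtain c where "?p = const c * B" by (auto simp: M_def)
      then show ?thesis using I(4)[OF BT] single_carrier[of "{#}" c] by simp
    next
      case False
      then have "?p \<in> T" using ab by (auto simp: T_def)
      then show ?thesis using Idl_props(2)[OF carr] by blast
    qed
  qed
  then have T: "binomial_generators G T" using carr bin by (simp add: binomial_generators_def)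
  define P where "P S \<longleftrightarrow> S \<subseteq> T \<and> binomial_generators G S" for S
  have "P T" using T by (simp add: P_def)
  from ex_has_least_nat[of P, OF this, of card] obtain S where
    S: "P S" "\<And>S'. P S' \<Longrightarrow> card S \<le> card S'" by blast
  have "minimal_binomial_generators G S"
    unfolding minimal_binomial_generators_def
  proof (intro conjI allI impI notI)
    show "binomial_generators G S" using S(1) by (simp add: P_def)
    fix S' assume "S' \<subset> S" "binomial_generators G S'"
    then have "P S'" using S(1) by (auto simp: P_def)
    moreover have "card S' < card S"
      using \<open>S' \<subset> S\<close> S(1) fin by (intro psubset_card_mono) (auto simp: P_def intro: finite_subset)
    ultimately show False using S(2)[of S'] by simp
  qed
  then obtain c where "c \<noteq> 0" "const c * B \<in> S" using ind by (auto simp: indispensable_def)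
  then show False using S(1) A(4) by (auto simp: P_def T_def M_def)
qed

lemma two_fiber_if_indispensable:
  assumes bal: "balanced u v" and "u \<noteq> v"
    and ind: "indispensable G (monomial u - monomial v :: ('a, 'k::field) edge_poly)"
  shows "two_fiber u v"
proof (rule ccontr)
  let ?B = "monomial u - monomial v :: ('a, 'k) edge_poly"
  assume not: "\<not> two_fiber u v"
  \<comment> \<open>Supports distinguish the replacing binomials from every nonzero multiple of
    \<open>?B\<close>.\<close>
  have keys: "Poly_Mapping.keys (const c * ?B) = {u, v}" if "c \<noteq> 0" for c
    using that \<open>u \<noteq> v\<close>
    by (auto simp: const_times_diff in_keys_iff lookup_minus lookup_single when_def split: if_splits)
  have keys': "Poly_Mapping.keys (monomial a - monomial b :: ('a, 'k) edge_poly) = {a, b}" if "a \<noteq> b" for a b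
    using that by (auto simp: in_keys_iff lookup_minus lookup_single when_def split: if_splits)
  show False
  proof (cases "u \<inter># v = {#}")
    case True
    then obtain t where t: "balanced u t" "t \<noteq> u" "t \<noteq> v" using not by (auto simp: two_fiber_def)
    let ?A = "{monomial u - monomial t, monomial t - monomial v} :: ('a, 'k) edge_poly set"
    have tv: "balanced t v" using t(1) bal by (simp add: balanced_def)
    have AI: "?A \<subseteq> toric_ideal G" using t(1) tv balanced_in_toric by blast
    then have carr: "?A \<subseteq> carrier R" using idealD(1)[OF toric_ideal] by blast
    have "(monomial u - monomial t) + (monomial t - monomial v) \<in> Idl\<^bsub>R\<^esub> ?A"
      using Idl_props(2)[OF carr] by (intro idealD(3)[OF Idl_props(1)[OF carr]]) auto
    then have gen: "?B \<in> Idl\<^bsub>R\<^esub> ?A" by simp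
    have notin: "const c * ?B \<notin> ?A" if "c \<noteq> 0" for c
    proof
      assume "const c * ?B \<in> ?A"
      then have "const c * ?B = monomial u - monomial t \<or> const c * ?B = monomial t - monomial v"
        by blast
      then have "{u, v} = {u, t} \<or> {u, v} = {t, v}"
        using keys[OF that] keys'[OF t(2)[symmetric]] keys'[OF t(3)] by metis
      then show False using t by (auto simp: doubleton_eq_iff)
    qed
    have bin: "\<forall>p\<in>?A. binomial p"
      using binomial_diff[OF t(2)[symmetric]] binomial_diff[OF t(3)] by blast
    show False
      using not_indispensable_if_generated[OF bal _ AI bin notin gen] ind by simp
  next
    case False
    then obtain e where e: "e \<in># u" "e \<in># v"
      by (metis multiset_nonemptyE set_mset_inter IntD1 IntD2)
    define a b where "a = u - {#e#}" and "b = v - {#e#}"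
    have uv: "u = add_mset e a" "v = add_mset e b" using e by (simp_all add: a_def b_def)
    let ?A = "{monomial a - monomial b} :: ('a, 'k) edge_poly set"
    have "balanced a b" using bal by (auto simp: uv balanced_def fun_eq_iff)
    then have AI: "?A \<subseteq> toric_ideal G" using balanced_in_toric by blast
    then have carr: "?A \<subseteq> carrier R" using idealD(1)[OF toric_ideal] by blast
    have "monomial {#e#} * (monomial a - monomial b) \<in> Idl\<^bsub>R\<^esub> ?A"
      using Idl_props(2)[OF carr] bal
      by (intro idealD(4)[OF Idl_props(1)[OF carr]] single_carrier) (auto simp: balanced_def uv)
    then have gen: "?B \<in> Idl\<^bsub>R\<^esub> ?A" by (simp add: right_diff_distrib mult_single uv)
    have notin: "const c * ?B \<notin> ?A" if "c \<noteq> 0" for c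
    proof
      assume "const c * ?B \<in> ?A"
      then have "const c * ?B = monomial a - monomial b" by blast
      moreover have "a \<noteq> b" using \<open>u \<noteq> v\<close> by (simp add: uv)
      ultimately have "{u, v} = {a, b}" using keys[OF that] keys' by metis
      then have "u = a \<or> u = b \<and> v = a" by (auto simp: doubleton_eq_iff)
      then show False using arg_cong[of u b size] arg_cong[of v a size] by (auto simp: uv)
    qed
    have bin: "\<forall>p\<in>?A. binomial p" using \<open>u \<noteq> v\<close> by (auto simp: uv intro: binomial_diff)
    show False
      using not_indispensable_if_generated[OF bal _ AI bin notin gen] ind by simp
  qed
qed

end

subsection \<open>Blocks\<close>

lemma reach_refl: "(x, x) \<in> reach G"
  by (simp add: reach_def)

lemma reach_edge: "{x, y} \<in> edges G \<Longrightarrow> (x, y) \<in> reach G"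
  by (auto simp: reach_def)

lemma reach_trans: "(x, y) \<in> reach G \<Longrightarrow> (y, z) \<in> reach G \<Longrightarrow> (x, z) \<in> reach G"
  by (simp add: reach_def)

lemma reach_sym: "(x, y) \<in> reach G \<Longrightarrow> (y, x) \<in> reach G"
proof -
  have "sym {(x, y). {x, y} \<in> edges G}" by (auto simp: sym_def insert_commute)
  then show "(x, y) \<in> reach G \<Longrightarrow> (y, x) \<in> reach G"
    unfolding reach_def by (meson sym_rtrancl symD)
qed

lemma reach_invariant:
  assumes "(x, y) \<in> reach G" "x \<in> S" "\<And>e. e \<in> edges G \<Longrightarrow> e \<inter> S \<noteq> {} \<Longrightarrow> e \<subseteq> S"
  shows "y \<in> S"
  using assms(1,2) unfolding reach_def
  by (induction rule: rtrancl_induct) (use assms(3) in blast)+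

lemma subgraph_trans: "subgraph A B \<Longrightarrow> subgraph B C \<Longrightarrow> subgraph A C"
  by (auto simp: subgraph_def)

lemma subgraph_antisym: "subgraph A B \<Longrightarrow> subgraph B A \<Longrightarrow> A = B"
  by (auto simp: subgraph_def prod_eq_iff)

lemma subgraph_refl: "subgraph A B \<Longrightarrow> subgraph A A"
  by (auto simp: subgraph_def)

lemma subgraph_measure:
  assumes "subgraph A B" "finite (verts B)" "finite (edges B)"
    "card (verts B) + card (edges B) \<le> card (verts A) + card (edges A)"
  shows "A = B"
proof -
  have "verts A \<subseteq> verts B" "edges A \<subseteq> edges B" using assms(1) by (auto simp: subgraph_def)
  moreover from this assms(2,3) have "card (verts A) \<le> card (verts B)" "card (edges A) \<le> card (edges B)"
    by (simp_all add: card_mono)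
  ultimately show ?thesis using assms(2-4)
    by (intro prod_eqI card_subset_eq) simp_all
qed

text \<open>Finiteness bounds the number of vertices plus edges, and a nonseparable extension for
  which it is largest is maximal for inclusion.\<close>

lemma obtain_block:
  assumes "subgraph B0 G" "nonseparable B0" "finite (verts G)" "finite (edges G)"
  obtains B where "block G B" "subgraph B0 B"
proof -
  define P where "P H \<longleftrightarrow> subgraph H G \<and> nonseparable H \<and> subgraph B0 H" for H
  define m where "m H = card (verts H) + card (edges H)" for H :: "'a ugraph"
  have "P B0" using assms(1,2) subgraph_refl[OF assms(1)] by (auto simp: P_def)
  moreover have "\<forall>H. P H \<longrightarrow> m H < Suc (m G)"
    using assms(3,4) by (auto simp: P_def m_def subgraph_def less_Suc_eq_le intro!: add_mono card_mono)
  ultimately obtain B where B: "P B" "\<And>H. P H \<Longrightarrow> m H \<le> m B"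
    using ex_has_greatest_nat[of P B0 m "Suc (m G)"] by blast
  have "block G B"
    unfolding block_def
  proof (intro conjI allI impI)
    fix H assume H: "subgraph H G \<and> nonseparable H \<and> subgraph B H"
    then have "P H" using B(1) subgraph_trans[of B0 B H] by (simp add: P_def)
    have "finite (verts H)" "finite (edges H)"
      using H assms(3,4) by (auto simp: subgraph_def intro: finite_subset)
    then show "H = B" using subgraph_measure[of B H] H B(2)[OF \<open>P H\<close>] by (auto simp: m_def)
  qed (use B(1) in \<open>auto simp: P_def\<close>)
  then show ?thesis using that B(1) by (auto simp: P_def)
qed

lemma nonseparable_vertex: "nonseparable ({x}, {})"
  by (auto simp: nonseparable_def connected_graph_def cut_vertex_def reach_refl)

lemma nonseparable_edge: "nonseparable ({a, b}, {{a, b}})"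
proof -
  have "(a, b) \<in> reach ({a, b}, {{a, b}})" by (rule reach_edge) simp
  then show ?thesis
    using reach_sym[of a b "({a, b}, {{a, b}})"]
    by (auto simp: nonseparable_def connected_graph_def cut_vertex_def reach_refl)
qed

text \<open>Lists of length 2 also occur below: they give a single edge, which is all that remains
  of a cycle whose closing edge coincides with its path.\<close>

definition cycle_on :: "'a list \<Rightarrow> 'a ugraph" where
  "cycle_on xs = (set xs, {{xs ! i, xs ! (Suc i mod length xs)} | i. i < length xs})"

text \<open>Deleting \<open>c k\<close> leaves the path \<open>c (k + 1)\<close>,
  \<open>c (k + 2)\<close>, ... through all other vertices. Indices modulo the length spare a case
  distinction at the closing edge.\<close>

lemma nonseparable_cycle_on:
  assumes "distinct xs" "xs \<noteq> []"
  shows "nonseparable (cycle_on xs)"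
proof -
  let ?n = "length xs" and ?C = "cycle_on xs"
  have n: "0 < ?n" using assms by simp
  define c where "c i = xs ! (i mod ?n)" for i
  have edge: "{c i, c (Suc i)} \<in> edges ?C" for i
    unfolding cycle_on_def c_def using n
    by (auto simp: mod_Suc_eq intro!: exI[of _ "i mod ?n"])
  have vert: "\<exists>j<?n. x = c (k + j)" if "x \<in> verts ?C" "k < ?n" for x k
  proof -
    obtain i where i: "i < ?n" "x = xs ! i"
      using \<open>x \<in> verts ?C\<close> by (auto simp: cycle_on_def in_set_conv_nth)
    define j where "j = (if k \<le> i then i - k else i + ?n - k)"
    have "j < ?n" "(k + j) mod ?n = i" using i that(2) by (auto simp: j_def)
    then show ?thesis using i(2) by (auto simp: c_def)
  qed
  have all: "(c 0, c j) \<in> reach ?C" for j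
  proof (induction j)
    case (Suc j)
    then show ?case by (rule reach_trans[OF _ reach_edge[OF edge]])
  qed (rule reach_refl)
  have "connected_graph ?C"
    unfolding connected_graph_def
  proof (intro conjI ballI)
    show "verts ?C \<noteq> {}" using n by (simp add: cycle_on_def)
    fix x y assume "x \<in> verts ?C" "y \<in> verts ?C"
    then obtain i j where "x = c i" "y = c j" using vert[of x 0] vert[of y 0] n by auto
    then show "(x, y) \<in> reach ?C" using all reach_sym reach_trans by metis
  qed
  moreover have "\<not> cut_vertex ?C v" for v
  proof
    assume cut: "cut_vertex ?C v"
    let ?D = "delete_vertex ?C v"
    obtain k where k: "k < ?n" "v = c k"
      using cut vert[of v 0] n by (auto simp: cut_vertex_def)
    have neq: "c (k + j) \<noteq> v" if "0 < j" "j < ?n" for j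
    proof
      assume "c (k + j) = v"
      then have "(k + j) mod ?n = k mod ?n"
        using k(2) n assms(1) by (simp add: c_def nth_eq_iff_index_eq)
      then have "?n dvd j"
        by (metis add_diff_cancel_left' le_add1 mod_eq_dvd_iff_nat)
      then show False using that by (simp add: nat_dvd_not_less)
    qed
    have walk: "(c (k + 1), c (k + Suc j)) \<in> reach ?D" if "Suc j < ?n" for j
      using that
    proof (induction j)
      case (Suc j)
      have "{c (k + Suc j), c (k + Suc (Suc j))} \<in> edges ?D"
        using edge[of "k + Suc j"] neq[of "Suc j"] neq[of "Suc (Suc j)"] Suc.prems
        by (auto simp: delete_vertex_def)
      from reach_trans[OF Suc.IH reach_edge[OF this]] Suc.prems show ?case by simp
    qed (simp add: reach_refl)
    have "(c (k + 1), x) \<in> reach ?D" if x: "x \<in> verts ?C - {v}" for x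
    proof -
      obtain j where j: "j < ?n" "x = c (k + j)" using vert[of x k] k x by auto
      then have "0 < j" using x k(2) by (cases j) auto
      then show ?thesis using walk[of "j - 1"] j by simp
    qed
    then show False using cut unfolding cut_vertex_def by (meson reach_sym reach_trans)
  qed
  ultimately show ?thesis by (simp add: nonseparable_def)
qed

lemma cycle_graph_cycle_on: "distinct xs \<Longrightarrow> 3 \<le> length xs \<Longrightarrow> cycle_graph (cycle_on xs)"
  by (auto simp: cycle_graph_def cycle_on_def)

subsection \<open>Primitive closed walks as periodic vertex sequences\<close>

definition cedge :: "(nat \<Rightarrow> 'a) \<Rightarrow> nat \<Rightarrow> 'a set" where
  "cedge v i = {v i, v (Suc i)}"

text \<open>It vanishes at every vertex exactly when the edges at even positions of \<open>I\<close>
  and those at odd positions have the same vertex degrees.\<close>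

definition altsum :: "(nat \<Rightarrow> 'a) \<Rightarrow> nat set \<Rightarrow> 'a \<Rightarrow> int" where
  "altsum v I x = (\<Sum>i\<in>I. (- 1) ^ i * of_bool (x \<in> cedge v i))"

definition cgraph :: "(nat \<Rightarrow> 'a) \<Rightarrow> 'a ugraph" where
  "cgraph v = (range v, range (cedge v))"

definition double :: "(nat \<Rightarrow> 'a) \<Rightarrow> nat \<Rightarrow> 'a \<Rightarrow> bool" where
  "double v L x \<longleftrightarrow> (\<exists>i j. i mod L \<noteq> j mod L \<and> v i = x \<and> v j = x)"

text \<open>The positions between \<open>p\<close> and \<open>q\<close> and those between
  \<open>q\<close> and \<open>p + L\<close> are the two sides of the vertex
  \<open>v p = v q\<close>. As \<open>p\<close> is arbitrary, no rotation needs special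
  treatment.\<close>

definition separated :: "(nat \<Rightarrow> 'a) \<Rightarrow> nat \<Rightarrow> 'a \<Rightarrow> 'a \<Rightarrow> bool" where
  "separated v L x y \<longleftrightarrow>
     (\<exists>p r q s. p < r \<and> r < q \<and> q < s \<and> s < p + L \<and> v p = v q \<and> v r = x \<and> v s = y)"

text \<open>A repeated edge counts as several positions. The last assumption encodes primitivity: a
  proper nonempty set of positions with vanishing alternating sum would yield a shorter even closed
  walk with compatible parities.\<close>

locale prim_cycle =
  fixes v :: "nat \<Rightarrow> 'a" and L :: nat
  assumes periodic: "v (i + L) = v i"
    and even_L: "even L" and L_gt_2: "2 < L"
    and neq_Suc: "v i \<noteq> v (Suc i)"
    and primitive: "I \<subseteq> {..<L} \<Longrightarrow> (\<forall>x. altsum v I x = 0) \<Longrightarrow> I = {} \<or> I = {..<L}"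
begin

lemma L_pos: "0 < L" using L_gt_2 by simp

lemma v_mult: "v (i + k * L) = v i"
proof (induction k)
  case (Suc k)
  have "v (i + Suc k * L) = v ((i + k * L) + L)" by (simp add: algebra_simps)
  then show ?case using Suc periodic by simp
qed simp

lemma v_mod: "v (i mod L) = v i"
  using v_mult[of "i mod L" "i div L"] by (simp add: add.commute)

lemma v_cong: "i mod L = j mod L \<Longrightarrow> v i = v j"
  using v_mod by metis

lemma cedge_mod: "cedge v (i mod L) = cedge v i"
  using v_mod v_cong[of "Suc (i mod L)" "Suc i"] by (simp add: cedge_def mod_Suc_eq)

lemma cedge_cong: "i mod L = j mod L \<Longrightarrow> cedge v i = cedge v j"
  using cedge_mod by metis

lemma even_mod: "even (i mod L) = even i"
  using even_L by (simp add: dvd_mod_iff)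

lemma range_v: "range v = v ` {..<L}"
  by (auto simp: image_iff intro!: bexI[of _ "_ mod L"] simp: v_mod L_pos)

lemma range_cedge: "range (cedge v) = cedge v ` {..<L}"
  by (auto simp: image_iff intro!: bexI[of _ "_ mod L"] simp: cedge_mod L_pos)

lemma card_cedge: "card (cedge v i) = 2"
  using neq_Suc by (simp add: cedge_def)

text \<open>Rotation by one position flips all signs, since \<open>L\<close> is even, and keeps
  vanishing sums. By iteration, statements may be proved at position 0.\<close>

lemma shift_Suc: "prim_cycle (\<lambda>i. v (Suc i)) L"
proof
  fix I assume I: "I \<subseteq> {..<L}" and zero: "\<forall>x. altsum (\<lambda>i. v (Suc i)) I x = 0"
  let ?f = "\<lambda>i. Suc i mod L"
  have inj: "inj_on ?f {..<L}"
  proof (rule inj_onI)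
    fix i j assume "i \<in> {..<L}" "j \<in> {..<L}" "?f i = ?f j"
    then show "i = j" by (auto simp: mod_Suc split: if_splits)
  qed
  have "altsum v (?f ` I) x = - altsum (\<lambda>i. v (Suc i)) I x" for x
  proof -
    have "altsum v (?f ` I) x = (\<Sum>i\<in>I. (- 1) ^ (?f i) * of_bool (x \<in> cedge v (?f i)))"
      unfolding altsum_def using inj I by (subst sum.reindex) (auto intro: inj_on_subset)
    also have "\<dots> = (\<Sum>i\<in>I. - ((- 1) ^ i * of_bool (x \<in> cedge (\<lambda>i. v (Suc i)) i)))"
    proof (rule sum.cong[OF refl])
      fix i assume "i \<in> I"
      have "(- 1 :: int) ^ (?f i) = - ((- 1) ^ i)"
        using even_mod[of "Suc i"] by (auto simp: uminus_power_if)
      moreover have "cedge v (?f i) = cedge (\<lambda>i. v (Suc i)) i"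
        unfolding cedge_mod by (simp add: cedge_def)
      ultimately show "(- 1) ^ (?f i) * of_bool (x \<in> cedge v (?f i))
        = - ((- 1 :: int) ^ i * of_bool (x \<in> cedge (\<lambda>i. v (Suc i)) i))" by simp
    qed
    finally show ?thesis by (simp add: altsum_def sum_negf)
  qed
  then have "\<forall>x. altsum v (?f ` I) x = 0" using zero by simp
  moreover have "?f ` I \<subseteq> {..<L}" using L_pos by auto
  ultimately have "?f ` I = {} \<or> ?f ` I = {..<L}" by (intro primitive) auto
  then show "I = {} \<or> I = {..<L}"
  proof
    assume "?f ` I = {..<L}"
    then have "card I = card {..<L}"
      using card_image[of ?f I] inj I by (metis inj_on_subset)
    then show ?thesis using I by (simp add: card_subset_eq)
  qed simp
next
  show "v (Suc (i + L)) = v (Suc i)" for i using periodic[of "Suc i"] by simp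
qed (use even_L L_gt_2 neq_Suc in auto)

lemma shift: "prim_cycle (\<lambda>i. v (i + k)) L"
proof (induction k)
  case 0
  then show ?case by (simp add: prim_cycle_axioms)
next
  case (Suc k)
  then show ?case using prim_cycle.shift_Suc by fastforce
qed

lemma cedge_shift: "cedge (\<lambda>i. v (i + k)) i = cedge v (i + k)"
  by (simp add: cedge_def)

lemma ex_shift: "\<exists>j. (j + k) mod L = i mod L"
proof
  have "i + k * L - k + k = i + k * L" using L_pos by (simp add: trans_le_add2)
  then show "(i + k * L - k + k) mod L = i mod L" by simp
qed

lemma range_shift:
  assumes "\<And>i j. i mod L = j mod L \<Longrightarrow> f i = f j"
  shows "range (\<lambda>i. f (i + k)) = range f"
proof (intro equalityI subsetI)
  fix y assume "y \<in> range f"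
  then obtain i where "y = f i" by blast
  moreover obtain j where "(j + k) mod L = i mod L" using ex_shift by blast
  ultimately have "y = f (j + k)" using assms by metis
  then show "y \<in> range (\<lambda>i. f (i + k))" by blast
qed blast

lemma cgraph_shift: "cgraph (\<lambda>i. v (i + k)) = cgraph v"
  using range_shift[of v k, OF v_cong] range_shift[of "cedge v" k, OF cedge_cong]
  by (simp add: cgraph_def cedge_shift)

lemma double_shift: "double (\<lambda>i. v (i + k)) L x \<longleftrightarrow> double v L x"
proof
  assume "double v L x"
  then obtain i j where ij: "i mod L \<noteq> j mod L" "v i = x" "v j = x" by (auto simp: double_def)
  have eq: "n + k * L - k + k = n + k * L" for n using L_pos by (simp add: trans_le_add2)
  have "(i + k * L - k) mod L \<noteq> (j + k * L - k) mod L"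
  proof
    assume "(i + k * L - k) mod L = (j + k * L - k) mod L"
    then have "(i + k * L - k + k) mod L = (j + k * L - k + k) mod L" by (metis mod_add_left_eq)
    then show False using ij(1) by (simp add: eq)
  qed
  moreover have "v (i + k * L - k + k) = x" "v (j + k * L - k + k) = x"
    using ij by (simp_all add: eq v_mult)
  ultimately show "double (\<lambda>i. v (i + k)) L x" unfolding double_def by blast
next
  assume "double (\<lambda>i. v (i + k)) L x"
  then obtain i j where ij: "i mod L \<noteq> j mod L" "v (i + k) = x" "v (j + k) = x"
    by (auto simp: double_def)
  then have "(i + k) mod L \<noteq> (j + k) mod L" by (simp add: nat_mod_eq_iff)
  then show "double v L x" using ij by (auto simp: double_def)
qed

lemma separated_shift: "separated (\<lambda>i. v (i + k)) L x y \<Longrightarrow> separated v L x y"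
proof -
  assume "separated (\<lambda>i. v (i + k)) L x y"
  then obtain p r q s where "p < r" "r < q" "q < s" "s < p + L" "v (p + k) = v (q + k)"
    "v (r + k) = x" "v (s + k) = y" unfolding separated_def by blast
  then show ?thesis unfolding separated_def
    by (intro exI[of _ "p + k"] exI[of _ "r + k"] exI[of _ "q + k"] exI[of _ "s + k"]) auto
qed

section \<open>Repeated vertices of a primitive closed walk\<close>

lemma altsum_interval:
  assumes "a \<le> b"
  shows "altsum v {a..<b} x = (- 1) ^ a * of_bool (v a = x) - (- 1) ^ b * of_bool (v b = x)"
  using assms
proof (induction b rule: dec_induct)
  case base
  then show ?case by (simp add: altsum_def)
next
  case (step n)
  have "altsum v {a..<Suc n} x = altsum v {a..<n} x + (- 1) ^ n * of_bool (x \<in> cedge v n)"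
    using step(1) by (simp add: altsum_def)
  moreover have "of_bool (x \<in> cedge v n) = (of_bool (v n = x) + of_bool (v (Suc n) = x) :: int)"
    using neq_Suc[of n] by (auto simp: cedge_def)
  ultimately show ?case using step by (simp add: algebra_simps)
qed

lemma altsum_Un: "finite I \<Longrightarrow> finite J \<Longrightarrow> I \<inter> J = {} \<Longrightarrow> altsum v (I \<union> J) x = altsum v I x + altsum v J x"
  unfolding altsum_def by (rule sum.union_disjoint)

lemma primitive_proper:
  assumes "I \<subseteq> {..<L}" "i \<in> I" "j < L" "j \<notin> I"
  shows "\<exists>x. altsum v I x \<noteq> 0"
  using primitive[OF assms(1)] assms(2-4) by blast

text \<open>Two positions of opposite parity with the same edge would cancel, and by
  \<open>2 < L\<close> they form a proper set of positions.\<close>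

lemma cedge_parity:
  assumes "even i \<noteq> even j"
  shows "cedge v i \<noteq> cedge v j"
proof
  assume eq: "cedge v i = cedge v j"
  let ?i = "i mod L" and ?j = "j mod L"
  have par: "even ?i \<noteq> even ?j" using assms even_mod by simp
  then have ne: "?i \<noteq> ?j" by auto
  have "card {?i, ?j} < card {..<L}" using ne L_gt_2 by simp
  moreover have sub: "{?i, ?j} \<subseteq> {..<L}" using L_pos by simp
  ultimately have "\<not> {..<L} \<subseteq> {?i, ?j}" using card_mono[of "{?i, ?j}" "{..<L}"] by auto
  then obtain m where "m < L" "m \<notin> {?i, ?j}" by blast
  from primitive_proper[OF sub _ this] obtain x where "altsum v {?i, ?j} x \<noteq> 0" by blast
  moreover have "altsum v {?i, ?j} x = 0"
    using ne par eq
    by (auto simp: altsum_def cedge_mod uminus_power_if simp del: sum_mult_of_bool_eq sum_of_bool_mult_eq)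
  ultimately show False by blast
qed

text \<open>Between two occurrences of equal parity the alternating sum telescopes to zero on a
  proper interval.\<close>

lemma parity_if_v_eq:
  assumes "v i = v j" "i mod L \<noteq> j mod L"
  shows "even i \<noteq> even j"
proof -
  have lt: "even i \<noteq> even j" if "i < j" "j < L" "v i = v j" for i j
  proof
    assume par: "even i = even j"
    then have "j \<noteq> i + 1" by auto
    have "{i..<j} \<subseteq> {..<L}" using that by auto
    from primitive_proper[OF this, of i j] obtain x where "altsum v {i..<j} x \<noteq> 0"
      using \<open>i < j\<close> \<open>j < L\<close> by auto
    then show False
      using altsum_interval[of i j x] that par by (auto simp: uminus_power_if split: if_splits)
  qed
  have "even (i mod L) \<noteq> even (j mod L)"
    using assms lt[of "i mod L" "j mod L"] lt[of "j mod L" "i mod L"] L_pos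
    by (cases "i mod L < j mod L") (auto simp: v_mod)
  then show ?thesis by (simp add: even_mod)
qed

text \<open>Of three occurrences at distinct positions, two would have the same parity.\<close>

lemma two_occurrences:
  assumes "v i = v j" "v j = v k" "i mod L \<noteq> j mod L" "j mod L \<noteq> k mod L"
  shows "i mod L = k mod L"
  using parity_if_v_eq[of i j] parity_if_v_eq[of j k] parity_if_v_eq[of i k] assms by auto

text \<open>A vertex on both sides of \<open>v 0 = v q\<close> would make the sum over
  \<open>{0..<r}\<close> and \<open>{q..<s}\<close> vanish: \<open>q\<close> is odd, so the terms at
  \<open>v 0\<close> cancel, and \<open>r\<close>, \<open>s\<close> have opposite parity, so the
  terms at \<open>v r\<close> cancel.\<close>

lemma sides_disjoint0:
  assumes "0 < r" "r < q" "q < s" "s < L" "v 0 = v q"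
  shows "v r \<noteq> v s"
proof
  assume eq: "v r = v s"
  have par: "even q = False" "even s \<noteq> even r"
    using parity_if_v_eq[of 0 q] parity_if_v_eq[of r s] assms eq by auto
  let ?I = "{0..<r} \<union> {q..<s}"
  have "?I \<subseteq> {..<L}" using assms by auto
  from primitive_proper[OF this, of 0 s] obtain x where x: "altsum v ?I x \<noteq> 0"
    using assms by auto
  have "altsum v ?I x = altsum v {0..<r} x + altsum v {q..<s} x"
    using assms by (intro altsum_Un) auto
  then show False using x altsum_interval[of 0 r x] altsum_interval[of q s x] assms par eq
    by (auto simp: uminus_power_if split: if_splits)
qed

lemma sides_disjoint:
  assumes "p < r" "r < q" "q < s" "s < p + L" "v p = v q"
  shows "v r \<noteq> v s"
proof -
  interpret s: prim_cycle "\<lambda>i. v (i + p)" L by (rule shift)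
  show ?thesis using s.sides_disjoint0[of "r - p" "q - p" "s - p"] assms by simp
qed

text \<open>Walk edges avoiding \<open>v 0\<close> cannot leave the side \<open>?S\<close>. If
  \<open>H\<close> meets both sides, connectedness puts \<open>v 0\<close> into \<open>H\<close>,
  where it is a cut vertex.\<close>

lemma nonseparable_split0:
  assumes H: "subgraph H (cgraph v)" "nonseparable H"
    and pos: "0 < r" "r < q" "q < s" "s < L" and c: "v 0 = v q"
    and in_H: "v r \<in> verts H" "v s \<in> verts H"
  shows False
proof -
  let ?S = "v ` {0<..<q}" and ?c = "v 0"
  have out: "v j \<notin> ?S" if "q < j" "j < L" for j
  proof
    assume "v j \<in> ?S"
    then obtain i where "0 < i" "i < q" "v i = v j" by auto
    then show False using sides_disjoint0[of i q j] that c by blast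
  qed
  have edge: "e \<subseteq> ?S" if "e \<in> range (cedge v)" "?c \<notin> e" "e \<inter> ?S \<noteq> {}" for e
  proof -
    obtain i where i: "i < L" "e = cedge v i" using \<open>e \<in> range (cedge v)\<close> range_cedge by auto
    have ne0: "i \<noteq> 0" using \<open>?c \<notin> e\<close> unfolding i(2) cedge_def by (metis insertI1)
    have ne: "i \<noteq> q" "Suc i \<noteq> q" "Suc i \<noteq> L"
      using \<open>?c \<notin> e\<close> c periodic[of 0] by (auto simp: i(2) cedge_def)
    show ?thesis
    proof (cases "i < q")
      case True
      then show ?thesis using ne ne0 by (auto simp: i(2) cedge_def)
    next
      case False
      then have "q < i" "Suc i < L" using ne i(1) by auto
      then have "v i \<notin> ?S" "v (Suc i) \<notin> ?S"
        by (simp_all add: out)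
      then show ?thesis using that(3) by (auto simp: i(2) cedge_def)
    qed
  qed
  have sE: "edges H \<subseteq> range (cedge v)" "\<And>e. e \<in> edges H \<Longrightarrow> e \<subseteq> verts H"
    using H(1) by (auto simp: subgraph_def cgraph_def)
  have "v r \<in> ?S" using pos by auto
  moreover have "v s \<notin> ?S" using out pos by simp
  moreover have "e \<subseteq> ?S" if "e \<in> edges H" "?c \<notin> e" "e \<inter> ?S \<noteq> {}" for e
    using edge[of e] that sE(1) by blast
  ultimately have unreach: "(v r, v s) \<notin> reach H'"
    if "edges H' \<subseteq> {e \<in> edges H. ?c \<notin> e}" for H'
    using reach_invariant[of "v r" "v s" H' ?S] that by (metis (mono_tags, lifting) mem_Collect_eq subsetD)
  have "v r \<noteq> ?c" "v s \<noteq> ?c"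
    using two_occurrences[of 0 q r] two_occurrences[of 0 q s] pos c by auto
  moreover have reach: "(v r, v s) \<in> reach H"
    using H(2) in_H by (auto simp: nonseparable_def connected_graph_def)
  moreover have "?c \<in> verts H"
  proof (rule ccontr)
    assume "?c \<notin> verts H"
    then show False using unreach[of H] sE(2) reach by blast
  qed
  moreover have "(v r, v s) \<notin> reach (delete_vertex H ?c)"
    by (rule unreach) (simp add: delete_vertex_def)
  ultimately have "cut_vertex H ?c" using in_H unfolding cut_vertex_def by blast
  then show False using H(2) by (auto simp: nonseparable_def)
qed

lemma nonseparable_split:
  assumes "subgraph H (cgraph v)" "nonseparable H" "p < r" "r < q" "q < s" "s < p + L" "v p = v q"
    "v r \<in> verts H" "v s \<in> verts H"
  shows False
proof -
  interpret s: prim_cycle "\<lambda>i. v (i + p)" L by (rule shift)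
  have "0 < r - p" "r - p < q - p" "q - p < s - p" "s - p < L" using assms by auto
  then show ?thesis using s.nonseparable_split0[of H "r - p" "q - p" "s - p"] assms
    by (simp add: cgraph_shift)
qed

end

section \<open>Loop erasure and the cycle through an edge\<close>

text \<open>From \<open>k\<close>, jump to the last occurrence \<open>l\<close> of
  \<open>v k\<close> up to \<open>r\<close> and continue at \<open>Suc l\<close>. The entries of
  \<open>ks\<close> are the starting positions of the erased loops, so \<open>v\<close> along
  \<open>ks\<close> is a simple path; the last clause locates every position within its
  loop.\<close>

lemma loop_erasure:
  fixes v :: "nat \<Rightarrow> 'a"
  assumes "k \<le> r"
  shows "\<exists>ks. ks \<noteq> [] \<and> hd ks = k \<and> set ks \<subseteq> {k..r} \<and> sorted_wrt (<) ks \<and>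
    distinct (map v ks) \<and> v (last ks) = v r \<and>
    (\<forall>i. Suc i < length ks \<longrightarrow> (\<exists>l<r. v l = v (ks ! i) \<and> ks ! Suc i = Suc l)) \<and>
    (\<forall>j\<in>{k..r}. \<exists>i<length ks. \<exists>l. ks ! i \<le> j \<and> j \<le> l \<and> l \<le> r \<and> v l = v (ks ! i) \<and>
       (if Suc i < length ks then ks ! Suc i = Suc l else l = r))"
  using assms
proof (induction "r - k" arbitrary: k rule: less_induct)
  case less
  define l where "l = Max {l \<in> {k..r}. v l = v k}"
  have "l \<in> {l \<in> {k..r}. v l = v k}"
    unfolding l_def by (rule Max_in) (use less.prems in auto)
  then have l: "k \<le> l" "l \<le> r" "v l = v k" by auto
  have after: "v j \<noteq> v k" if "l < j" "j \<le> r" for j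
  proof
    assume "v j = v k"
    then have "j \<le> l" unfolding l_def by (intro Max_ge) (use that l in auto)
    then show False using that by simp
  qed
  show ?case
  proof (cases "l = r")
    case True
    then show ?thesis using l by (intro exI[of _ "[k]"]) auto
  next
    case False
    then have "Suc l \<le> r" "r - Suc l < r - k" using l by auto
    from less.hyps[OF this(2,1)] obtain ks where ks: "ks \<noteq> []" "hd ks = Suc l" "set ks \<subseteq> {Suc l..r}"
      "sorted_wrt (<) ks" "distinct (map v ks)" "v (last ks) = v r"
      and step: "\<And>i. Suc i < length ks \<Longrightarrow> \<exists>l<r. v l = v (ks ! i) \<and> ks ! Suc i = Suc l"
      and cover: "\<And>j. j \<in> {Suc l..r} \<Longrightarrow> \<exists>i<length ks. \<exists>l. ks ! i \<le> j \<and> j \<le> l \<and> l \<le> r \<and> v l = v (ks ! i) \<and>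
       (if Suc i < length ks then ks ! Suc i = Suc l else l = r)" by blast
    have hd: "ks ! 0 = Suc l" using ks(1,2) by (simp add: hd_conv_nth)
    show ?thesis
    proof (intro exI[of _ "k # ks"] conjI allI ballI impI)
      show "set (k # ks) \<subseteq> {k..r}" using ks(3) l by auto
      show "sorted_wrt (<) (k # ks)" using ks(3,4) l by auto
      have "v k \<notin> v ` set ks"
      proof
        assume "v k \<in> v ` set ks"
        then obtain j where "j \<in> set ks" "v j = v k" by auto
        then show False using ks(3) after[of j] by auto
      qed
      then show "distinct (map v (k # ks))" using ks(5) by simp
      show "\<exists>l<r. v l = v ((k # ks) ! i) \<and> (k # ks) ! Suc i = Suc l" if "Suc i < length (k # ks)" for i
      proof (cases i)
        case 0
        then show ?thesis using hd l \<open>Suc l \<le> r\<close> by (intro exI[of _ l]) auto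
      next
        case (Suc i')
        then show ?thesis using step[of i'] that by simp
      qed
      show "\<exists>i<length (k # ks). \<exists>l. (k # ks) ! i \<le> j \<and> j \<le> l \<and> l \<le> r \<and> v l = v ((k # ks) ! i) \<and>
        (if Suc i < length (k # ks) then (k # ks) ! Suc i = Suc l else l = r)" if "j \<in> {k..r}" for j
      proof (cases "j \<le> l")
        case True
        then show ?thesis using hd l that ks(1) by (intro exI[of _ 0]) auto
      next
        case False
        then have "j \<in> {Suc l..r}" using that by simp
        from cover[OF this] obtain i l' where "i < length ks" "ks ! i \<le> j" "j \<le> l'" "l' \<le> r" "v l' = v (ks ! i)"
          "if Suc i < length ks then ks ! Suc i = Suc l' else l' = r" by blast
        then show ?thesis by (intro exI[of _ "Suc i"] conjI exI[of _ l']) auto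
      qed
    qed (use ks in auto)
  qed
qed

context prim_cycle
begin

lemma cedge_last: "cedge v (L - 1) = {v (L - 1), v 0}"
  using periodic[of 0] L_pos by (simp add: cedge_def)

text \<open>Loop erasure on the positions \<open>0\<close> to \<open>L - 1\<close> gives a simple
  path from \<open>v 0\<close> to \<open>v (L - 1)\<close>, closed by the edge at
  \<open>L - 1\<close>. Vertices off the cycle lie inside an erased loop from \<open>a\<close> to
  \<open>b\<close>. By primitivity such a loop meets the cycle only at \<open>v a\<close>, so no
  walk edge is a chord of the cycle.\<close>

lemma obtain_cycle:
  obtains xs where "distinct xs" "xs \<noteq> []" "hd xs = v 0" "last xs = v (L - 1)" "set xs \<subseteq> range v"
    "\<And>j. j < L \<Longrightarrow> v j \<in> set xs \<or> (\<exists>a b. a < j \<and> j < b \<and> b < L \<and> v a = v b \<and>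
       (\<forall>x\<in>set xs. x \<noteq> v a \<longrightarrow> (\<exists>m<L. (m < a \<or> b < m) \<and> x = v m)))"
    "\<And>i. cedge v i \<subseteq> set xs \<Longrightarrow> cedge v i \<in> edges (cycle_on xs)"
    "\<And>i. Suc i < length xs \<Longrightarrow> \<exists>l<L - 1. cedge v l = {xs ! i, xs ! Suc i}"
    "cedge v (L - 1) \<in> edges (cycle_on xs)"
proof -
  obtain ks where ks: "ks \<noteq> []" "hd ks = 0" "set ks \<subseteq> {0..L - 1}" "sorted_wrt (<) ks"
    "distinct (map v ks)" "v (last ks) = v (L - 1)"
    and step: "\<And>i. Suc i < length ks \<Longrightarrow> \<exists>l<L - 1. v l = v (ks ! i) \<and> ks ! Suc i = Suc l"
    and cover: "\<And>j. j \<in> {0..L - 1} \<Longrightarrow> \<exists>i<length ks. \<exists>l. ks ! i \<le> j \<and> j \<le> l \<and> l \<le> L - 1 \<and> v l = v (ks ! i) \<and>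
       (if Suc i < length ks then ks ! Suc i = Suc l else l = L - 1)"
    using loop_erasure[of 0 "L - 1" v] by blast
  define xs where "xs = map v ks"
  have xs: "distinct xs" "xs \<noteq> []" "hd xs = v 0" "last xs = v (L - 1)"
    using ks by (simp_all add: xs_def hd_map last_map)
  have ks_L: "m < L" if "m \<in> set ks" for m using ks(3) that L_pos by fastforce
  have outside: "m \<le> ks ! i \<or> l < m"
    if "m \<in> set ks" "i < length ks" "if Suc i < length ks then ks ! Suc i = Suc l else l = L - 1" for m i l
  proof -
    obtain i' where i': "i' < length ks" "m = ks ! i'" using \<open>m \<in> set ks\<close> by (auto simp: in_set_conv_nth)
    consider "i' < i" | "i' = i" | "Suc i = i'" | "Suc i < i'" by linarith
    then show ?thesis
    proof cases
      case 1
      then show ?thesis using sorted_wrt_nth_less[OF ks(4), of i' i] i' that(2) by simp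
    next
      case 4
      then show ?thesis using sorted_wrt_nth_less[OF ks(4), of "Suc i" i'] i' that(3) by simp
    qed (use i' that(3) in auto)
  qed
  have closing: "cedge v (L - 1) \<in> edges (cycle_on xs)"
  proof -
    let ?n = "length xs"
    have "cedge v (L - 1) = {xs ! (?n - 1), xs ! (Suc (?n - 1) mod ?n)}"
      using xs cedge_last by (simp add: hd_conv_nth last_conv_nth)
    moreover have "?n - 1 < ?n" using xs(2) by simp
    ultimately show ?thesis unfolding cycle_on_def by auto
  qed
  have path: "\<exists>l<L - 1. cedge v l = {xs ! i, xs ! Suc i}" if "Suc i < length xs" for i
    using step[of i] that by (auto simp: xs_def cedge_def)
  have in_cycle: "{xs ! i, xs ! Suc i} \<in> edges (cycle_on xs)" if "Suc i < length xs" for i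
    using that by (auto simp: cycle_on_def intro!: exI[of _ i])
  have off: "v j \<in> set xs \<or> (\<exists>a b. a < j \<and> j < b \<and> b < L \<and> v a = v b \<and>
       (\<forall>x\<in>set xs. x \<noteq> v a \<longrightarrow> (\<exists>m<L. (m < a \<or> b < m) \<and> x = v m)))" if "j < L" for j
  proof (rule disj_imp[THEN iffD2], rule impI)
    assume j: "v j \<notin> set xs"
    have "j \<in> {0..L - 1}" using \<open>j < L\<close> by auto
    from cover[OF this] obtain i l where il: "i < length ks" "ks ! i \<le> j" "j \<le> l" "l \<le> L - 1" "v l = v (ks ! i)"
       "if Suc i < length ks then ks ! Suc i = Suc l else l = L - 1" by blast
    have "v (ks ! i) \<in> set xs" using il(1) by (simp add: xs_def)
    then have "ks ! i \<noteq> j" "l \<noteq> j" using j il(5) by auto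
    moreover have "\<exists>m<L. (m < ks ! i \<or> l < m) \<and> x = v m" if x: "x \<in> set xs" "x \<noteq> v (ks ! i)" for x
    proof -
      obtain m where m: "m \<in> set ks" "x = v m" using x(1) by (auto simp: xs_def)
      then have "m \<noteq> ks ! i" using x(2) by auto
      then show ?thesis using outside[OF m(1) il(1,6)] ks_L m by (metis nat_less_le)
    qed
    ultimately show "\<exists>a b. a < j \<and> j < b \<and> b < L \<and> v a = v b \<and>
       (\<forall>x\<in>set xs. x \<noteq> v a \<longrightarrow> (\<exists>m<L. (m < a \<or> b < m) \<and> x = v m))"
      using il L_pos by (intro exI[of _ "ks ! i"] exI[of _ l]) auto
  qed
  have chordless: "cedge v i \<in> edges (cycle_on xs)" if "i < L" "cedge v i \<subseteq> set xs" for i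
  proof (cases "i = L - 1")
    case False
    have "i \<in> {0..L - 1}" using \<open>i < L\<close> by auto
    from cover[OF this] obtain n l where il: "n < length ks" "ks ! n \<le> i" "i \<le> l" "l \<le> L - 1" "v l = v (ks ! n)"
       "if Suc n < length ks then ks ! Suc n = Suc l else l = L - 1" by blast
    show ?thesis
    proof (cases "i = l")
      case True
      then have n: "Suc n < length ks" "ks ! Suc n = Suc l" using il(6) False by (auto split: if_splits)
      then have "cedge v i = {xs ! n, xs ! Suc n}" using il(5) True by (simp add: cedge_def xs_def)
      then show ?thesis using in_cycle[of n] n(1) by (simp add: xs_def)
    next
      \<comment> \<open>The edge lies inside an erased loop. Some inner position \<open>j\<close> of
        the loop then carries a cycle vertex, which also occurs at a position outside the loop,
        against \<open>sides_disjoint\<close>.\<close>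
      case ne: False
      have "\<exists>j. ks ! n < j \<and> j < l \<and> v j \<in> set xs"
      proof (cases "ks ! n = i")
        case True
        then have "Suc i \<noteq> l" using il(5) neq_Suc[of i] by auto
        then show ?thesis using that(2) ne il(2,3) True by (intro exI[of _ "Suc i"]) (auto simp: cedge_def)
      next
        case False
        then show ?thesis using that(2) ne il(2,3) by (intro exI[of _ i]) (auto simp: cedge_def)
      qed
      then obtain j where j: "ks ! n < j" "j < l" "v j \<in> set xs" by blast
      then obtain m where m: "m \<in> set ks" "v j = v m" by (auto simp: xs_def)
      have "v m \<noteq> v l"
      proof
        assume "v m = v l"
        then have "ks ! n mod L = l mod L \<or> j mod L = l mod L"
          using two_occurrences[of "ks ! n" j l] il(5) m(2) j il(4)
          by (metis mod_less less_imp_diff_less order_less_le_trans L_pos diff_less less_one less_trans nat_neq_iff)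
        then show False using j il(4) L_pos by auto
      qed
      then have "m < ks ! n \<or> l < m"
        using outside[OF m(1) il(1,6)] il(5) by (metis nat_less_le)
      then show ?thesis
      proof
        assume "l < m"
        then show ?thesis using sides_disjoint[of "ks ! n" j l m] j il(5) m ks_L by fastforce
      next
        assume "m < ks ! n"
        \<comment> \<open>A position before the loop is read as one after it, in the next
          period.\<close>
        moreover have "l < m + L" using il(4) L_pos by linarith
        ultimately show ?thesis using sides_disjoint[of "ks ! n" j l "m + L"] j il m periodic L_pos by auto
      qed
    qed
  qed (use closing in simp)
  have chordless': "cedge v i \<in> edges (cycle_on xs)" if "cedge v i \<subseteq> set xs" for i
    using chordless[of "i mod L"] that L_pos by (simp add: cedge_mod)
  show ?thesis
    using that[of xs] xs off chordless' path closing by (auto simp: xs_def)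
qed

end

section \<open>Double vertices, sinks and cyclic blocks\<close>

definition csink :: "(nat \<Rightarrow> 'a) \<Rightarrow> nat \<Rightarrow> 'a ugraph \<Rightarrow> 'a \<Rightarrow> bool" where
  "csink v L B x \<longleftrightarrow> (\<exists>i j. i mod L \<noteq> j mod L \<and> even i = even j \<and>
     cedge v i \<in> edges B \<and> cedge v j \<in> edges B \<and> x \<in> cedge v i \<and> x \<in> cedge v j)"

context prim_cycle
begin

lemma mod_add_neq: "i mod L \<noteq> j mod L \<Longrightarrow> (i + k) mod L \<noteq> (j + k) mod L"
  by (simp add: nat_mod_eq_iff)

lemma csink_shift: "csink (\<lambda>i. v (i + k)) L B x \<Longrightarrow> csink v L B x"
proof -
  assume "csink (\<lambda>i. v (i + k)) L B x"
  then obtain i j where ij: "i mod L \<noteq> j mod L" "even i = even j"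
    "cedge v (i + k) \<in> edges B" "cedge v (j + k) \<in> edges B" "x \<in> cedge v (i + k)" "x \<in> cedge v (j + k)"
    unfolding csink_def cedge_shift by blast
  then have "even (i + k) = even (j + k)" by simp
  then show ?thesis using ij mod_add_neq unfolding csink_def by blast
qed

lemma double_other:
  assumes "double v L (v 0)"
  obtains q where "1 < q" "q < L - 1" "v q = v 0" "odd q"
proof -
  obtain i j where ij: "i mod L \<noteq> j mod L" "v i = v 0" "v j = v 0"
    using assms by (auto simp: double_def)
  define q where "q = (if i mod L = 0 then j mod L else i mod L)"
  have q: "0 < q" "q < L" "v q = v 0" using ij L_pos by (auto simp: q_def v_mod)
  have "q \<noteq> 1" using q(3) neq_Suc[of 0] by auto
  moreover have "q \<noteq> L - 1" using q(3) neq_Suc[of "L - 1"] periodic[of 0] L_pos by auto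
  moreover have "odd q" using parity_if_v_eq[of q 0] q by auto
  ultimately show ?thesis using that[of q] q by linarith
qed

text \<open>Edges at \<open>v 0\<close> sit at positions \<open>0\<close>, \<open>q - 1\<close> on
  one side, both even, and \<open>q\<close>, \<open>L - 1\<close> on the other, both odd. A
  nonseparable graph has edges at \<open>v 0\<close> on one side only, so two of them have equal
  parity.\<close>

lemma csink_if_double0:
  assumes H: "subgraph H (cgraph v)" "nonseparable H" and double: "double v L (v 0)"
    and g: "g \<in> edges H" "g' \<in> edges H" "g \<noteq> g'" "v 0 \<in> g" "v 0 \<in> g'"
  shows "csink v L H (v 0)"
proof -
  obtain q where q: "1 < q" "q < L - 1" "v q = v 0" "odd q" using double by (rule double_other)
  have verts: "v i \<in> verts H \<and> v (Suc i) \<in> verts H" if "cedge v i \<in> edges H" for i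
    using H(1) that by (auto simp: subgraph_def cedge_def)
  have incident: "i \<in> {0, q - 1} \<or> i \<in> {q, L - 1}" if i: "i < L" "v 0 \<in> cedge v i" for i
  proof -
    have *: "j = 0 \<or> j = q" if "j < L" "v j = v 0" for j
      using two_occurrences[of 0 q j] that q by auto
    have "v i = v 0 \<or> v (Suc i) = v 0" using i(2) by (auto simp: cedge_def)
    then show ?thesis using *[of i] *[of "Suc i"] i(1) by (cases "Suc i = L") auto
  qed
  have no: False if "i \<in> {0, q - 1}" "j \<in> {q, L - 1}" "cedge v i \<in> edges H" "cedge v j \<in> edges H" for i j
  proof -
    define r where "r = (if i = 0 then 1 else q - 1)"
    define s where "s = (if j = q then Suc q else L - 1)"
    have "v r \<in> verts H" "v s \<in> verts H" "0 < r" "r < q" "q < s" "s < L"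
      using verts[OF that(3)] verts[OF that(4)] that(1,2) q L_pos by (auto simp: r_def s_def)
    then show False using nonseparable_split0[OF H] q(3) by metis
  qed
  have "g \<in> range (cedge v)" "g' \<in> range (cedge v)"
    using H(1) g by (auto simp: subgraph_def cgraph_def)
  then obtain i j where ij: "i < L" "g = cedge v i" "j < L" "g' = cedge v j"
    using range_cedge by auto
  have "i \<in> {0, q - 1} \<longleftrightarrow> j \<in> {0, q - 1}"
    using incident[of i] incident[of j] no[of i j] no[of j i] ij g by blast
  moreover have "even n" if "n \<in> {0, q - 1}" for n using that q(4) by auto
  moreover have "odd n" if "n \<in> {q, L - 1}" for n using that q(4) even_L L_pos by auto
  moreover have "i \<in> {0, q - 1} \<or> i \<in> {q, L - 1}" "j \<in> {0, q - 1} \<or> j \<in> {q, L - 1}"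
    using incident[of i] incident[of j] ij g by blast+
  ultimately have "even i = even j" by metis
  moreover have "i mod L \<noteq> j mod L" using ij g(3) by auto
  ultimately show ?thesis using ij g unfolding csink_def by blast
qed

lemma csink_if_double:
  assumes "subgraph H (cgraph v)" "nonseparable H" "double v L x"
    and "g \<in> edges H" "g' \<in> edges H" "g \<noteq> g'" "x \<in> g" "x \<in> g'"
  shows "csink v L H x"
proof -
  obtain k where k: "x = v k" using assms(3) by (auto simp: double_def)
  interpret s: prim_cycle "\<lambda>i. v (i + k)" L by (rule shift)
  show ?thesis using s.csink_if_double0[of H g g'] assms
    by (intro csink_shift) (simp add: k cgraph_shift double_shift)
qed

text \<open>A vertex of \<open>H\<close> off the cycle lies inside an erased loop, and the base
  \<open>v a\<close> of the loop separates it from every other cycle vertex of \<open>H\<close>.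
  Such a vertex exists if \<open>H\<close> shares two vertices with the cycle, or one that is not
  \<open>double\<close>, since \<open>v a\<close> is.\<close>

lemma obtain_cyclic_block:
  obtains xs where "distinct xs" "xs \<noteq> []" "hd xs = v 0" "last xs = v (L - 1)"
    "\<And>j. j < L \<Longrightarrow> v j \<in> set xs \<or> (\<exists>a b. a < j \<and> j < b \<and> b < L \<and> v a = v b)"
    "\<And>i. Suc i < length xs \<Longrightarrow> \<exists>l<L - 1. cedge v l = {xs ! i, xs ! Suc i}"
    "cedge v (L - 1) \<in> edges (cycle_on xs)"
    "\<And>H x. subgraph H (cgraph v) \<Longrightarrow> nonseparable H \<Longrightarrow> x \<in> verts H \<Longrightarrow> x \<in> set xs \<Longrightarrow>
       \<not> double v L x \<Longrightarrow> subgraph H (cycle_on xs)"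
    "3 \<le> length xs \<Longrightarrow> cyclic_block (cgraph v) (cycle_on xs)"
proof -
  obtain xs where xs: "distinct xs" "xs \<noteq> []" "hd xs = v 0" "last xs = v (L - 1)" "set xs \<subseteq> range v"
    and off: "\<And>j. j < L \<Longrightarrow> v j \<in> set xs \<or> (\<exists>a b. a < j \<and> j < b \<and> b < L \<and> v a = v b \<and>
       (\<forall>x\<in>set xs. x \<noteq> v a \<longrightarrow> (\<exists>m<L. (m < a \<or> b < m) \<and> x = v m)))"
    and chordless: "\<And>i. cedge v i \<subseteq> set xs \<Longrightarrow> cedge v i \<in> edges (cycle_on xs)"
    and path: "\<And>i. Suc i < length xs \<Longrightarrow> \<exists>l<L - 1. cedge v l = {xs ! i, xs ! Suc i}"
    and closing: "cedge v (L - 1) \<in> edges (cycle_on xs)"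
    by (rule obtain_cycle) (rule that; assumption)
  have inside: "subgraph H (cycle_on xs)"
    if H: "subgraph H (cgraph v)" "nonseparable H" and xy: "x \<in> verts H" "x \<in> set xs" "y \<in> verts H" "y \<in> set xs"
      and ne: "x \<noteq> y \<or> \<not> double v L x" for H x y
  proof -
    have vH: "verts H \<subseteq> set xs"
    proof
      fix z assume z: "z \<in> verts H"
      then have "z \<in> range v" using H(1) by (auto simp: subgraph_def cgraph_def)
      then obtain j where j: "j < L" "z = v j" using range_v by auto
      show "z \<in> set xs"
      proof (rule ccontr)
        assume "z \<notin> set xs"
        with off[OF j(1)] j(2) obtain a b where ab: "a < j" "j < b" "b < L" "v a = v b"
          and sep: "\<And>x. x \<in> set xs \<Longrightarrow> x \<noteq> v a \<Longrightarrow> \<exists>m<L. (m < a \<or> b < m) \<and> x = v m" by blast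
        have "a mod L \<noteq> b mod L" using ab by auto
        then have "double v L (v a)" using ab(4) unfolding double_def by metis
        then obtain u where u: "u \<in> {x, y}" "u \<noteq> v a" using ne by auto
        then obtain m where m: "m < L" "m < a \<or> b < m" "u = v m" using sep[of u] xy by auto
        have "v m \<in> verts H" "v j \<in> verts H" using u m(3) xy z j(2) by auto
        from m(2) show False
        proof
          assume "b < m"
          then show False
            using nonseparable_split[OF H, of a j b m] ab m(1) \<open>v m \<in> verts H\<close> \<open>v j \<in> verts H\<close> by simp
        next
          assume "m < a"
          then show False
            using nonseparable_split[OF H, of a j b "m + L"] ab m(1) \<open>v m \<in> verts H\<close> \<open>v j \<in> verts H\<close>
            by (simp add: periodic)
        qed
      qed
    qed
    have "edges H \<subseteq> edges (cycle_on xs)"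
    proof
      fix e assume e: "e \<in> edges H"
      then obtain i where "e = cedge v i" using H(1) by (auto simp: subgraph_def cgraph_def)
      moreover have "e \<subseteq> verts H" using H(1) e by (auto simp: subgraph_def)
      ultimately show "e \<in> edges (cycle_on xs)" using chordless[of i] vH by auto
    qed
    then show ?thesis using vH H(1) by (auto simp: subgraph_def cycle_on_def)
  qed
  have "cyclic_block (cgraph v) (cycle_on xs)" if len: "3 \<le> length xs"
  proof -
    have "{xs ! i, xs ! (Suc i mod length xs)} \<in> range (cedge v)" if "i < length xs" for i
    proof (cases "Suc i = length xs")
      case True
      then have "xs ! i = last xs" "xs ! (Suc i mod length xs) = hd xs"
        using xs(2) by (auto simp: last_conv_nth hd_conv_nth simp flip: True)
      then show ?thesis using xs(3,4) cedge_last by auto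
    next
      case False
      then show ?thesis using path[of i] that by auto
    qed
    moreover have "e \<subseteq> set xs" if "e \<in> edges (cycle_on xs)" for e
      using that xs(2) by (auto simp: cycle_on_def)
    ultimately have sub: "subgraph (cycle_on xs) (cgraph v)"
      using xs(5) by (auto simp: subgraph_def cgraph_def cycle_on_def)
    have "block (cgraph v) (cycle_on xs)"
      unfolding block_def
    proof (intro conjI allI impI sub nonseparable_cycle_on xs(1,2))
      fix H assume H: "subgraph H (cgraph v) \<and> nonseparable H \<and> subgraph (cycle_on xs) H"
      have "0 < length xs" "1 < length xs" using len by auto
      then have "xs ! 0 \<in> set xs" "xs ! 1 \<in> set xs" "xs ! 0 \<noteq> xs ! 1"
        using nth_eq_iff_index_eq[OF xs(1), of 0 1] by auto
      moreover have "set xs \<subseteq> verts H" using H by (auto simp: subgraph_def cycle_on_def)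
      ultimately have "subgraph H (cycle_on xs)" using inside[of H "xs ! 0" "xs ! 1"] H by blast
      then show "H = cycle_on xs" using H subgraph_antisym by blast
    qed
    then show ?thesis using cycle_graph_cycle_on[OF xs(1) len] by (simp add: cyclic_block_def)
  qed
  moreover have "v j \<in> set xs \<or> (\<exists>a b. a < j \<and> j < b \<and> b < L \<and> v a = v b)" if "j < L" for j
    using off[OF that] by blast
  moreover have "subgraph H (cycle_on xs)" if "subgraph H (cgraph v)" "nonseparable H" "x \<in> verts H"
    "x \<in> set xs" "\<not> double v L x" for H x
    using inside[of H x x] that by blast
  ultimately show ?thesis by (intro that[of xs] xs(1-4) path closing)
qed

text \<open>On a cycle of length at least 3, each end of the closing edge has a second cycle edge,
  so \<open>csink_if_double\<close> makes both ends adjacent sinks of a cyclic block. Hence the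
  erased path is a single edge, and its position repeats the closing edge.\<close>

lemma double_edge_last:
  assumes sinks: "\<And>B x y. cyclic_block (cgraph v) B \<Longrightarrow> csink v L B x \<Longrightarrow> csink v L B y \<Longrightarrow> {x, y} \<notin> edges B"
    and double: "double v L (v (L - 1))" "double v L (v 0)"
  shows "\<exists>j<L - 1. cedge v j = cedge v (L - 1)"
proof -
  obtain xs where xs: "distinct xs" "xs \<noteq> []" "hd xs = v 0" "last xs = v (L - 1)"
    and path: "\<And>i. Suc i < length xs \<Longrightarrow> \<exists>l<L - 1. cedge v l = {xs ! i, xs ! Suc i}"
    and closing: "cedge v (L - 1) \<in> edges (cycle_on xs)"
    and blk: "3 \<le> length xs \<Longrightarrow> cyclic_block (cgraph v) (cycle_on xs)"
    by (rule obtain_cyclic_block) (rule that; assumption)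
  let ?n = "length xs" and ?B = "cycle_on xs"
  have ends: "xs ! 0 = v 0" "xs ! (?n - 1) = v (L - 1)"
    using xs by (simp_all add: hd_conv_nth last_conv_nth)
  have "v (L - 1) \<noteq> v 0" using neq_Suc[of "L - 1"] periodic[of 0] L_pos by auto
  then have "?n \<noteq> 1" using ends by auto
  moreover have "?n \<noteq> 0" using xs(2) by simp
  ultimately consider "?n = 2" | "3 \<le> ?n" by linarith
  then show ?thesis
  proof cases
    case 1
    then show ?thesis using path[of 0] ends cedge_last by (auto simp: insert_commute)
  next
    case 2
    from blk[OF 2] have B: "subgraph ?B (cgraph v)" "nonseparable ?B"
      by (auto simp: cyclic_block_def block_def)
    have "{xs ! i, xs ! Suc i} \<in> edges ?B" if "Suc i < ?n" for i
      using that by (auto simp: cycle_on_def intro!: exI[of _ i])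
    from this[of 0] this[of "?n - 2"] 2
    have e0: "{xs ! 0, xs ! 1} \<in> edges ?B" "{xs ! (?n - 2), xs ! (?n - 1)} \<in> edges ?B"
      by (simp_all add: Suc_diff_Suc numeral_2_eq_2)
    have last: "cedge v (L - 1) = {xs ! (?n - 1), xs ! 0}" using cedge_last ends by simp
    have "xs ! 1 \<noteq> xs ! (?n - 1)" "xs ! (?n - 2) \<noteq> xs ! 0" "xs ! 0 \<noteq> xs ! (?n - 1)"
      using 2 nth_eq_iff_index_eq[OF xs(1), of 1 "?n - 1"] nth_eq_iff_index_eq[OF xs(1), of "?n - 2" 0]
        nth_eq_iff_index_eq[OF xs(1), of 0 "?n - 1"] by linarith+
    then have ne: "{xs ! 0, xs ! 1} \<noteq> cedge v (L - 1)" "{xs ! (?n - 2), xs ! (?n - 1)} \<noteq> cedge v (L - 1)"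
      unfolding last by (auto simp: doubleton_eq_iff)
    have "csink v L ?B (v 0)"
      using csink_if_double[OF B double(2) e0(1) closing ne(1)] ends unfolding last by simp
    moreover have "csink v L ?B (v (L - 1))"
      using csink_if_double[OF B double(1) e0(2) closing ne(2)] ends unfolding last by simp
    moreover have "{v (L - 1), v 0} \<in> edges ?B" using closing unfolding cedge_last .
    ultimately show ?thesis using sinks[OF blk[OF 2]] by blast
  qed
qed

lemma double_edge:
  assumes sinks: "\<And>B x y. cyclic_block (cgraph v) B \<Longrightarrow> csink v L B x \<Longrightarrow> csink v L B y \<Longrightarrow> {x, y} \<notin> edges B"
    and double: "double v L (v i)" "double v L (v (Suc i))"
  shows "\<exists>j. j mod L \<noteq> i mod L \<and> cedge v j = cedge v i"
proof -
  interpret s: prim_cycle "\<lambda>j. v (j + Suc i)" L by (rule shift)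
  have i: "L - 1 + Suc i = i + L" using L_pos by simp
  have "\<exists>j<L - 1. cedge (\<lambda>j. v (j + Suc i)) j = cedge (\<lambda>j. v (j + Suc i)) (L - 1)"
  proof (rule s.double_edge_last)
    fix B x y
    assume "cyclic_block (cgraph (\<lambda>j. v (j + Suc i))) B"
      "csink (\<lambda>j. v (j + Suc i)) L B x" "csink (\<lambda>j. v (j + Suc i)) L B y"
    then show "{x, y} \<notin> edges B"
      using sinks csink_shift[of "Suc i"] cgraph_shift[of "Suc i"] by metis
  next
    show "double (\<lambda>j. v (j + Suc i)) L (v (L - 1 + Suc i))"
      using double(1) double_shift[of "Suc i"] periodic by (simp only: i)
    show "double (\<lambda>j. v (j + Suc i)) L (v (0 + Suc i))"
      using double(2) double_shift[of "Suc i"] by simp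
  qed
  then obtain j where j: "j < L - 1" "cedge v (j + Suc i) = cedge v (L - 1 + Suc i)"
    unfolding cedge_shift by blast
  have "(j + Suc i) mod L \<noteq> (L - 1 + Suc i) mod L"
    using j(1) by (intro mod_add_neq) simp
  then show ?thesis using j(2) cedge_cong[of "i + L" i] unfolding i by (metis mod_add_self2)
qed

section \<open>Separation by a double vertex and blocks\<close>

lemma separated_sym: "separated v L x y \<Longrightarrow> separated v L y x"
proof -
  assume "separated v L x y"
  then obtain p r q s where "p < r" "r < q" "q < s" "s < p + L" "v p = v q" "v r = x" "v s = y"
    unfolding separated_def by blast
  then show ?thesis unfolding separated_def
    by (intro exI[of _ q] exI[of _ s] exI[of _ "p + L"] exI[of _ "r + L"]) (auto simp: periodic)
qed

lemma finite_cgraph: "finite (verts (cgraph v))" "finite (edges (cgraph v))"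
  using range_v range_cedge by (simp_all add: cgraph_def)

text \<open>Both vertices lie on the cycle through \<open>x\<close>: off the cycle, \<open>y\<close>
  would be separated from \<open>x\<close> by the base of a loop. As neither is
  \<open>double\<close>, each belongs to no block other than this cycle.\<close>

lemma blocks_eq:
  assumes xy: "x \<in> range v" "y \<in> range v" "x \<noteq> y" "{x, y} \<notin> range (cedge v)"
    and single: "\<not> double v L x" "\<not> double v L y" and sep: "\<not> separated v L x y"
    and B: "block (cgraph v) B1" "block (cgraph v) B2" "x \<in> verts B1" "y \<in> verts B2"
  shows "B1 = B2"
proof -
  obtain k where k: "x = v k" using xy(1) by blast
  let ?v = "\<lambda>i. v (i + k)"
  interpret s: prim_cycle ?v L by (rule shift)
  obtain xs where xs: "distinct xs" "xs \<noteq> []" "hd xs = ?v 0" "last xs = ?v (L - 1)"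
    and off: "\<And>j. j < L \<Longrightarrow> ?v j \<in> set xs \<or> (\<exists>a b. a < j \<and> j < b \<and> b < L \<and> ?v a = ?v b)"
    and sub: "\<And>H x. subgraph H (cgraph ?v) \<Longrightarrow> nonseparable H \<Longrightarrow> x \<in> verts H \<Longrightarrow> x \<in> set xs \<Longrightarrow>
       \<not> double ?v L x \<Longrightarrow> subgraph H (cycle_on xs)"
    and blk: "3 \<le> length xs \<Longrightarrow> cyclic_block (cgraph ?v) (cycle_on xs)"
    by (rule s.obtain_cyclic_block) (rule that; assumption)
  have "y \<in> range ?v" using xy(2) range_shift[of v k, OF v_cong] by simp
  then obtain j where j: "j < L" "y = ?v j" using s.range_v by auto
  have y: "y \<in> set xs"
  proof (rule ccontr)
    assume "y \<notin> set xs"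
    then obtain a b where ab: "a < j" "j < b" "b < L" "?v a = ?v b" using off[OF j(1)] j(2) by auto
    have "a \<noteq> 0"
    proof
      assume "a = 0"
      then have "v (0 + k) = x" "v (b + k) = x" "(0 + k) mod L \<noteq> (b + k) mod L"
        using ab k mod_add_neq[of 0 b k] by auto
      then show False using single(1) unfolding double_def by blast
    qed
    then have "separated ?v L y x" unfolding separated_def
      using ab j s.periodic[of 0] k
      by (intro exI[of _ a] exI[of _ j] exI[of _ b] exI[of _ L]) auto
    then show False using sep separated_shift separated_sym by blast
  qed
  have x: "x \<in> set xs" using xs(2,3) k by (metis add_0 hd_in_set)
  have last: "cedge v (L - 1 + k) = {?v (L - 1), x}"
    using s.cedge_last by (simp add: cedge_shift k)
  then have ne: "?v (L - 1) \<noteq> x" "?v (L - 1) \<noteq> y"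
    using card_cedge[of "L - 1 + k"] xy(4) by (auto simp: insert_commute)
  \<comment> \<open>\<open>last xs\<close> is joined to \<open>x\<close> by a walk edge while
    \<open>y\<close> is not, so it is a third vertex.\<close>
  have "card {x, y, last xs} = 3" using ne xy(3) by (auto simp: xs(4))
  moreover have "{x, y, last xs} \<subseteq> set xs" using x y xs(2) by auto
  ultimately have "3 \<le> length xs" by (metis card_length card_mono finite_set order_trans)
  from blk[OF this] have C: "subgraph (cycle_on xs) (cgraph v)" "nonseparable (cycle_on xs)"
    by (auto simp: cyclic_block_def block_def cgraph_shift)
  have "B1 = cycle_on xs"
    using B(1,3) C sub[of B1 x] x single(1) unfolding block_def cgraph_shift double_shift by metis
  moreover have "B2 = cycle_on xs"
    using B(2,4) C sub[of B2 y] y single(2) unfolding block_def cgraph_shift double_shift by metis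
  ultimately show ?thesis by simp
qed

lemma obtain_block_vertex:
  assumes "x \<in> range v"
  obtains B where "block (cgraph v) B" "x \<in> verts B"
proof -
  have "subgraph ({x}, {}) (cgraph v)" using assms by (simp add: subgraph_def cgraph_def)
  from obtain_block[OF this nonseparable_vertex finite_cgraph] obtain B where
    "block (cgraph v) B" "subgraph ({x}, {}) B" .
  then show ?thesis using that by (simp add: subgraph_def)
qed

lemma obtain_block_edge:
  obtains B where "block (cgraph v) B" "v i \<in> verts B" "v (Suc i) \<in> verts B"
proof -
  have "subgraph ({v i, v (Suc i)}, {{v i, v (Suc i)}}) (cgraph v)"
    by (auto simp: subgraph_def cgraph_def cedge_def)
  from obtain_block[OF this nonseparable_edge finite_cgraph] obtain B where
    "block (cgraph v) B" "subgraph ({v i, v (Suc i)}, {{v i, v (Suc i)}}) B" .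
  then show ?thesis using that by (simp add: subgraph_def)
qed

lemma not_separated_if_blocks_eq:
  assumes "x \<in> range v" "y \<in> range v"
    and eq: "\<And>B1 B2. block (cgraph v) B1 \<Longrightarrow> block (cgraph v) B2 \<Longrightarrow> x \<in> verts B1 \<Longrightarrow> y \<in> verts B2 \<Longrightarrow> B1 = B2"
  shows "\<not> separated v L x y"
proof
  assume "separated v L x y"
  then obtain p r q s where pos: "p < r" "r < q" "q < s" "s < p + L" "v p = v q" "v r = x" "v s = y"
    unfolding separated_def by blast
  obtain B where B: "block (cgraph v) B" "x \<in> verts B" using assms(1) by (rule obtain_block_vertex)
  obtain B' where B': "block (cgraph v) B'" "y \<in> verts B'" using assms(2) by (rule obtain_block_vertex)
  have "B = B'" using eq B B' by blast
  then show False using nonseparable_split[of B p r q s] B B' pos by (simp add: block_def)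
qed

text \<open>At a double vertex the first and the last edge of the rotated walk lie on different
  sides, hence in different blocks. Both blocks contain \<open>x\<close>, so they cannot both equal
  a block of \<open>y\<close>.\<close>

lemma single_if_blocks_eq:
  assumes "x \<in> range v" "y \<in> range v"
    and eq: "\<And>B1 B2. block (cgraph v) B1 \<Longrightarrow> block (cgraph v) B2 \<Longrightarrow> x \<in> verts B1 \<Longrightarrow> y \<in> verts B2 \<Longrightarrow> B1 = B2"
  shows "\<not> double v L x"
proof
  assume double: "double v L x"
  obtain k where k: "x = v k" using assms(1) by blast
  let ?v = "\<lambda>i. v (i + k)"
  interpret s: prim_cycle ?v L by (rule shift)
  obtain q where q: "1 < q" "q < L - 1" "?v q = ?v 0"
    using double s.double_other by (auto simp: double_shift k)
  obtain B1 where B1: "block (cgraph v) B1" "?v 0 \<in> verts B1" "?v (Suc 0) \<in> verts B1"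
    using s.obtain_block_edge[of 0] by (auto simp: cgraph_shift)
  obtain B2 where B2: "block (cgraph v) B2" "?v (L - 1) \<in> verts B2" "?v (Suc (L - 1)) \<in> verts B2"
    using s.obtain_block_edge[of "L - 1"] unfolding cgraph_shift by blast
  have x: "x \<in> verts B1" "x \<in> verts B2"
    using B1 B2 periodic[of k] L_pos by (simp_all add: k add.commute)
  obtain B3 where B3: "block (cgraph v) B3" "y \<in> verts B3" using assms(2) by (rule obtain_block_vertex)
  have "B1 = B2" using eq[OF B1(1) B3(1) x(1) B3(2)] eq[OF B2(1) B3(1) x(2) B3(2)] by simp
  then show False using s.nonseparable_split0[of B1 1 q "L - 1"] B1 B2 q
    by (simp add: cgraph_shift block_def)
qed

end

subsection \<open>Even closed walks\<close>

lemma walk_length_conv: "walk_length w = length w - 1"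
  by (induction w rule: walk_edges.induct) (auto simp: walk_length_def)

lemma walk_edges_nth: "i < walk_length w \<Longrightarrow> walk_edges w ! i = {w ! i, w ! Suc i}"
proof (induction w arbitrary: i rule: walk_edges.induct)
  case (1 x y w)
  then show ?case by (cases i) (auto simp: walk_length_def)
qed (auto simp: walk_length_def)

lemma Eplus_Cons [simp]: "Eplus (x # y # w) = add_mset {x, y} (Eminus (y # w))"
  and Eminus_Cons [simp]: "Eminus (x # y # w) = Eplus (y # w)"
  and Eplus_single [simp]: "Eplus [x] = {#}"
  and Eminus_single [simp]: "Eminus [x] = {#}"
  by (simp_all add: Eplus_def Eminus_def nths_Cons)

lemma Eplus_Eminus: "Eplus w + Eminus w = mset (walk_edges w)"
proof (induction w rule: walk_edges.induct)
  case (1 x y w)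
  then show ?case by (simp add: add.commute)
qed (simp_all add: Eplus_def Eminus_def)

lemma walk_length_eq_size: "walk_length w = size (Eplus w) + size (Eminus w)"
  using arg_cong[OF Eplus_Eminus, of size w] by (simp add: walk_length_def)

lemma deg_Eplus_Eminus:
  assumes "w \<noteq> []" "\<And>e. e \<in> set (walk_edges w) \<Longrightarrow> card e = 2"
  shows "int (deg (Eplus w) a) - int (deg (Eminus w) a) =
    of_bool (hd w = a) - (- 1) ^ walk_length w * of_bool (last w = a)"
  using assms
proof (induction w rule: walk_edges.induct)
  case (1 x y w)
  have "x \<noteq> y" using "1.prems"(2)[of "{x, y}"] by auto
  moreover have "walk_length (x # y # w) = Suc (walk_length (y # w))" by (simp add: walk_length_def)
  moreover have "int (deg (Eplus (y # w)) a) - int (deg (Eminus (y # w)) a) =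
      of_bool (y = a) - (- 1) ^ walk_length (y # w) * of_bool (last (y # w) = a)"
    using "1.IH" "1.prems"(2) by simp
  ultimately show ?case by (auto simp: algebra_simps)
qed (simp_all add: walk_length_def)

lemma mset_nths: "mset (nths xs A) = image_mset ((!) xs) (mset_set {i. i < length xs \<and> i \<in> A})"
proof (induction xs rule: rev_induct)
  case (snoc x xs)
  have "{i. i < length (xs @ [x]) \<and> i \<in> A} =
      {i. i < length xs \<and> i \<in> A} \<union> (if length xs \<in> A then {length xs} else {})"
    by (auto simp: less_Suc_eq)
  moreover have "image_mset ((!) (xs @ [x])) (mset_set {i. i < length xs \<and> i \<in> A}) =
      image_mset ((!) xs) (mset_set {i. i < length xs \<and> i \<in> A})"
    by (rule image_mset_cong) (simp add: nth_append)
  ultimately show ?case using snoc by (simp add: nths_append)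
qed simp

section \<open>Alternating trails and even closed walks in balanced pairs\<close>

text \<open>Greedy construction: the excess of \<open>B\<close> at \<open>z\<close> provides an edge
  of \<open>B\<close>. Unless its other end is \<open>x0\<close>, that end has positive degree in
  \<open>A\<close>, which provides the next edge. Removing both restores the hypothesis with a
  smaller \<open>A\<close>.\<close>

lemma alternating_trail:
  assumes "\<And>e. e \<in># A + B \<Longrightarrow> card e = 2"
    and "\<And>x. deg A x + of_bool (x = x0) + of_bool (x = z) = deg B x"
  shows "\<exists>\<xi>. \<xi> \<noteq> [] \<and> hd \<xi> = z \<and> last \<xi> = x0 \<and> odd (walk_length \<xi>) \<and>
    Eplus \<xi> \<subseteq># B \<and> Eminus \<xi> \<subseteq># A"
  using assms
proof (induction "size A" arbitrary: A B z rule: less_induct)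
  case less
  have other: "\<exists>y. e = {x, y} \<and> x \<noteq> y" if "e \<in># A + B" "x \<in> e" for x e
    using less.prems(1)[OF that(1)] that(2) by (auto simp: card_2_iff)
  have pos: "\<exists>e. e \<in># t \<and> x \<in> e" if "deg t x \<noteq> 0" for t :: "'a set multiset" and x
    using that by (induction t) (auto split: if_splits)
  have "deg B z \<noteq> 0" using less.prems(2)[of z] by simp
  then obtain e z' where e: "e \<in># B" "e = {z, z'}" "z \<noteq> z'" using pos other by (metis union_iff)
  obtain B' where B': "B = add_mset e B'" using e(1) by (metis multi_member_split)
  show ?case
  proof (cases "z' = x0")
    case True
    then show ?thesis using e B'
      by (intro exI[of _ "[z, x0]"]) (simp add: walk_length_def)
  next
    case False
    then have "deg A z' \<noteq> 0" using less.prems(2)[of z'] e by (simp add: B')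
    then obtain f z'' where f: "f \<in># A" "f = {z', z''}" "z' \<noteq> z''" using pos other by (metis union_iff)
    obtain A' where A': "A = add_mset f A'" using f(1) by (metis multi_member_split)
    have deg: "deg A' x + of_bool (x = x0) + of_bool (x = z'') = deg B' x" for x
    proof -
      have "deg A x = of_bool (x = z') + of_bool (x = z'') + deg A' x"
        unfolding A' deg_add_mset f(2) using f(3) by auto
      moreover have "deg B x = of_bool (x = z) + of_bool (x = z') + deg B' x"
        unfolding B' deg_add_mset e(2) using e(3) by auto
      ultimately show ?thesis using less.prems(2)[of x] by linarith
    qed
    have "size A' < size A" by (simp add: A')
    moreover have "card e = 2" if "e \<in># A' + B'" for e
      using that less.prems(1)[of e] by (auto simp: A' B')
    ultimately have "\<exists>\<xi>. \<xi> \<noteq> [] \<and> hd \<xi> = z'' \<and> last \<xi> = x0 \<and> odd (walk_length \<xi>) \<and>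
        Eplus \<xi> \<subseteq># B' \<and> Eminus \<xi> \<subseteq># A'"
      using deg by (rule less.hyps)
    then obtain \<xi> where \<xi>: "\<xi> \<noteq> []" "hd \<xi> = z''" "last \<xi> = x0" "odd (walk_length \<xi>)"
      "Eplus \<xi> \<subseteq># B'" "Eminus \<xi> \<subseteq># A'" by blast
    obtain \<eta> where \<eta>: "\<xi> = z'' # \<eta>" using \<xi>(1,2) by (cases \<xi>) auto
    show ?thesis
      using \<xi> by (intro exI[of _ "z # z' # \<xi>"]) (auto simp: \<eta> A' B' e(2) f(2) walk_length_def)
  qed
qed

text \<open>The repetition of the first vertex at the end of the list is dropped: the period is the
  number of edges.\<close>

definition walk_fun :: "'a list \<Rightarrow> nat \<Rightarrow> 'a" where
  "walk_fun w i = w ! (i mod walk_length w)"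

definition pos_part :: "(nat \<Rightarrow> 'a) \<Rightarrow> nat set \<Rightarrow> 'a set multiset" where
  "pos_part v I = image_mset (cedge v) (mset_set {i \<in> I. even i})"

definition neg_part :: "(nat \<Rightarrow> 'a) \<Rightarrow> nat set \<Rightarrow> 'a set multiset" where
  "neg_part v I = image_mset (cedge v) (mset_set {i \<in> I. odd i})"

lemma deg_image_mset_set:
  assumes "finite J"
  shows "deg (image_mset f (mset_set J)) x = (\<Sum>i\<in>J. of_bool (x \<in> f i))"
  using assms by (induction J rule: finite_induct) simp_all

lemma altsum_eq_deg:
  assumes "finite I"
  shows "altsum v I x = int (deg (pos_part v I) x) - int (deg (neg_part v I) x)"
proof -
  have "altsum v I x = (\<Sum>i\<in>I. of_bool (even i \<and> x \<in> cedge v i) - of_bool (odd i \<and> x \<in> cedge v i))"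
    unfolding altsum_def by (rule sum.cong) auto
  also have "\<dots> = (\<Sum>i\<in>I. of_bool (even i \<and> x \<in> cedge v i)) - (\<Sum>i\<in>I. of_bool (odd i \<and> x \<in> cedge v i))"
    by (rule sum_subtractf)
  also have "(\<Sum>i\<in>I. of_bool (even i \<and> x \<in> cedge v i)) = int (deg (pos_part v I) x)"
    using assms by (simp add: pos_part_def deg_image_mset_set sum_of_bool_eq Int_def conj_ac
        del: of_bool_conj)
  also have "(\<Sum>i\<in>I. of_bool (odd i \<and> x \<in> cedge v i)) = int (deg (neg_part v I) x)"
    using assms by (simp add: neg_part_def deg_image_mset_set sum_of_bool_eq Int_def conj_ac
        del: of_bool_conj)
  finally show ?thesis .
qed

lemma size_parts: "finite I \<Longrightarrow> size (pos_part v I) + size (neg_part v I) = card I"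
proof -
  assume "finite I"
  moreover have "{i \<in> I. even i} \<union> {i \<in> I. odd i} = I" "{i \<in> I. even i} \<inter> {i \<in> I. odd i} = {}"
    by auto
  ultimately show ?thesis
    using card_Un_disjoint[of "{i \<in> I. even i}" "{i \<in> I. odd i}"]
    by (auto simp: pos_part_def neg_part_def)
qed

lemma parts_mono:
  assumes "I \<subseteq> J" "finite J"
  shows "pos_part v I \<subseteq># pos_part v J" "neg_part v I \<subseteq># neg_part v J"
  using assms by (auto simp: pos_part_def neg_part_def intro!: image_mset_subseteq_mono
      subset_imp_msubset_mset_set)

lemma set_parts: "finite I \<Longrightarrow> set_mset (pos_part v I) \<subseteq> range (cedge v)"
  "finite I \<Longrightarrow> set_mset (neg_part v I) \<subseteq> range (cedge v)"
  by (auto simp: pos_part_def neg_part_def)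

locale closed_walk = fin_graph G for G :: "'a ugraph" +
  fixes w :: "'a list"
  assumes even_closed: "even_closed_walk G w"
begin

abbreviation "L \<equiv> walk_length w"
abbreviation "v \<equiv> walk_fun w"

lemma L_even: "even L" and L_ge_2: "2 \<le> L" and edges_w: "set (walk_edges w) \<subseteq> edges G"
  using even_closed unfolding even_closed_walk_def walk_def by auto

lemma length_w: "length w = Suc L"
  using L_ge_2 by (simp add: walk_length_conv)

lemma closing: "w ! L = w ! 0"
  using even_closed length_w by (simp add: even_closed_walk_def hd_conv_nth last_conv_nth
      flip: length_greater_0_conv)

lemma v_le: "i \<le> L \<Longrightarrow> v i = w ! i"
  using closing by (cases "i = L") (auto simp: walk_fun_def)

lemma cedge_v: "i < L \<Longrightarrow> cedge v i = walk_edges w ! i"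
  using v_le[of i] v_le[of "Suc i"] by (simp add: cedge_def walk_edges_nth)

lemma v_periodic: "v (i + L) = v i"
  by (simp add: walk_fun_def)

lemma cedge_v_mod: "cedge v (i mod L) = cedge v i"
  by (simp add: cedge_def walk_fun_def mod_Suc_eq)

lemma set_walk_edges: "set (walk_edges w) = range (cedge v)"
proof -
  have "set (walk_edges w) = cedge v ` {..<L}"
    using cedge_v by (force simp: set_conv_nth walk_length_def)
  also have "\<dots> = range (cedge v)"
    using L_ge_2 by (auto simp: image_iff intro!: bexI[of _ "_ mod L"] simp: cedge_v_mod)
  finally show ?thesis .
qed

lemma cedge_in_edges: "cedge v i \<in> edges G"
  using set_walk_edges edges_w by blast

lemma set_w: "set w = range v"
proof
  have "\<exists>j. w ! i = v j" if "i < length w" for i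
    using that v_le[of i] length_w by (intro exI[of _ i]) simp
  then show "set w \<subseteq> range v" by (auto simp: set_conv_nth)
  show "range v \<subseteq> set w" using length_w L_ge_2
    by (auto simp: walk_fun_def intro!: nth_mem) (simp add: less_Suc_eq)
qed

lemma walk_graph_eq: "walk_graph w = cgraph v"
  by (simp add: walk_graph_def cgraph_def set_w set_walk_edges)

lemma Eplus_eq: "Eplus w = pos_part v {..<L}" and Eminus_eq: "Eminus w = neg_part v {..<L}"
  unfolding Eplus_def Eminus_def mset_nths pos_part_def neg_part_def
  by (auto simp: walk_length_def[symmetric] cedge_v intro!: image_mset_cong)

lemma balanced_w: "balanced (Eplus w) (Eminus w)"
proof -
  have sub: "set_mset (Eplus w) \<subseteq> edges G" "set_mset (Eminus w) \<subseteq> edges G"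
    unfolding Eplus_eq Eminus_eq using set_parts[of "{..<L}" v] cedge_in_edges by blast+
  have "w \<noteq> []" using length_w by auto
  then have "deg (Eplus w) x = deg (Eminus w) x" for x
    using deg_Eplus_Eminus[of w x] even_closed edges_w edge_card
    by (simp add: even_closed_walk_def subset_iff)
  then show ?thesis using sub by (simp add: balanced_def fun_eq_iff)
qed

text \<open>Removing one edge from \<open>A\<close> leaves \<open>B\<close> with an excess at its
  two ends; the alternating trail between them closes up with that edge.\<close>

lemma even_closed_in_balanced:
  assumes "balanced A B" "A \<noteq> {#}"
  obtains \<xi> where "even_closed_walk G \<xi>" "Eplus \<xi> \<subseteq># A" "Eminus \<xi> \<subseteq># B"
proof -
  have card2: "card e = 2" if "e \<in># A + B" for e
    using that assms(1) edge_card by (auto simp: balanced_def)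
  obtain e A' where A': "A = add_mset e A'" using assms(2) by (metis multiset_cases)
  obtain x y where e: "e = {x, y}" "x \<noteq> y" using card2[of e] by (auto simp: A' card_2_iff)
  have "\<exists>\<xi>. \<xi> \<noteq> [] \<and> hd \<xi> = y \<and> last \<xi> = x \<and> odd (walk_length \<xi>) \<and> Eplus \<xi> \<subseteq># B \<and> Eminus \<xi> \<subseteq># A'"
  proof (rule alternating_trail)
    show "deg A' a + of_bool (a = x) + of_bool (a = y) = deg B a" for a
    proof -
      have "deg B a = deg A a" using assms(1) by (simp add: balanced_def)
      then show ?thesis using e(2) unfolding A' deg_add_mset e(1) by auto
    qed
  qed (use card2 in \<open>auto simp: A'\<close>)
  then obtain \<xi> where \<xi>: "hd \<xi> = y" "last \<xi> = x" "odd (walk_length \<xi>)" "Eplus \<xi> \<subseteq># B" "Eminus \<xi> \<subseteq># A'"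
    "\<xi> \<noteq> []" by blast
  then obtain \<eta> where \<eta>: "\<xi> = y # \<eta>" by (cases \<xi>) auto
  have E: "Eplus (x # \<xi>) \<subseteq># A" "Eminus (x # \<xi>) \<subseteq># B" using \<xi> by (simp_all add: \<eta> A' e(1))
  have "set (walk_edges (x # \<xi>)) = set_mset (Eplus (x # \<xi>) + Eminus (x # \<xi>))"
    by (simp only: Eplus_Eminus set_mset_mset)
  also have "\<dots> \<subseteq> edges G"
    using E assms(1) unfolding balanced_def by (auto dest: mset_subset_eqD)
  finally have "even_closed_walk G (x # \<xi>)"
    using \<xi> by (auto simp: even_closed_walk_def walk_def walk_length_def \<eta>)
  then show ?thesis using that E by blast
qed

text \<open>A vanishing set of positions gives a balanced pair dividing \<open>Eplus w\<close> and
  \<open>Eminus w\<close>; the even closed walk found inside that pair is no longer than the number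
  of positions.\<close>

lemma prim_cycle_if_primitive:
  assumes prim: "primitive_walk G w" and ne: "Eplus w \<noteq> Eminus w"
  shows "prim_cycle v L"
proof
  have neq: "v i \<noteq> v (Suc i)" for i
    using edge_card[OF cedge_in_edges[of i]] by (auto simp: cedge_def)
  then show "v i \<noteq> v (Suc i)" for i .
  show "2 < L"
  proof (rule ccontr)
    assume "\<not> 2 < L"
    \<comment> \<open>A closed walk of length 2 traverses one edge back and forth, so its binomial
      is zero.\<close>
    then have L: "L = 2" using L_ge_2 by simp
    have "cedge v 0 = cedge v 1" using v_periodic[of 0] by (auto simp: L cedge_def numeral_2_eq_2)
    moreover have "{i. i < 2 \<and> even i} = {0::nat}" "{i. i < 2 \<and> odd i} = {1::nat}"
      by (auto simp: less_2_cases_iff)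
    ultimately show False using ne by (simp add: Eplus_eq Eminus_eq L pos_part_def neg_part_def)
  qed
  fix I assume I: "I \<subseteq> {..<L}" and zero: "\<forall>x. altsum v I x = 0"
  show "I = {} \<or> I = {..<L}"
  proof (rule ccontr)
    assume not: "\<not> (I = {} \<or> I = {..<L})"
    have fin: "finite I" using I finite_subset by blast
    let ?A = "pos_part v I" and ?B = "neg_part v I"
    have bal: "balanced ?A ?B"
      using set_parts[OF fin, of v] cedge_in_edges zero altsum_eq_deg[OF fin, of v]
      by (auto simp: balanced_def fun_eq_iff)
    have "?A \<noteq> {#}"
    proof
      assume A: "?A = {#}"
      then have "?B = {#}" using deg_0_imp_empty[of ?B] bal by (simp add: balanced_def)
      then have "card I = 0" using size_parts[OF fin, of v] A by simp
      then show False using not fin by simp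
    qed
    from even_closed_in_balanced[OF bal this] obtain \<xi> where
      \<xi>: "even_closed_walk G \<xi>" "Eplus \<xi> \<subseteq># ?A" "Eminus \<xi> \<subseteq># ?B" .
    have le: "?A \<subseteq># Eplus w" "?B \<subseteq># Eminus w"
      unfolding Eplus_eq Eminus_eq using I parts_mono by blast+
    have "walk_length \<xi> \<le> card I"
      unfolding walk_length_eq_size[of \<xi>] size_parts[OF fin, of v, symmetric]
      using \<xi>(2,3) by (intro add_mono size_mset_mono)
    also have "card I < L" using I not psubset_card_mono[of "{..<L}" I] by auto
    finally have "walk_length \<xi> < L" .
    moreover have "Eplus \<xi> \<subseteq># Eplus w" "Eminus \<xi> \<subseteq># Eminus w"
      using \<xi>(2,3) le subset_mset.order_trans by blast+
    moreover from this have "subwalk \<xi> w"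
      unfolding subwalk_def Eplus_Eminus[symmetric] by (rule subset_mset.add_mono)
    ultimately show False using prim \<xi>(1) by (auto simp: primitive_walk_def)
  qed
qed (use L_even v_periodic in auto)

text \<open>A shorter even closed walk inside \<open>w\<close> allows its odd edges to be replaced
  in \<open>Eplus w\<close> by its even ones. Disjointness of \<open>Eplus w\<close> and
  \<open>Eminus w\<close> rules out both fiber elements as the result, since the replaced part is
  nonempty and proper.\<close>

lemma primitive_if_two_fiber:
  assumes fib: "two_fiber (Eplus w) (Eminus w)"
  shows "primitive_walk G w"
  unfolding primitive_walk_def
proof (intro conjI even_closed notI, elim exE conjE)
  let ?U = "Eplus w" and ?V = "Eminus w"
  fix \<xi> assume \<xi>: "even_closed_walk G \<xi>" "walk_length \<xi> < L" "Eplus \<xi> \<subseteq># ?U" "Eminus \<xi> \<subseteq># ?V"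
  interpret x: closed_walk G \<xi> by unfold_locales (rule \<xi>(1))
  have disj: "?U \<inter># ?V = {#}" using fib by (simp add: two_fiber_def)
  have "size (Eplus \<xi>) = size (Eminus \<xi>)" "size ?U = size ?V"
    using x.balanced_w balanced_w size_eq_if_deg_eq by (auto simp: balanced_def)
  then have size: "size (Eplus \<xi>) < size ?U" "0 < size (Eplus \<xi>)"
    using \<xi>(2) x.L_ge_2 by (auto simp: walk_length_eq_size)
  let ?t = "?U - Eplus \<xi> + Eminus \<xi>"
  have "balanced ?U ?t"
    using balanced_w x.balanced_w \<xi>(3)
    by (auto simp: balanced_def fun_eq_iff deg_diff mset_subset_eq_exists_conv add.commute dest: in_diffD)
  then consider "?t = ?U" | "?t = ?V" using fib by (auto simp: two_fiber_def)
  then show False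
  proof cases
    case 1
    then have "Eplus \<xi> = Eminus \<xi>" using \<xi>(3) by (metis add.commute add_left_imp_eq subset_mset.diff_add)
    then have "Eplus \<xi> \<subseteq># ?U \<inter># ?V" using \<xi>(3,4) by simp
    then show False using disj size(2) by auto
  next
    case 2
    then have "?U - Eplus \<xi> \<subseteq># ?V" by (metis mset_subset_eq_add_left)
    then have "?U - Eplus \<xi> \<subseteq># ?U \<inter># ?V" by simp
    then have "?U - Eplus \<xi> = {#}" using disj by auto
    then show False using size(1) by (metis size_Diff_submset \<xi>(3) size_empty zero_less_diff less_irrefl)
  qed
qed

end

subsection \<open>Elements of the fiber of a walk\<close>

lemma count_le_deg: "x \<in> e \<Longrightarrow> count t e \<le> deg t x"
  by (induction t) auto

lemma deg_pos_iff: "deg t x \<noteq> 0 \<longleftrightarrow> (\<exists>e. e \<in># t \<and> x \<in> e)"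
  by (induction t) auto

context prim_cycle
begin

lemma card_occurrences:
  assumes "x \<in> range v"
  shows "card {i. i < L \<and> v i = x} = (if double v L x then 2 else 1)"
proof (cases "double v L x")
  case True
  then obtain i j where ij: "i mod L \<noteq> j mod L" "v i = x" "v j = x" by (auto simp: double_def)
  have "{i. i < L \<and> v i = x} = {i mod L, j mod L}"
  proof (intro equalityI subsetI)
    fix k assume "k \<in> {i. i < L \<and> v i = x}"
    then show "k \<in> {i mod L, j mod L}" using two_occurrences[of i j k] ij by auto
  qed (use ij L_pos in \<open>auto simp: v_mod\<close>)
  then show ?thesis using ij True by simp
next
  case False
  obtain k where k: "k < L" "x = v k" using assms range_v by auto
  have "{i. i < L \<and> v i = x} = {k}"
  proof (intro equalityI subsetI)
    fix i assume "i \<in> {i. i < L \<and> v i = x}"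
    then have i: "i < L" "v i = x" by auto
    then have "i mod L = k mod L" using False k(2) unfolding double_def by metis
    then show "i \<in> {k}" using i k by simp
  qed (use k in auto)
  then show ?thesis using False by simp
qed

lemma unique_occurrence:
  assumes "\<not> double v L (v i)" "v j = v i" "i < L" "j < L"
  shows "j = i"
  using assms unfolding double_def by (metis mod_less)

text \<open>The edges at even positions pair up the positions \<open>i\<close>, \<open>Suc i\<close>
  of the whole cycle, so every occurrence of a vertex is counted once.\<close>

lemma deg_pos_part: "deg (pos_part v {..<L}) x = card {i. i < L \<and> v i = x}"
proof -
  define f :: "nat \<Rightarrow> nat" where "f i = of_bool (v i = x)" for i
  have pairs: "(\<Sum>i | i < 2 * n \<and> even i. f i + f (Suc i)) = (\<Sum>i<2 * n. f i)" for n
  proof (induction n)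
    case (Suc n)
    have "{i. i < 2 * Suc n \<and> even i} = insert (2 * n) {i. i < 2 * n \<and> even i}"
      by (auto simp: less_Suc_eq)
    then show ?case using Suc by simp
  qed simp
  have "deg (pos_part v {..<L}) x = (\<Sum>i | i < L \<and> even i. of_bool (x \<in> cedge v i))"
    by (simp add: pos_part_def deg_image_mset_set)
  also have "\<dots> = (\<Sum>i | i < L \<and> even i. f i + f (Suc i))"
  proof (rule sum.cong[OF refl])
    show "of_bool (x \<in> cedge v i) = f i + f (Suc i)" for i
      using neq_Suc[of i] by (auto simp: cedge_def f_def)
  qed
  also have "\<dots> = (\<Sum>i<L. f i)" using pairs[of "L div 2"] even_L by simp
  also have "\<dots> = card {i. i < L \<and> v i = x}"
    by (simp add: f_def Int_def)
  finally show ?thesis .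
qed

lemma not_in_side:
  assumes "v 0 = v q" "0 < q" "q < L"
  shows "v 0 \<notin> v ` {0<..<q}"
proof
  assume "v 0 \<in> v ` {0<..<q}"
  then obtain r where "0 < r" "r < q" "v r = v 0" by auto
  moreover from this have "0 mod L = r mod L" using assms by (intro two_occurrences[of 0 q r]) simp_all
  ultimately show False using assms(3) by simp
qed

lemma range_cedge_shift: "range (cedge (\<lambda>i. v (i + k))) = range (cedge v)"
proof -
  have "cedge (\<lambda>i. v (i + k)) = (\<lambda>i. cedge v (i + k))" by (rule ext) (rule cedge_shift)
  then show ?thesis using range_shift[of "cedge v" k, OF cedge_cong] by simp
qed

lemma beyond_side:
  assumes "v 0 = v q" "q < j" "j < L"
  shows "v j \<notin> v ` {0<..<q}"
proof
  assume "v j \<in> v ` {0<..<q}"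
  then obtain r where "0 < r" "r < q" "v r = v j" by auto
  then show False using sides_disjoint0[of r q j] assms by blast
qed

lemma cedge_side:
  assumes "v 0 = v q" "q < L" "v 0 \<notin> cedge v i" "cedge v i \<inter> v ` {0<..<q} \<noteq> {}"
  shows "cedge v i \<subseteq> v ` {0<..<q}"
proof -
  define m where "m = i mod L"
  have m: "m < L" "cedge v i = cedge v m" using L_pos by (simp_all add: m_def cedge_mod)
  have notin: "v 0 \<notin> {v m, v (Suc m)}" using assms(3) unfolding m(2) by (simp add: cedge_def)
  then have "m \<noteq> 0" by (metis insertI1)
  moreover have "m \<noteq> q" "Suc m \<noteq> q" "Suc m \<noteq> L"
    using notin assms(1) periodic[of 0] by auto
  moreover note out = beyond_side[OF assms(1)]
  have "\<not> (q < m \<and> Suc m < L)"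
    using out[of m] out[of "Suc m"] assms(4) unfolding m(2) by (auto simp: cedge_def)
  ultimately have "0 < m" "Suc m < q" using m(1) by linarith+
  then show ?thesis unfolding m(2) by (auto simp: cedge_def)
qed

end

section \<open>Reading a fiber element along the walk\<close>

text \<open>The chords of \<open>t\<close> are its edges outside \<open>range (cedge v)\<close>. The
  absence of bridges yields the two assumptions on them, and the condition on sinks yields the last
  assumption, through \<open>double_edge\<close>.\<close>

locale fiber_element = prim_cycle v L for v :: "nat \<Rightarrow> 'a" and L +
  fixes t :: "'a set multiset"
  assumes card_t: "e \<in># t \<Longrightarrow> card e = 2"
    and deg_t: "deg t x = (if double v L x then 2 else if x \<in> range v then 1 else 0)"
    and chord_single: "e \<in># t \<Longrightarrow> e \<notin> range (cedge v) \<Longrightarrow> x \<in> e \<Longrightarrow> \<not> double v L x"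
    and chord_side: "e \<in># t \<Longrightarrow> e \<notin> range (cedge v) \<Longrightarrow> x \<in> e \<Longrightarrow> y \<in> e \<Longrightarrow> \<not> separated v L x y"
    and double_twice: "double v L (v i) \<Longrightarrow> double v L (v (Suc i)) \<Longrightarrow>
      \<exists>j. j mod L \<noteq> i mod L \<and> cedge v j = cedge v i"
begin

definition chord_at :: "'a \<Rightarrow> bool" where
  "chord_at x \<longleftrightarrow> (\<exists>e. e \<in># t \<and> e \<notin> range (cedge v) \<and> x \<in> e)"

lemma shift_fiber: "fiber_element (\<lambda>i. v (i + k)) L t"
proof -
  interpret s: prim_cycle "\<lambda>i. v (i + k)" L by (rule shift)
  have range: "range (\<lambda>i. v (i + k)) = range v" "range (cedge (\<lambda>i. v (i + k))) = range (cedge v)"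
    using range_shift[of v k, OF v_cong] range_shift[of "cedge v" k, OF cedge_cong]
    by (simp_all add: cedge_shift)
  show ?thesis
  proof
    fix e x y assume e: "e \<in># t" "e \<notin> range (cedge (\<lambda>i. v (i + k)))" "x \<in> e"
    then show "\<not> double (\<lambda>i. v (i + k)) L x"
      using chord_single by (simp add: range double_shift)
    assume "y \<in> e"
    then show "\<not> separated (\<lambda>i. v (i + k)) L x y"
      using chord_side[of e x y] e separated_shift unfolding range by blast
  next
    fix i assume "double (\<lambda>i. v (i + k)) L (v (i + k))" "double (\<lambda>i. v (i + k)) L (v (Suc i + k))"
    then obtain j where j: "j mod L \<noteq> (i + k) mod L" "cedge v j = cedge v (i + k)"
      using double_twice[of "i + k"] by (auto simp: double_shift)
    obtain m where m: "(m + k) mod L = j mod L" using ex_shift by blast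
    have "m mod L \<noteq> i mod L" using j(1) m by (metis mod_add_cong)
    moreover have "cedge v (m + k) = cedge v j" using cedge_cong[OF m] .
    ultimately show "\<exists>j. j mod L \<noteq> i mod L \<and> cedge (\<lambda>i. v (i + k)) j = cedge (\<lambda>i. v (i + k)) i"
      using j(2) unfolding cedge_shift by metis
  qed (use card_t deg_t range double_shift in auto)
qed

lemma in_range: "e \<in># t \<Longrightarrow> x \<in> e \<Longrightarrow> x \<in> range v"
  using deg_pos_iff[of t x] deg_t[of x] by (auto simp: double_def split: if_splits)

lemma double_if_count: "2 \<le> count t e \<Longrightarrow> x \<in> e \<Longrightarrow> double v L x"
  using count_le_deg[of x e t] deg_t[of x] by (auto split: if_splits)

text \<open>Summing the degrees over the vertices strictly on one side of a double vertex shows that the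
  number of edges of \<open>t\<close> from that vertex into the side is even.\<close>

lemma side_parity:
  assumes q: "0 < q" "q < L" "v 0 = v q"
  shows "even (size {#e \<in># t. v 0 \<in> e \<and> e \<inter> v ` {0<..<q} \<noteq> {}#})"
proof -
  let ?S = "v ` {0<..<q}"
  have dbl: "double v L (v 0)" using q unfolding double_def by (metis mod_less mod_0 less_irrefl)
  have v0: "v 0 \<notin> ?S" using not_in_side q by blast
  have card_side: "card (?S \<inter> e) = (if e \<inter> ?S = {} then 0 else if v 0 \<in> e then 1 else 2)" if e: "e \<in># t" for e
  proof -
    obtain a b where ab: "e = {a, b}" "a \<noteq> b" using card_t[OF e] by (auto simp: card_2_iff)
    \<comment> \<open>An edge meeting the side but not \<open>v 0\<close> stays inside: walk edges
      by \<open>cedge_side\<close>, chords because they do not join separated vertices.\<close>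
    have side: "e \<subseteq> ?S" if disj: "v 0 \<notin> e" "e \<inter> ?S \<noteq> {}"
    proof (cases "e \<in> range (cedge v)")
      case True
      then show ?thesis using cedge_side[of q] disj q by auto
    next
      case False
      obtain r where r: "0 < r" "r < q" "v r \<in> e" using disj(2) by auto
      show ?thesis
      proof
        fix y assume y: "y \<in> e"
        then obtain s where s: "s < L" "y = v s" using in_range[OF e y] range_v by auto
        have "\<not> q < s"
        proof
          assume "q < s"
          then have "separated v L (v r) y" unfolding separated_def using r s q
            by (intro exI[of _ 0] exI[of _ r] exI[of _ q] exI[of _ s]) auto
          then show False using chord_side[OF e False r(3) y] by blast
        qed
        moreover have "s \<noteq> 0" "s \<noteq> q" using disj(1) y s(2) q(3) by metis+
        ultimately show "y \<in> ?S" using s by auto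
      qed
    qed
    show ?thesis
    proof (cases "e \<inter> ?S = {}")
      case True
      then show ?thesis by (simp add: Int_commute)
    next
      case ne: False
      show ?thesis
      proof (cases "v 0 \<in> e")
        case True
        then obtain y where "e = {v 0, y}" using ab by auto
        then have "?S \<inter> e = {y}" using v0 ne by auto
        then show ?thesis using True ne by simp
      next
        case False
        then have "?S \<inter> e = e" using side ne by auto
        then show ?thesis using False ne card_t[OF e] by simp
      qed
    qed
  qed
  have "even (\<Sum>x\<in>?S. deg s x) = even (size {#e \<in># s. v 0 \<in> e \<and> e \<inter> ?S \<noteq> {}#})"
    if "s \<subseteq># t" for s
    using that
  proof (induction s)
    case (add e s)
    have "(\<Sum>x\<in>?S. deg (add_mset e s) x) = card (?S \<inter> e) + (\<Sum>x\<in>?S. deg s x)"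
      by (simp add: sum.distrib)
    moreover have "e \<in># t" "s \<subseteq># t"
      using add.prems mset_subset_eq_insertD[OF add.prems] by (auto simp: subset_mset.less_le)
    ultimately show ?case using add.IH card_side[of e] by (auto split: if_splits)
  qed simp
  then have "even (\<Sum>x\<in>?S. deg t x) = even (size {#e \<in># t. v 0 \<in> e \<and> e \<inter> ?S \<noteq> {}#})" by simp
  \<comment> \<open>Each position strictly between \<open>0\<close> and \<open>q\<close> contributes
    once; as \<open>q\<close> is odd, the total is even.\<close>
  moreover have "(\<Sum>x\<in>?S. deg t x) = q - 1"
  proof -
    have "deg t x = card {i \<in> {0<..<q}. v i = x}" if x: "x \<in> ?S" for x
    proof -
      obtain r where r: "0 < r" "r < q" "x = v r" using x by auto
      have "{i. i < L \<and> v i = x} = {i \<in> {0<..<q}. v i = x}"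
      proof (intro equalityI subsetI)
        fix i assume "i \<in> {i. i < L \<and> v i = x}"
        then have i: "i < L" "v i = v r" using r by auto
        have "v i \<in> ?S" using i r by simp
        then have "i \<noteq> 0" "i \<noteq> q" using v0 q(3) by metis+
        moreover have "\<not> q < i" using sides_disjoint0[of r q i] i r q by auto
        ultimately show "i \<in> {i \<in> {0<..<q}. v i = x}" using i r by auto
      qed (use q in auto)
      then show ?thesis using card_occurrences[of x] deg_t[of x] r by auto
    qed
    then have "(\<Sum>x\<in>?S. deg t x) = (\<Sum>x\<in>?S. card {i \<in> {0<..<q}. v i = x})" by simp
    also have "\<dots> = card {0<..<q}"
      using sum.image_gen[of "{0<..<q}" "\<lambda>_. 1::nat" v] by simp
    finally show ?thesis by simp
  qed
  moreover have "odd q" using parity_if_v_eq[of 0 q] q by auto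
  ultimately show ?thesis using q by simp
qed

text \<open>A vertex visited once has a single edge in \<open>t\<close>. A double vertex has two,
  both walk edges, and by \<open>side_parity\<close> both go to the same side. Only the one of the
  positions \<open>0\<close> and \<open>L - 1\<close> on that side can then have its edge in
  \<open>t\<close>; \<open>twice\<close> shows that it does.\<close>

lemma step0:
  shows "chord_at (v 0) \<Longrightarrow> cedge v 0 \<notin># t \<and> cedge v (L - 1) \<notin># t"
    and "\<not> chord_at (v 0) \<Longrightarrow> cedge v 0 \<in># t \<longleftrightarrow> cedge v (L - 1) \<notin># t"
proof -
  let ?M = "{#e \<in># t. v 0 \<in> e#}"
  have size_M: "size ?M = deg t (v 0)" by (simp add: deg_def)
  have v0: "v 0 \<in> cedge v 0" "v 0 \<in> cedge v (L - 1)" using cedge_last by (auto simp: cedge_def)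
  have "odd (L - 1)" using even_L L_pos by simp
  then have ne: "cedge v 0 \<noteq> cedge v (L - 1)" using cedge_parity[of 0 "L - 1"] by simp
  have goal: "(chord_at (v 0) \<longrightarrow> cedge v 0 \<notin># t \<and> cedge v (L - 1) \<notin># t) \<and>
    (\<not> chord_at (v 0) \<longrightarrow> (cedge v 0 \<in># t \<longleftrightarrow> cedge v (L - 1) \<notin># t))"
  proof (cases "double v L (v 0)")
    case False
    then have "size ?M = 1" using size_M deg_t[of "v 0"] by simp
    then obtain e where e: "?M = {#e#}" using size_1_singleton_mset by blast
    have mem: "f \<in># t \<and> v 0 \<in> f \<longleftrightarrow> f = e" for f
      using arg_cong[OF e, of "\<lambda>M. f \<in># M"] by simp
    have "e = cedge v 0 \<or> e = cedge v (L - 1)" if e_range: "e \<in> range (cedge v)"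
    proof -
      obtain i where i: "i < L" "e = cedge v i" using e_range range_cedge by auto
      have "v 0 \<in> cedge v i" using mem[of e] i by simp
      then have "v i = v 0 \<or> v (Suc i) = v 0" by (auto simp: cedge_def)
      then have "i = 0 \<or> Suc i = L"
        using unique_occurrence[OF False, of i] unique_occurrence[OF False, of "Suc i"] i(1) L_pos
        by (cases "Suc i < L") auto
      then show ?thesis using i(2) by (metis diff_Suc_1)
    qed
    then show ?thesis using mem v0 ne unfolding chord_at_def by (metis rangeI)
  next
    case True
    then obtain q where q: "1 < q" "q < L - 1" "v q = v 0" "odd q" by (rule double_other)
    let ?S = "v ` {0<..<q}"
    let ?M1 = "{#e \<in># t. v 0 \<in> e \<and> e \<inter> ?S \<noteq> {}#}"
    have size2: "size ?M = 2" using size_M deg_t[of "v 0"] True by simp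
    have chord: "\<not> chord_at (v 0)" using chord_single True by (auto simp: chord_at_def)
    have incident: "i \<in> {0, q - 1, q, L - 1}" if i: "i < L" "v 0 \<in> cedge v i" for i
    proof -
      have *: "j = 0 \<or> j = q" if "j < L" "v j = v 0" for j
        using two_occurrences[of 0 q j] that q by auto
      have "v i = v 0 \<or> v (Suc i) = v 0" using i(2) by (auto simp: cedge_def)
      then show ?thesis using *[of i] *[of "Suc i"] i(1) by (cases "Suc i = L") auto
    qed
    have out: "v j \<notin> ?S" if "q \<le> j" "j \<le> L" for j
    proof -
      have "v j \<notin> ?S" if "v j = v 0"
        unfolding that using not_in_side[of q] q by simp
      then show ?thesis using beyond_side[of q j] that q periodic[of 0]
        by (cases "j = q"; cases "j = L") simp_all
    qed
    have in_S: "cedge v 0 \<inter> ?S \<noteq> {}" "cedge v (q - 1) \<inter> ?S \<noteq> {}"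
      using q(1) by (auto simp: cedge_def)
    have out_S: "cedge v q \<inter> ?S = {}" "cedge v (L - 1) \<inter> ?S = {}"
      using out[of q] out[of "Suc q"] out[of "L - 1"] out[of L] q by (auto simp: cedge_def)
    have M_cases: "e \<in> cedge v ` {0, q - 1, q, L - 1}" if "e \<in># ?M" for e
    proof -
      have e: "e \<in># t" "v 0 \<in> e" using that by auto
      then have "e \<in> range (cedge v)" using chord by (auto simp: chord_at_def)
      then obtain i where "i < L" "e = cedge v i" using range_cedge by auto
      then show ?thesis using incident[of i] e by blast
    qed
    \<comment> \<open>If the edge at \<open>j\<close> were missing, both edges of \<open>t\<close>
      at \<open>v 0\<close> would be the edge at \<open>i\<close>, whose ends would be double. The
      walk then traverses this edge at a second position of the same parity, which can only be
      \<open>j\<close>.\<close>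
    have twice: False
      if all: "\<And>e. e \<in># ?M \<Longrightarrow> e = cedge v i" and i: "i < L" and not: "cedge v j \<notin># t"
        and other: "\<And>k. k < L \<Longrightarrow> v 0 \<in> cedge v k \<Longrightarrow> even k = even i \<Longrightarrow> k = i \<or> k = j" for i j
    proof -
      have "?M = replicate_mset 2 (cedge v i)"
        using all size2 by (metis set_mset_subset_singletonD subsetI singleton_iff)
      then have cnt: "count ?M (cedge v i) = 2" by simp
      then have "v 0 \<in> cedge v i" "2 \<le> count t (cedge v i)" by (auto split: if_splits)
      then have "double v L (v i)" "double v L (v (Suc i))"
        using double_if_count[of "cedge v i"] by (auto simp: cedge_def)
      then obtain k where k: "k mod L \<noteq> i mod L" "cedge v k = cedge v i" using double_twice by blast
      have "even k = even i" using cedge_parity[of k i] k(2) by blast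
      then have "k mod L = i \<or> k mod L = j"
        using other[of "k mod L"] \<open>v 0 \<in> cedge v i\<close> k(2) L_pos by (simp add: cedge_mod even_mod)
      then have "k mod L = j" using k(1) mod_less[OF i] by metis
      then have "cedge v j = cedge v i" using k(2) cedge_mod[of k] by simp
      then show False using not \<open>2 \<le> count t (cedge v i)\<close> by (simp add: not_in_iff)
    qed
    have "even (size ?M1)" using side_parity[of q] q by simp
    moreover have sub: "?M1 \<subseteq># ?M" by (rule mset_subset_eqI) simp
    moreover have "size ?M1 \<le> 2" using size_mset_mono[OF sub] size2 by simp
    ultimately consider "size ?M1 = 0" | "size ?M1 = 2" by (auto simp: le_Suc_eq numeral_2_eq_2)
    then show ?thesis
    proof cases
      case 1
      then have empty: "e \<inter> ?S = {}" if "e \<in># t" "v 0 \<in> e" for e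
        using that by (auto simp: filter_mset_eq_conv)
      have not0: "cedge v 0 \<notin># t" using empty in_S v0 by blast
      have "cedge v (L - 1) \<in># t"
      proof (rule ccontr)
        assume not: "cedge v (L - 1) \<notin># t"
        show False
        proof (rule twice[of q "L - 1"])
          show "e = cedge v q" if "e \<in># ?M" for e
            using M_cases[OF that] that empty[of e] in_S not by auto
          show "k = q \<or> k = L - 1" if "k < L" "v 0 \<in> cedge v k" "even k = even q" for k
            using incident[OF that(1,2)] that(3) q by auto
        qed (use q not in auto)
      qed
      then show ?thesis using not0 chord by simp
    next
      case 2
      then have "?M1 = ?M" using sub size2 by (metis mset_subset_size subset_mset.less_le nat_less_le)
      then have meets: "e \<inter> ?S \<noteq> {}" if "e \<in># t" "v 0 \<in> e" for e
        using that by (metis (mono_tags, lifting) mem_Collect_eq set_mset_filter)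
      have notL: "cedge v (L - 1) \<notin># t" using meets out_S v0 by blast
      have "cedge v 0 \<in># t"
      proof (rule ccontr)
        assume not: "cedge v 0 \<notin># t"
        show False
        proof (rule twice[of "q - 1" 0])
          show "e = cedge v (q - 1)" if "e \<in># ?M" for e
            using M_cases[OF that] that meets[of e] out_S not by auto
          show "k = q - 1 \<or> k = 0" if "k < L" "v 0 \<in> cedge v k" "even k = even (q - 1)" for k
            using incident[OF that(1,2)] that(3) q \<open>odd (L - 1)\<close> by auto
        qed (use q not in auto)
      qed
      then show ?thesis using notL chord by simp
    qed
  qed
  show "chord_at (v 0) \<Longrightarrow> cedge v 0 \<notin># t \<and> cedge v (L - 1) \<notin># t"
    and "\<not> chord_at (v 0) \<Longrightarrow> cedge v 0 \<in># t \<longleftrightarrow> cedge v (L - 1) \<notin># t"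
    using goal by auto
qed

lemma step:
  shows "chord_at (v (Suc i)) \<Longrightarrow> cedge v (Suc i) \<notin># t \<and> cedge v i \<notin># t"
    and "\<not> chord_at (v (Suc i)) \<Longrightarrow> cedge v (Suc i) \<in># t \<longleftrightarrow> cedge v i \<notin># t"
proof -
  interpret s: fiber_element "\<lambda>j. v (j + Suc i)" L t by (rule shift_fiber)
  have "cedge v (L - 1 + Suc i) = cedge v i"
    using cedge_cong[of "i + L" i] L_pos by (simp add: add.commute)
  moreover have "range (cedge (\<lambda>j. v (j + Suc i))) = range (cedge v)"
    by (rule range_cedge_shift)
  then have "s.chord_at x = chord_at x" for x
    unfolding s.chord_at_def chord_at_def by simp
  ultimately show "chord_at (v (Suc i)) \<Longrightarrow> cedge v (Suc i) \<notin># t \<and> cedge v i \<notin># t"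
    and "\<not> chord_at (v (Suc i)) \<Longrightarrow> cedge v (Suc i) \<in># t \<longleftrightarrow> cedge v i \<notin># t"
    using s.step0[unfolded cedge_shift] by simp_all
qed

lemma chord_at_notin: "chord_at (v i) \<Longrightarrow> cedge v i \<notin># t"
proof -
  assume "chord_at (v i)"
  moreover have eq: "Suc (i + L - 1) = i + L" using L_pos by simp
  ultimately have "chord_at (v (Suc (i + L - 1)))" unfolding eq periodic by simp
  from step(1)[OF this] show ?thesis unfolding eq using cedge_cong[of "i + L" i] by simp
qed

text \<open>The walk edge right after a chord endpoint is missing from \<open>t\<close>. Up to the
  next endpoint missing and present edges alternate, and the last one is missing again, so their
  number is odd.\<close>

lemma odd_distance:
  assumes "chord_at (v s)" "chord_at (v s')" "s < s'"
    and between: "\<And>k. s < k \<Longrightarrow> k < s' \<Longrightarrow> \<not> chord_at (v k)"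
  shows "odd (s' - s)"
proof -
  have alt: "cedge v (s + m) \<in># t \<longleftrightarrow> odd m" if "s + m < s'" for m
    using that
  proof (induction m)
    case 0
    then show ?case using chord_at_notin[OF assms(1)] by simp
  next
    case (Suc m)
    then show ?case using step(2)[of "s + m"] between[of "s + Suc m"] by simp
  qed
  obtain m where m: "s' = Suc (s + m)" using assms(3) less_imp_Suc_add by blast
  have "cedge v (s + m) \<notin># t" using step(1)[of "s + m"] assms(2) m by simp
  then show ?thesis using alt[of m] m by simp
qed

definition chord_pos :: "nat \<Rightarrow> nat \<Rightarrow> bool" where
  "chord_pos s j \<longleftrightarrow> s < j \<and> j < L \<and> {v s, v j} \<in># t \<and> {v s, v j} \<notin> range (cedge v)"

text \<open>Starting from a chord of \<open>t\<close> with endpoints as close as possible along the walk, the next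
  chord endpoint has the other parity, so its chord is a shorter one or crosses effectively.\<close>

lemma no_chord:
  assumes par: "\<And>s j. chord_pos s j \<Longrightarrow> even s = even j"
    and cross: "\<And>s j s' j'. chord_pos s j \<Longrightarrow> chord_pos s' j' \<Longrightarrow> even s \<noteq> even s' \<Longrightarrow>
      \<not> (s < s' \<and> s' < j \<and> j < j')"
    and e: "e \<in># t"
  shows "e \<in> range (cedge v)"
proof (rule ccontr)
  assume not: "e \<notin> range (cedge v)"
  have chord_pos_of: "\<exists>i<L. i \<noteq> k \<and> (if k < i then chord_pos k i else chord_pos i k)"
    if f: "f \<in># t" "f \<notin> range (cedge v)" "v k \<in> f" "k < L" for f k
  proof -
    obtain y where y: "f = {v k, y}" "v k \<noteq> y" using card_t[OF f(1)] f(3) by (auto simp: card_2_iff)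
    then have "y \<in> range v" using in_range[OF f(1)] by simp
    then obtain i where "i < L" "y = v i" using range_v by auto
    then show ?thesis using f y by (intro exI[of _ i]) (auto simp: chord_pos_def insert_commute)
  qed
  have chord_at_of: "chord_at (v s) \<and> chord_at (v j)" if "chord_pos s j" for s j
    using that unfolding chord_pos_def chord_at_def by blast
  have "\<exists>s j. chord_pos s j"
  proof -
    obtain x where "x \<in> e" using card_t[OF e] by fastforce
    moreover from this obtain k where "k < L" "x = v k" using in_range[OF e] range_v by auto
    ultimately show ?thesis using chord_pos_of[of e k] e not by (meson)
  qed
  then obtain s0 j0 where "chord_pos s0 j0" by blast
  then have "case_prod chord_pos (s0, j0)" by simp
  from ex_has_least_nat[of "case_prod chord_pos", OF this, of "\<lambda>(s, j). j - s"]
  obtain p where p: "case_prod chord_pos p"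
    "\<And>p'. case_prod chord_pos p' \<Longrightarrow> (case p of (s, j) \<Rightarrow> j - s) \<le> (case p' of (s, j) \<Rightarrow> j - s)" by blast
  obtain s j where "p = (s, j)" by fastforce
  with p have sj: "chord_pos s j" and min: "\<And>s' j'. chord_pos s' j' \<Longrightarrow> j - s \<le> j' - s'" by auto
  have lt: "s < j" "j < L" using sj by (simp_all add: chord_pos_def)
  define s' where "s' = (LEAST k. s < k \<and> chord_at (v k))"
  have j: "s < j \<and> chord_at (v j)" using lt chord_at_of[OF sj] by simp
  from LeastI[of "\<lambda>k. s < k \<and> chord_at (v k)", OF this] have s': "s < s'" "chord_at (v s')"
    unfolding s'_def by simp_all
  have "s' \<le> j" unfolding s'_def using j by (rule Least_le)
  have "\<not> chord_at (v k)" if "s < k" "k < s'" for k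
    using not_less_Least[of k "\<lambda>k. s < k \<and> chord_at (v k)"] that by (simp add: s'_def)
  then have "odd (s' - s)" using odd_distance[of s s'] s' chord_at_of[OF sj] by blast
  then have odd: "even s \<noteq> even s'" using s'(1) by auto
  then have "s' < j" using par[OF sj] \<open>s' \<le> j\<close> by (cases "s' = j") auto
  obtain f where f: "f \<in># t" "f \<notin> range (cedge v)" "v s' \<in> f" using s'(2) by (auto simp: chord_at_def)
  have "s' < L" using \<open>s' < j\<close> lt by simp
  from chord_pos_of[OF f this] obtain j' where j': "j' < L" "j' \<noteq> s'"
    "if s' < j' then chord_pos s' j' else chord_pos j' s'" by blast
  \<comment> \<open>By parity \<open>j'\<close> differs from \<open>s\<close> and \<open>j\<close>.
    Inside the interval it gives a shorter chord, against \<open>min\<close>; outside, an effective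
    crossing.\<close>
  have par': "even j' = even s'" using j' par by (auto split: if_splits)
  then have ne: "j' \<noteq> s" "j' \<noteq> j" using odd par[OF sj] by auto
  show False
  proof (cases "s' < j'")
    case True
    then have c: "chord_pos s' j'" using j' by simp
    then have "\<not> j < j'" using cross[OF sj c odd] s'(1) \<open>s' < j\<close> by blast
    then show False using min[OF c] ne s'(1) True by linarith
  next
    case False
    then have c: "chord_pos j' s'" using j' by simp
    have "\<not> j' < s" using cross[OF c sj] odd par' s'(1) \<open>s' < j\<close> by blast
    then show False using min[OF c] ne \<open>s' < j\<close> False j'(2) by linarith
  qed
qed

text \<open>Without chords, membership in \<open>t\<close> alternates along the walk, which fixes
  the parity. There remain the multiplicities: they are at most 2, and an edge of multiplicity 2 has
  two double ends, hence occurs at two positions.\<close>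

lemma subset_part:
  assumes no_chord: "\<And>e. e \<in># t \<Longrightarrow> e \<in> range (cedge v)"
  shows "t \<subseteq># pos_part v {..<L} \<or> t \<subseteq># neg_part v {..<L}"
proof -
  define b where "b \<longleftrightarrow> cedge v 0 \<in># t"
  define J where "J = {i \<in> {..<L}. even i = b}"
  have "\<not> chord_at x" for x using no_chord by (auto simp: chord_at_def)
  then have "cedge v (Suc i) \<in># t \<longleftrightarrow> cedge v i \<notin># t" for i using step(2) by blast
  then have alt: "cedge v i \<in># t \<longleftrightarrow> even i = b" for i
    by (induction i) (auto simp: b_def)
  have "t \<subseteq># image_mset (cedge v) (mset_set J)"
  proof (rule mset_subset_eqI)
    fix e
    have count: "count (image_mset (cedge v) (mset_set J)) e = card {i \<in> J. cedge v i = e}"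
    proof -
      have "finite J" by (simp add: J_def)
      then show ?thesis by (simp add: count_image_mset Int_def vimage_def conj_commute)
    qed
    show "count t e \<le> count (image_mset (cedge v) (mset_set J)) e"
    proof (cases "e \<in># t")
      case True
      then obtain i where i: "i < L" "e = cedge v i" using no_chord range_cedge by auto
      then have iJ: "i \<in> J" using alt True by (simp add: J_def)
      have le2: "count t e \<le> 2"
        using count_le_deg[of "v i" e t] deg_t[of "v i"] i(2)
        by (auto simp: cedge_def split: if_splits)
      have fin: "finite {i \<in> J. cedge v i = e}" by (simp add: J_def)
      show ?thesis
      proof (cases "count t e = 2")
        case True
        then have "double v L (v i)" "double v L (v (Suc i))"
          using double_if_count[of e] i(2) by (auto simp: cedge_def)
        then obtain k where k: "k mod L \<noteq> i mod L" "cedge v k = cedge v i" using double_twice by blast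
        have "even k = even i" using cedge_parity[of k i] k(2) by blast
        then have "k mod L \<in> J" using iJ L_pos by (simp add: J_def even_mod)
        then have "{i, k mod L} \<subseteq> {i \<in> J. cedge v i = e}" using iJ k(2) i(2) by (simp add: cedge_mod)
        then have "card {i, k mod L} \<le> card {i \<in> J. cedge v i = e}" using fin by (intro card_mono)
        moreover have "i \<noteq> k mod L" using k(1) i(1) by auto
        ultimately show ?thesis using le2 count by simp
      next
        case False
        have "{i} \<subseteq> {i \<in> J. cedge v i = e}" using iJ i(2) by simp
        then have "card {i} \<le> card {i \<in> J. cedge v i = e}" using fin by (intro card_mono)
        then show ?thesis using le2 False count by simp
      qed
    qed (simp add: not_in_iff)
  qed
  then show ?thesis unfolding J_def pos_part_def neg_part_def by (cases b) simp_all
qed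

end

subsection \<open>Walks whose fiber has two elements\<close>

text \<open>\<open>pos_part\<close> and \<open>neg_part\<close> with the parity as an argument, so
  that an exchange and its mirror image become one statement.\<close>

definition part :: "(nat \<Rightarrow> 'a) \<Rightarrow> bool \<Rightarrow> nat set \<Rightarrow> 'a set multiset" where
  "part v b I = image_mset (cedge v) (mset_set {i \<in> I. even i = b})"

lemma pos_part_eq: "pos_part v I = part v True I" and neg_part_eq: "neg_part v I = part v False I"
  by (simp_all add: part_def pos_part_def neg_part_def)

lemma part_split: "I \<subseteq> J \<Longrightarrow> finite J \<Longrightarrow> part v b J = part v b I + part v b (J - I)"
proof -
  assume "I \<subseteq> J" "finite J"
  then have "{i \<in> J. even i = b} = {i \<in> I. even i = b} \<union> {i \<in> J - I. even i = b}"
    and "finite I" by (auto intro: finite_subset)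
  then show ?thesis using \<open>finite J\<close>
    by (simp add: part_def mset_set_Union disjoint_iff)
qed

lemma in_part_iff: "finite I \<Longrightarrow> e \<in># part v b I \<longleftrightarrow> (\<exists>i\<in>I. even i = b \<and> e = cedge v i)"
  by (auto simp: part_def)

text \<open>Positions of equal parity are never consecutive, also across the end as \<open>L\<close>
  is even. So the two edges share no single occurrence of \<open>x\<close>.\<close>

lemma double_if_csink:
  assumes "even L" "0 < L" "csink v L B x"
  shows "double v L x"
proof -
  obtain i j where ij: "i mod L \<noteq> j mod L" "even i = even j" "x \<in> cedge v i" "x \<in> cedge v j"
    using assms(3) by (auto simp: csink_def)
  have even_mod: "even (k mod L) = even k" for k using assms(1) by (simp add: dvd_mod_iff)
  obtain i' where i': "i' \<in> {i, Suc i}" "v i' = x" using ij(3) by (auto simp: cedge_def)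
  obtain j' where j': "j' \<in> {j, Suc j}" "v j' = x" using ij(4) by (auto simp: cedge_def)
  have "i' mod L \<noteq> j' mod L"
  proof
    assume eq: "i' mod L = j' mod L"
    then have "even i' = even j'" by (metis even_mod)
    then consider "i' = i" "j' = j" | "i' = i + 1" "j' = j + 1" using i'(1) j'(1) ij(2) by auto
    then show False using eq ij(1) by cases (auto simp: nat_mod_eq_iff)
  qed
  then show ?thesis using i'(2) j'(2) unfolding double_def by blast
qed

lemma (in prim_cycle) part_disjoint: "finite I \<Longrightarrow> finite J \<Longrightarrow> e \<in># part v b I \<Longrightarrow> e \<notin># part v (\<not> b) J"
  using cedge_parity by (fastforce simp: in_part_iff)

text \<open>Stating the fiber condition for both parities makes it invariant under rotation by one
  position, which interchanges the two parts.\<close>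

locale two_fiber_cycle = prim_cycle v L for v :: "nat \<Rightarrow> 'a" and L +
  fixes E :: "'a set set"
  assumes card_E: "e \<in> E \<Longrightarrow> card e = 2"
    and cedge_E: "cedge v i \<in> E"
    and fiber: "set_mset t \<subseteq> E \<Longrightarrow> deg t = deg (part v b {..<L}) \<Longrightarrow> t = part v b {..<L} \<or> t = part v (\<not> b) {..<L}"
begin

lemma shift_Suc_fiber: "two_fiber_cycle (\<lambda>i. v (Suc i)) L E"
proof -
  interpret s: prim_cycle "\<lambda>i. v (Suc i)" L by (rule shift_Suc)
  have part: "part (\<lambda>i. v (Suc i)) b {..<L} = part v (\<not> b) {..<L}" for b
  proof -
    let ?f = "\<lambda>i. Suc i mod L" and ?J = "{i \<in> {..<L}. even i = b}"
    have inj: "inj_on ?f ?J"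
    proof (rule inj_onI)
      fix i j assume "i \<in> ?J" "j \<in> ?J" "?f i = ?f j"
      then show "i = j" by (auto simp: mod_Suc split: if_splits)
    qed
    have "?f ` ?J = {i \<in> {..<L}. even i = (\<not> b)}"
    proof (intro equalityI subsetI)
      fix k assume k: "k \<in> {i \<in> {..<L}. even i = (\<not> b)}"
      show "k \<in> ?f ` ?J"
      proof (cases k)
        case 0
        then show ?thesis using k even_L L_pos by (intro image_eqI[of _ _ "L - 1"]) auto
      next
        case (Suc m)
        then show ?thesis using k by (intro image_eqI[of _ _ m]) auto
      qed
    next
      fix k assume "k \<in> ?f ` ?J"
      then obtain i where "even i = b" "k = ?f i" by blast
      then show "k \<in> {i \<in> {..<L}. even i = (\<not> b)}" using even_mod[of "Suc i"] L_pos by simp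
    qed
    then have "part v (\<not> b) {..<L} = image_mset (cedge v) (image_mset ?f (mset_set ?J))"
      using image_mset_mset_set[OF inj] by (simp add: part_def)
    moreover have "cedge (\<lambda>i. v (Suc i)) = (\<lambda>i. cedge v (Suc i))"
      by (rule ext) (simp add: cedge_def)
    then have "image_mset (cedge v) (image_mset ?f (mset_set ?J)) = image_mset (cedge (\<lambda>i. v (Suc i))) (mset_set ?J)"
      by (simp add: image_mset.compositionality comp_def cedge_mod)
    ultimately show ?thesis by (simp add: part_def)
  qed
  show ?thesis
  proof
    show "cedge (\<lambda>i. v (Suc i)) i \<in> E" for i
      using cedge_E[of "Suc i"] cedge_shift[of 1 i] by simp
    fix t b assume "set_mset t \<subseteq> E" "deg t = deg (part (\<lambda>i. v (Suc i)) b {..<L})"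
    then show "t = part (\<lambda>i. v (Suc i)) b {..<L} \<or> t = part (\<lambda>i. v (Suc i)) (\<not> b) {..<L}"
      unfolding part by (rule fiber)
  qed (rule card_E)
qed

lemma shift_fiber: "two_fiber_cycle (\<lambda>i. v (i + k)) L E"
proof (induction k)
  case 0
  then show ?case by (simp add: two_fiber_cycle_axioms)
next
  case (Suc k)
  then show ?case using two_fiber_cycle.shift_Suc_fiber by fastforce
qed

text \<open>On \<open>I\<close> the edges of parity \<open>b\<close> are exchanged for those of the
  other parity, and \<open>Q\<close> supplies the missing degrees. The alternating sum over
  \<open>I\<close> is this deficit up to the sign given by \<open>b\<close>.\<close>

lemma swap:
  assumes "I \<subseteq> {..<L}" "set_mset Q \<subseteq> E"
    and sum: "\<And>x. altsum v I x = (if b then 1 else - 1) * int (deg Q x)"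
  shows "part v b ({..<L} - I) + part v (\<not> b) I + Q = part v b {..<L} \<or>
    part v b ({..<L} - I) + part v (\<not> b) I + Q = part v (\<not> b) {..<L}"
proof (rule fiber)
  have fin: "finite I" using assms(1) finite_subset by blast
  show "set_mset (part v b ({..<L} - I) + part v (\<not> b) I + Q) \<subseteq> E"
    using assms(2) cedge_E fin by (auto simp: in_part_iff)
  have "int (deg (part v b I) x) = int (deg (part v (\<not> b) I) x) + int (deg Q x)" for x
    using sum[of x] altsum_eq_deg[OF fin, of v x] unfolding pos_part_eq neg_part_eq
    by (cases b) auto
  then have "deg (part v b I) x = deg (part v (\<not> b) I) x + deg Q x" for x
    by (metis of_nat_add of_nat_eq_iff)
  then show "deg (part v b ({..<L} - I) + part v (\<not> b) I + Q) = deg (part v b {..<L})"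
    using part_split[OF assms(1), of v b] by (simp add: fun_eq_iff)
qed

lemma swap_no_chord:
  assumes "I \<subseteq> {..<L}" "set_mset Q \<subseteq> E" "f \<in># Q"
    and "\<And>x. altsum v I x = (if b then 1 else - 1) * int (deg Q x)"
  shows "f \<in> range (cedge v)"
proof -
  have "f \<in># part v b {..<L} \<or> f \<in># part v (\<not> b) {..<L}"
    using swap[OF assms(1,2,4)] assms(3) by (metis union_iff)
  then show ?thesis by (auto simp: in_part_iff)
qed

text \<open>Exchanging the segment from \<open>q\<close> to \<open>r\<close> and adding
  \<open>{v q, v r}\<close> gives one of the two parts. In the first case the segment has no
  position of the other parity; in the second it contains all positions of the parity of
  \<open>q\<close>. The edge may be a walk edge, as in \<open>adjacent_double0\<close>.\<close>

lemma opposite_parity_adjacent: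
  assumes "q < r" "r < L" "odd (r - q)" "{v q, v r} \<in> E"
  shows "r = Suc q \<or> q = 0 \<and> r = L - 1"
proof -
  let ?I = "{q..<r}" and ?b = "even q" and ?g = "{v q, v r}"
  have par: "even r \<noteq> even q" using assms(1,3) by auto
  have "v q \<noteq> v r" using card_E[OF assms(4)] by auto
  then have "altsum v ?I x = (if ?b then 1 else - 1) * int (deg {#?g#} x)" for x
    using altsum_interval[of q r x] assms(1) par by auto
  then consider "part v ?b ({..<L} - ?I) + part v (\<not> ?b) ?I + {#?g#} = part v ?b {..<L}"
    | "part v ?b ({..<L} - ?I) + part v (\<not> ?b) ?I + {#?g#} = part v (\<not> ?b) {..<L}"
    using swap[of ?I "{#?g#}" ?b] assms by fastforce
  then show ?thesis
  proof cases
    case 1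
    have split: "part v ?b {..<L} = part v ?b ({..<L} - ?I) + part v ?b ?I"
      using assms(2) by (subst part_split[of ?I "{..<L}"]) auto
    have "part v (\<not> ?b) ?I + {#?g#} = part v ?b ?I"
      using 1 unfolding split add.assoc by (rule add_left_imp_eq)
    then have sub: "e \<in># part v ?b ?I" if "e \<in># part v (\<not> ?b) ?I" for e
      using that by (metis union_iff)
    have "Suc q \<notin> ?I"
    proof
      assume "Suc q \<in> ?I"
      then have "cedge v (Suc q) \<in># part v (\<not> ?b) ?I"
        by (auto simp: in_part_iff intro!: bexI[of _ "Suc q"])
      then show False using sub part_disjoint[of ?I ?I] by blast
    qed
    then show ?thesis using assms(1) by simp
  next
    case 2
    then have sub: "e \<in># part v (\<not> ?b) {..<L}" if "e \<in># part v ?b ({..<L} - ?I)" for e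
      using that by (metis union_iff)
    have all: "k \<in> ?I" if "k < L" "even k = even q" for k
    proof (rule ccontr)
      assume "k \<notin> ?I"
      then have "cedge v k \<in># part v ?b ({..<L} - ?I)"
        using that by (auto simp: in_part_iff intro!: bexI[of _ k])
      then show False using sub part_disjoint[of "{..<L} - ?I" "{..<L}"] by blast
    qed
    show ?thesis
    proof (cases "even q")
      case True
      then have "q = 0" using all[of 0] L_pos by simp
      moreover have "L - 2 \<in> ?I" using all[of "L - 2"] True even_L L_gt_2 by simp
      ultimately show ?thesis using assms(2) par by (auto simp: not_less_eq)
    next
      case False
      then have "L - 1 \<in> ?I" using all[of "L - 1"] even_L L_pos by simp
      then have "L - 1 < r" by simp
      then show ?thesis using assms(2) by linarith
    qed
  qed
qed

lemma chord_parity: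
  assumes "q < L" "r < L" "{v q, v r} \<in> E" "{v q, v r} \<notin> range (cedge v)"
  shows "even q = even r"
proof -
  have *: "even q = even r" if "q < r" "r < L" "{v q, v r} \<in> E" "{v q, v r} \<notin> range (cedge v)" for q r
  proof (rule ccontr)
    assume "even q \<noteq> even r"
    then have "odd (r - q)" using that(1) by simp
    with that(1-3) consider "r = Suc q" | "q = 0" "r = L - 1" using opposite_parity_adjacent by blast
    then have "{v q, v r} \<in> range (cedge v)"
    proof cases
      case 1
      then show ?thesis by (auto simp: cedge_def)
    next
      case 2
      then show ?thesis using cedge_last by (metis insert_commute rangeI)
    qed
    then show False using that(4) by simp
  qed
  show ?thesis
  proof (cases q r rule: linorder_cases)
    case greater
    then show ?thesis using *[of r q] assms by (simp add: insert_commute)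
  qed (use * assms in auto)
qed

text \<open>A double vertex occurs at positions of both parities, and a position of the other end
  can agree with only one of them.\<close>

lemma chord_single:
  assumes "e \<in> E" "e \<notin> range (cedge v)" "e \<subseteq> range v" "x \<in> e"
  shows "\<not> double v L x"
proof
  assume "double v L x"
  then obtain i j where ij: "i mod L \<noteq> j mod L" "v i = x" "v j = x" by (auto simp: double_def)
  then have par: "even i \<noteq> even j" using parity_if_v_eq[of i j] by simp
  obtain y where y: "e = {x, y}" using card_E[OF assms(1)] assms(4) by (auto simp: card_2_iff)
  then obtain k where "k < L" "y = v k" using assms(3) range_v by auto
  then show False
    using chord_parity[of "i mod L" k] chord_parity[of "j mod L" k] assms(1,2) ij y par L_pos
    by (auto simp: v_mod even_mod)
qed

lemma chord_not_separated0:
  assumes "{v r, v s} \<in> E" "{v r, v s} \<notin> range (cedge v)" "0 < r" "r < q" "q < s" "s < L" "v 0 = v q"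
  shows False
proof -
  \<comment> \<open>The segments end at \<open>v q\<close> and \<open>v L\<close>, the same vertex,
    whose terms cancel as \<open>q\<close> is odd and \<open>L\<close> even. The ends of the chord
    remain, with equal signs.\<close>
  let ?I = "{r..<q} \<union> {s..<L}" and ?g = "{v r, v s}"
  have q: "odd q" using parity_if_v_eq[of 0 q] assms by auto
  have par: "even r = even s" using chord_parity[of r s] assms by simp
  have vL: "v L = v q" using periodic[of 0] assms(7) by simp
  have "v r \<noteq> v s" using card_E[OF assms(1)] by auto
  have "altsum v ?I x = (if even r then 1 else - 1) * int (deg {#?g#} x)" for x
  proof -
    have "altsum v ?I x = altsum v {r..<q} x + altsum v {s..<L} x"
      using assms by (intro altsum_Un) auto
    then show ?thesis
      using altsum_interval[of r q x] altsum_interval[of s L x] assms(4,6) q par vL even_L \<open>v r \<noteq> v s\<close>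
      by auto
  qed
  then have "?g \<in> range (cedge v)"
    using assms by (intro swap_no_chord[of ?I "{#?g#}" ?g "even r"]) auto
  then show False using assms(2) by simp
qed

lemma chord_not_separated:
  assumes "{x, y} \<in> E" "{x, y} \<notin> range (cedge v)"
  shows "\<not> separated v L x y"
proof
  assume "separated v L x y"
  then obtain p r q s where pos: "p < r" "r < q" "q < s" "s < p + L" "v p = v q" "v r = x" "v s = y"
    unfolding separated_def by blast
  interpret s: two_fiber_cycle "\<lambda>i. v (i + p)" L E by (rule shift_fiber)
  have "0 < r - p" "r - p < q - p" "q - p < s - p" "s - p < L" using pos by auto
  then show False
    using s.chord_not_separated0[of "r - p" "s - p" "q - p"] assms pos
    unfolding range_cedge_shift by simp
qed

lemma no_crossing:
  assumes "s < s'" "s' < j" "j < j'" "j' < L" "odd (s' - s)"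
    and "{v s, v j} \<in> E" "{v s', v j'} \<in> E" "{v s, v j} \<notin> range (cedge v)" "{v s', v j'} \<notin> range (cedge v)"
  shows False
proof -
  \<comment> \<open>Since \<open>s\<close>, \<open>j\<close> have one parity and \<open>s'\<close>,
    \<open>j'\<close> the other, all four endpoints appear with the sign of \<open>s\<close>,
    matching the degrees of the two chords.\<close>
  let ?I = "{s..<s'} \<union> {j..<j'}" and ?Q = "{#{v s, v j}, {v s', v j'}#}"
  have par: "even j = even s" "even j' = even s'" "even s' \<noteq> even s"
    using chord_parity[of s j] chord_parity[of s' j'] assms by auto
  have ne: "v s \<noteq> v j" "v s' \<noteq> v j'" using card_E[OF assms(6)] card_E[OF assms(7)] by auto
  have "altsum v ?I x = (if even s then 1 else - 1) * int (deg ?Q x)" for x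
  proof -
    have "altsum v ?I x = altsum v {s..<s'} x + altsum v {j..<j'} x"
      using assms by (intro altsum_Un) auto
    moreover have "int (deg ?Q x) = of_bool (v s = x) + of_bool (v j = x) + of_bool (v s' = x) + of_bool (v j' = x)"
      using ne by auto
    ultimately show ?thesis
      using altsum_interval[of s s' x] altsum_interval[of j j' x] assms(1,3) par by auto
  qed
  then have "{v s, v j} \<in> range (cedge v)"
    using assms by (intro swap_no_chord[of ?I ?Q _ "even s"]) auto
  then show False using assms(8) by simp
qed

text \<open>By \<open>opposite_parity_adjacent\<close>, \<open>y\<close> has an odd position
  cyclically next to \<open>0\<close> and an even one next to \<open>q\<close>, and both lie on the
  same side of \<open>v 0\<close>. A third vertex \<open>z\<close> is then either cut off from
  \<open>v 0\<close> by \<open>y\<close> or cut off from \<open>y\<close> by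
  \<open>v 0\<close>.\<close>

lemma adjacent_double0:
  assumes B: "subgraph B (cgraph v)" "nonseparable B" and edge: "{v 0, y} \<in> edges B"
    and double: "double v L (v 0)" "double v L y" and z: "z \<in> verts B" "z \<noteq> v 0" "z \<noteq> y"
  shows False
proof -
  obtain q where q: "1 < q" "q < L - 1" "v q = v 0" "odd q" using double(1) by (rule double_other)
  have "q < L" using q(2) by linarith
  have in_B: "v 0 \<in> verts B" "y \<in> verts B" using B(1) edge by (auto simp: subgraph_def)
  have "{v 0, y} \<in> range (cedge v)" using B(1) edge by (auto simp: subgraph_def cgraph_def)
  then have E: "{v 0, y} \<in> E" using cedge_E by auto
  obtain i j where ij: "i mod L \<noteq> j mod L" "v i = y" "v j = y" using double(2) by (auto simp: double_def)
  then have "even i \<noteq> even j" using parity_if_v_eq[of i j] by simp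
  then have "\<exists>k<L. v k = y \<and> even k = b" for b
  proof (cases "even i = b")
    case True
    then show ?thesis using ij L_pos by (intro exI[of _ "i mod L"]) (simp add: v_mod even_mod)
  next
    case False
    then show ?thesis using ij L_pos \<open>even i \<noteq> even j\<close>
      by (intro exI[of _ "j mod L"]) (auto simp: v_mod even_mod)
  qed
  then obtain k1 k2 where k1: "k1 < L" "v k1 = y" "even k1" and k2: "k2 < L" "v k2 = y" "odd k2"
    by metis
  have "0 < k2" using k2(3) by (cases k2) auto
  then have k2': "k2 = 1 \<or> k2 = L - 1"
    using opposite_parity_adjacent[of 0 k2] k2 E by auto
  have k1': "k1 = q - 1 \<or> k1 = Suc q"
  proof (cases "k1 < q")
    case True
    then have "odd (q - k1)" using q(4) k1(3) by simp
    then show ?thesis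
      using opposite_parity_adjacent[of k1 q] True k1 q E \<open>q < L\<close>
      by (auto simp: insert_commute)
  next
    case False
    moreover have "k1 \<noteq> q" using q(4) k1(3) by auto
    ultimately have "q < k1" by simp
    moreover from this have "odd (k1 - q)" using q(4) k1(3) by simp
    ultimately show ?thesis using opposite_parity_adjacent[of q k1] k1 q E by auto
  qed
  obtain m where m: "m < L" "z = v m" using z(1) B(1) range_v by (auto simp: subgraph_def cgraph_def)
  have m_ne: "m \<noteq> 0" "m \<noteq> q" "m \<noteq> k1" "m \<noteq> k2" using z(2,3) m(2) q(3) k1(2) k2(2) by metis+
  show False
  proof (cases "k2 = 1")
    case True
    have "k1 \<noteq> Suc q" using sides_disjoint0[of 1 q "Suc q"] q k1 k2 True by auto
    then have k1': "k1 = q - 1" using k1' by simp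
    show False
    proof (cases "m < q")
      case True
      then have pos: "1 < m" "m < q - 1" using m_ne \<open>k2 = 1\<close> k1' by auto
      moreover have "v 1 = v (q - 1)" using k1 k2 \<open>k2 = 1\<close> k1' by simp
      ultimately show False
        using nonseparable_split[OF B, of 1 m "q - 1" q] q z(1) m in_B \<open>q < L\<close> by simp
    next
      case False
      then show False
        using nonseparable_split0[OF B, of 1 q m] m_ne m q z(1) in_B k2 True by simp
    qed
  next
    case False
    then have k2': "k2 = L - 1" using k2' by simp
    have "k1 \<noteq> q - 1" using sides_disjoint0[of "q - 1" q "L - 1"] q k1 k2 k2' by auto
    then have k1': "k1 = Suc q" using k1' by simp
    show False
    proof (cases "m < q")
      case True
      then show False
        using nonseparable_split0[OF B, of m q "Suc q"] m_ne m q z(1) in_B k1 k1' by simp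
    next
      case False
      then have pos: "Suc q < m" "m < L - 1" using m_ne m(1) k1' k2' by auto
      moreover have "v (Suc q) = v (L - 1)" using k1 k2 k2' k1' by simp
      moreover have "v L = v 0" using periodic[of 0] by simp
      ultimately show False
        using nonseparable_split[OF B, of "Suc q" m "L - 1" L] q z(1) m in_B by simp
    qed
  qed
qed

text \<open>Sinks are double vertices, and a cyclic block has a vertex besides the two.\<close>

lemma no_adjacent_csinks:
  assumes B: "cyclic_block (cgraph v) B" and sinks: "csink v L B x" "csink v L B y"
  shows "{x, y} \<notin> edges B"
proof
  assume edge: "{x, y} \<in> edges B"
  have sub: "subgraph B (cgraph v)" "nonseparable B" using B by (auto simp: cyclic_block_def block_def)
  have double: "double v L x" "double v L y" using sinks[THEN double_if_csink[OF even_L L_pos]] .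
  obtain xs where xs: "3 \<le> length xs" "distinct xs" "verts B = set xs"
    using B by (auto simp: cyclic_block_def cycle_graph_def)
  have "card {x, y} < card (set xs)" using xs distinct_card[of xs] card_insert_le_m1[of 2 "{y}" x]
    by (simp add: card_insert_if)
  then have "\<not> set xs \<subseteq> {x, y}" using card_mono[of "{x, y}" "set xs"] by auto
  then obtain z where z: "z \<in> verts B" "z \<noteq> x" "z \<noteq> y" using xs(3) by auto
  obtain k where k: "x = v k" using double(1) by (auto simp: double_def)
  interpret s: two_fiber_cycle "\<lambda>i. v (i + k)" L E by (rule shift_fiber)
  show False
    using s.adjacent_double0[of B y z] sub edge double z
    unfolding cgraph_shift double_shift by (simp add: k)
qed

end

subsection \<open>The characterisation\<close>

context closed_walk
begin

lemma chord_iff: "chord G w f \<longleftrightarrow> f \<in> edges G \<and> f \<subseteq> range v \<and> f \<notin> range (cedge v)"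
  by (simp add: chord_def walk_graph_def set_w set_walk_edges)

text \<open>The two walks have lengths \<open>i + 1 + L - j\<close> and \<open>j + 1 - i\<close>,
  and \<open>L\<close> is even.\<close>

lemma break_lengths:
  assumes "i < j" "j < L"
  shows "odd (walk_length (break_outer w i j)) \<and> odd (walk_length (break_inner w i j)) \<longleftrightarrow> even i = even j"
proof -
  have "walk_length (break_outer w i j) = i + 1 + L - j" "walk_length (break_inner w i j) = j + 1 - i"
    using assms by (simp_all add: walk_length_conv[of "take (Suc i) w @ drop j w"]
        walk_length_conv[of "drop i (take (Suc j) w) @ [w ! i]"]
        break_outer_def break_inner_def length_w)
  then show ?thesis using assms L_even by auto
qed

lemma odd_chord_iff:
  "odd_chord G w f \<longleftrightarrow> chord G w f \<and> \<not> bridge G w f \<and>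
     (\<exists>i j. i < j \<and> j < L \<and> f = {v i, v j} \<and> even i = even j)"
proof -
  have "{w ! i, w ! j} = {v i, v j}" if "i < j" "j < L" for i j
    using that by (simp add: v_le)
  then show ?thesis unfolding odd_chord_def using break_lengths by metis
qed

lemma bridge_iff:
  "bridge G w f \<longleftrightarrow> chord G w f \<and> (\<exists>x y B1 B2. f = {x, y} \<and> block (cgraph v) B1 \<and>
     block (cgraph v) B2 \<and> B1 \<noteq> B2 \<and> x \<in> verts B1 \<and> y \<in> verts B2)"
  by (simp add: bridge_def walk_graph_eq)

lemma sink_iff: "sink w B x \<longleftrightarrow> csink v L B x"
proof
  assume "sink w B x"
  then obtain i j where "i < L" "j < L" "i \<noteq> j" "even i = even j" "cedge v i \<in> edges B" "cedge v j \<in> edges B"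
    "x \<in> cedge v i" "x \<in> cedge v j" unfolding sink_def using cedge_v by metis
  then show "csink v L B x" unfolding csink_def by (metis mod_less)
next
  assume "csink v L B x"
  then obtain i j where ij: "i mod L \<noteq> j mod L" "even i = even j" "cedge v i \<in> edges B" "cedge v j \<in> edges B"
    "x \<in> cedge v i" "x \<in> cedge v j" unfolding csink_def by blast
  have "k mod L < L" "walk_edges w ! (k mod L) = cedge v k" "even (k mod L) = even k" for k
    using cedge_v[of "k mod L"] cedge_v_mod[of k] L_even L_ge_2 by (simp_all add: dvd_mod_iff)
  then show "sink w B x" unfolding sink_def using ij by metis
qed

lemma cross_effectively_iff:
  "cross_effectively G w f f' \<longleftrightarrow> odd_chord G w f \<and> odd_chord G w f' \<and>
     (\<exists>s j s' j'. s < j \<and> j < L \<and> s' < j' \<and> j' < L \<and> f = {v s, v j} \<and> f' = {v s', v j'} \<and>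
        even s \<noteq> even s' \<and> (s < s' \<and> s' < j \<and> j < j' \<or> s' < s \<and> s < j' \<and> j' < j))"
proof -
  have "{w ! i, w ! j} = {v i, v j}" if "i < j" "j < L" for i j
    using that by (simp add: v_le)
  moreover have "odd (int s' - int s) \<longleftrightarrow> even s \<noteq> even s'" for s s' by auto
  ultimately show ?thesis unfolding cross_effectively_def by metis
qed

lemma indispensable_iff:
  assumes "Eplus w \<noteq> Eminus w"
  shows "indispensable G (walk_binomial w :: ('a, 'k::field) edge_poly) \<longleftrightarrow> two_fiber (Eplus w) (Eminus w)"
  unfolding walk_binomial_def
  using indispensable_if_two_fiber[OF balanced_w assms] two_fiber_if_indispensable[OF balanced_w assms]
  by blast

lemma conditions_if_two_fiber:
  assumes ne: "Eplus w \<noteq> Eminus w" and fib: "two_fiber (Eplus w) (Eminus w)"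
  shows "strongly_primitive G w" "\<And>f. chord G w f \<Longrightarrow> odd_chord G w f" "\<not> cross_effectively G w f f'"
proof -
  have prim: "primitive_walk G w" using fib by (rule primitive_if_two_fiber)
  interpret prim_cycle v L using prim ne by (rule prim_cycle_if_primitive)
  have U: "Eplus w = part v True {..<L}" and V: "Eminus w = part v False {..<L}"
    by (simp_all add: Eplus_eq Eminus_eq pos_part_eq neg_part_eq)
  have deg: "deg (part v b {..<L}) = deg (Eplus w)" for b
    using balanced_w by (cases b) (simp_all add: U V balanced_def)
  interpret two_fiber_cycle v L "edges G"
  proof
    fix t b assume t: "set_mset t \<subseteq> edges G" "deg t = deg (part v b {..<L})"
    then have "balanced (Eplus w) t" using balanced_w deg by (simp add: balanced_def)
    then have "t = Eplus w \<or> t = Eminus w" using fib by (simp add: two_fiber_def)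
    then show "t = part v b {..<L} \<or> t = part v (\<not> b) {..<L}" unfolding U V by (cases b) auto
  qed (use edge_card cedge_in_edges in auto)
  show "strongly_primitive G w"
    using prim no_adjacent_csinks by (auto simp: strongly_primitive_def sink_iff walk_graph_eq)
  show "odd_chord G w f" if f: "chord G w f" for f
  proof -
    have fE: "f \<in> edges G" "f \<subseteq> range v" "f \<notin> range (cedge v)" using f by (simp_all add: chord_iff)
    obtain x y where xy: "f = {x, y}" "x \<noteq> y" using edge_card[OF fE(1)] by (auto simp: card_2_iff)
    then obtain i j where ij: "i < L" "j < L" "x = v i" "y = v j" using fE(2) range_v by auto
    have par: "even i = even j" using chord_parity[of i j] ij fE xy by simp
    have "\<exists>i j. i < j \<and> j < L \<and> f = {v i, v j} \<and> even i = even j"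
    proof (cases "i < j")
      case True
      then show ?thesis using ij par xy by blast
    next
      case False
      then have "j < i" using ij xy by (metis linorder_neqE_nat)
      then show ?thesis using ij par xy by (metis insert_commute)
    qed
    moreover have "\<not> bridge G w f"
    proof
      assume "bridge G w f"
      then obtain a b B1 B2 where ab: "f = {a, b}" "block (cgraph v) B1" "block (cgraph v) B2" "B1 \<noteq> B2"
        "a \<in> verts B1" "b \<in> verts B2" unfolding bridge_iff by blast
      have "a \<noteq> b" using ab(1) edge_card[OF fE(1)] by auto
      then show False
        using blocks_eq[of a b B1 B2] chord_single[OF fE(1,3,2)] chord_not_separated[of a b] fE ab by auto
    qed
    ultimately show ?thesis using f by (simp add: odd_chord_iff)
  qed
  show "\<not> cross_effectively G w f f'"
  proof
    assume "cross_effectively G w f f'"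
    then obtain s j s' j' where sj: "j < L" "j' < L" "f = {v s, v j}" "f' = {v s', v j'}" "even s \<noteq> even s'"
      and pos: "s < s' \<and> s' < j \<and> j < j' \<or> s' < s \<and> s < j' \<and> j' < j"
      and "chord G w f" "chord G w f'"
      unfolding cross_effectively_iff odd_chord_iff by blast
    then have E: "{v s, v j} \<in> edges G" "{v s, v j} \<notin> range (cedge v)"
      "{v s', v j'} \<in> edges G" "{v s', v j'} \<notin> range (cedge v)" by (simp_all add: chord_iff)
    from pos show False
    proof
      assume p: "s < s' \<and> s' < j \<and> j < j'"
      then have "odd (s' - s)" using sj(5) by simp
      then show False using no_crossing[of s s' j j'] p sj(2) E by simp
    next
      assume p: "s' < s \<and> s < j' \<and> j' < j"
      then have "odd (s - s')" using sj(5) by simp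
      then show False using no_crossing[of s' s j' j] p sj(1) E by simp
    qed
  qed
qed

lemma two_fiber_if_conditions:
  assumes ne: "Eplus w \<noteq> Eminus w" and strong: "strongly_primitive G w"
    and odd: "\<And>f. chord G w f \<Longrightarrow> odd_chord G w f"
    and cross: "\<And>f f'. f \<noteq> f' \<Longrightarrow> \<not> cross_effectively G w f f'"
  shows "two_fiber (Eplus w) (Eminus w)"
proof -
  have prim: "primitive_walk G w" using strong by (simp add: strongly_primitive_def)
  interpret prim_cycle v L using prim ne by (rule prim_cycle_if_primitive)
  have sinks: "{x, y} \<notin> edges B"
    if "cyclic_block (cgraph v) B" "csink v L B x" "csink v L B y" for B x y
    using strong that unfolding strongly_primitive_def sink_iff walk_graph_eq by blast
  have chord_props: "\<not> double v L x \<and> \<not> separated v L x y"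
    if f: "f \<in> edges G" "f \<subseteq> range v" "f \<notin> range (cedge v)" and xy: "f = {x, y}" for f x y
  proof -
    have chord: "chord G w f" using f by (simp add: chord_iff)
    then have "\<not> bridge G w f" using odd by (simp add: odd_chord_iff)
    then have "B1 = B2" if "block (cgraph v) B1" "block (cgraph v) B2" "x \<in> verts B1" "y \<in> verts B2" for B1 B2
      using that chord xy unfolding bridge_iff by blast
    then show ?thesis
      using single_if_blocks_eq[of x y] not_separated_if_blocks_eq[of x y] f(2) xy by blast
  qed
  have elem: "t = Eplus w \<or> t = Eminus w" if t: "balanced (Eplus w) t" for t
  proof -
    have tE: "set_mset t \<subseteq> edges G" and deg: "deg t = deg (Eplus w)" using t by (auto simp: balanced_def)
    have deg_t: "deg t x = (if double v L x then 2 else if x \<in> range v then 1 else 0)" for x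
    proof -
      have "deg t x = card {i. i < L \<and> v i = x}" using deg deg_pos_part[of x] by (simp add: Eplus_eq)
      moreover have "{i. i < L \<and> v i = x} = {}" if "x \<notin> range v" using that by auto
      ultimately show ?thesis using card_occurrences[of x] by (auto simp: double_def)
    qed
    have t_range: "e \<subseteq> range v" if "e \<in># t" for e
    proof
      fix x assume "x \<in> e"
      then have "deg t x \<noteq> 0" using that deg_pos_iff by metis
      then show "x \<in> range v" using deg_t[of x] by (auto simp: double_def split: if_splits)
    qed
    have chord_t: "\<not> double v L x" "y \<in> e \<Longrightarrow> \<not> separated v L x y"
      if e: "e \<in># t" "e \<notin> range (cedge v)" "x \<in> e" for e x y
    proof -
      have eE: "e \<in> edges G" using e(1) tE by blast
      obtain z where z: "e = {x, z}" using edge_card[OF eE] e(3) by (auto simp: card_2_iff)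
      show single: "\<not> double v L x"
        using chord_props[OF eE t_range[OF e(1)] e(2) z] by simp
      show "\<not> separated v L x y" if "y \<in> e"
      proof (cases "y = x")
        case False
        then have "e = {x, y}" using z that by auto
        then show ?thesis using chord_props[OF eE t_range[OF e(1)] e(2)] by simp
      next
        case True
        show ?thesis
        proof
          assume "separated v L x y"
          then obtain p r q s where "p < r" "r < q" "q < s" "s < p + L" "v p = v q" "v r = x" "v s = x"
            unfolding separated_def True by blast
          then show False using sides_disjoint[of p r q s] by simp
        qed
      qed
    qed
    interpret fiber_element v L t
    proof
      show "card e = 2" if "e \<in># t" for e using that tE edge_card by blast
      show "\<exists>j. j mod L \<noteq> i mod L \<and> cedge v j = cedge v i"
        if "double v L (v i)" "double v L (v (Suc i))" for i
        using double_edge[OF sinks that] .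
    qed (use deg_t chord_t in auto)
    have chord_pos: "odd_chord G w {v s, v j} \<and> even s = even j \<and> \<not> double v L (v s) \<and> \<not> double v L (v j)"
      if sj: "chord_pos s j" for s j
    proof -
      have f: "s < j" "j < L" "{v s, v j} \<in># t" "{v s, v j} \<notin> range (cedge v)"
        using sj by (auto simp: chord_pos_def)
      have single: "\<not> double v L (v s)" "\<not> double v L (v j)" using chord_t(1)[OF f(3,4)] by auto
      have "chord G w {v s, v j}" using f tE t_range[OF f(3)] by (auto simp: chord_iff)
      then have odd: "odd_chord G w {v s, v j}" by (rule odd)
      then obtain a b where ab: "a < b" "b < L" "{v s, v j} = {v a, v b}" "even a = even b"
        unfolding odd_chord_iff by blast
      then have "v a = v s \<and> v b = v j \<or> v a = v j \<and> v b = v s" by (auto simp: doubleton_eq_iff)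
      \<comment> \<open>The ends of the chord occur only once in the walk, so the positions
        witnessing oddness are \<open>s\<close> and \<open>j\<close> themselves.\<close>
      then have "a = s \<and> b = j \<or> a = j \<and> b = s"
        using unique_occurrence[OF single(1)] unique_occurrence[OF single(2)] f(1,2) ab(1,2) by auto
      then show ?thesis using odd single ab(4) by auto
    qed
    have "e \<in> range (cedge v)" if "e \<in># t" for e
    proof (rule no_chord[OF _ _ that])
      show "even s = even j" if "chord_pos s j" for s j using chord_pos[OF that] by simp
      fix s j s' j' assume c: "chord_pos s j" "chord_pos s' j'" and par: "even s \<noteq> even s'"
      show "\<not> (s < s' \<and> s' < j \<and> j < j')"
      proof
        assume pos: "s < s' \<and> s' < j \<and> j < j'"
        have lt: "s < j" "j < L" "s' < j'" "j' < L" using c by (auto simp: chord_pos_def)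
        \<comment> \<open>The hypothesis on crossings concerns two distinct chords.\<close>
        have "{v s, v j} \<noteq> {v s', v j'}"
        proof
          assume "{v s, v j} = {v s', v j'}"
          then have "v s' = v s \<or> v s' = v j" by (auto simp: doubleton_eq_iff)
          then have "s' = s \<or> s' = j"
            using unique_occurrence[of s s'] unique_occurrence[of j s'] chord_pos[OF c(1)] lt pos by auto
          then show False using pos by auto
        qed
        from cross[OF this] have "\<not> cross_effectively G w {v s, v j} {v s', v j'}" .
        moreover have "cross_effectively G w {v s, v j} {v s', v j'}"
          unfolding cross_effectively_iff
          using chord_pos[OF c(1)] chord_pos[OF c(2)] lt pos par by blast
        ultimately show False by (rule notE)
      qed
    qed
    then have sub: "t \<subseteq># Eplus w \<or> t \<subseteq># Eminus w"
      using subset_part by (simp add: Eplus_eq Eminus_eq)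
    \<comment> \<open>Elements of one fiber have equal size, so either inclusion is an
      equality.\<close>
    have "size t = size (Eplus w)" "size t = size (Eminus w)"
      using size_eq_if_deg_eq t balanced_w by (auto simp: balanced_def)
    then show ?thesis using sub by (metis mset_subset_size subset_mset.less_le less_irrefl)
  qed
  have "Eplus w \<inter># Eminus w = {#}"
  proof (rule ccontr)
    assume "Eplus w \<inter># Eminus w \<noteq> {#}"
    then obtain e where "e \<in># Eplus w" "e \<in># Eminus w"
      by (metis multiset_nonemptyE set_mset_inter IntD1 IntD2)
    then show False using part_disjoint[of "{..<L}" "{..<L}" e True] by (simp add: Eplus_eq Eminus_eq pos_part_eq neg_part_eq)
  qed
  then show ?thesis using elem by (simp add: two_fiber_def)
qed

end

theorem theorem4p14:
  fixes G :: "'a ugraph" and w :: "'a list"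
  assumes "simple_graph G" and "connected_graph G"
    and "even_closed_walk G w"
    and "(walk_binomial w :: ('a, 'k::field) edge_poly) \<noteq> 0"
  shows "indispensable G (walk_binomial w :: ('a, 'k) edge_poly) \<longleftrightarrow>
    strongly_primitive G w \<and>
    (\<forall>f. chord G w f \<longrightarrow> odd_chord G w f) \<and>
    (\<nexists>f f'. f \<noteq> f' \<and> chord G w f \<and> chord G w f' \<and> cross_effectively G w f f')"
proof -
  interpret closed_walk G w using assms(1,3) by unfold_locales
  have ne: "Eplus w \<noteq> Eminus w" using assms(4) by (auto simp: walk_binomial_def)
  have "chord G w f \<and> chord G w f'" if "cross_effectively G w f f'" for f f'
    using that by (simp add: cross_effectively_def odd_chord_def)
  then show ?thesis
    unfolding indispensable_iff[OF ne]
    using conditions_if_two_fiber[OF ne] two_fiber_if_conditions[OF ne] by blast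
qed

end
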